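(* Let $G=(V,E)$ be a finite simple graph with a fixed total order on $V$, and $\lambda$ a partition. Let $c'_\lambda$ be the coefficient of $\overline{p}'_\lambda$ in the $\overline{p}'$-expansion of $\overline{X}_G$. Then $(-1)^{|\lambda|-\ell(\lambda)}c'_\lambda$ equals the number of families $(M_k)_{k\ge1}$ such that: for $k$ odd, $M_k$ is a set of $i_k(\lambda)$ distinct Lyndon heaps of size $k$; for $4\mid k$, $M_k$ is a multiset of $i_k(\lambda)$ Lyndon heaps of size $k$; for $k\equiv2\pmod 4$, $M_k$ is a multiset of $i_k(\lambda)$ Lyndon heaps each of size $k$ or $k/2$; and every vertex of $G$ is used by some Lyndon heap in some $M_k$. Equivalently, $$(-1)^{|\lambda|-\ell(\lambda)}c'_\lambda=\sum_{W\subseteq V}(-1)^{|V\setminus W|}\prod_{k\text{ odd}}\binom{|\mathcal{L}_{G|_W}(k)|}{i_k(\lambda)}\prod_{4\mid k}\left(\!\!\binom{|\mathcal{L}_{G|_W}(k)|}{i_k(\lambda)}\!\!\right)\prod_{k\equiv2\ (4)}\left(\!\!\binom{|\mathcal{L}_{G|_W}(k)|+|\mathcal{L}_{G|_W}(k/2)|}{i_k(\lambda)}\!\!\right),$$ with $\left(\!\binom{n}{r}\!\right)=\binom{n+r-1}{r}$.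
   Context: Graphs are finite, simple; $G|_W$ induced subgraph; $i_k(\lambda)$ = multiplicity of $k$ as a part of $\lambda$. $\overline{X}_G=\sum_\kappa\prod_v\prod_{i\in\kappa(v)}x_i$, summed over proper set colorings $\kappa$ (maps from $V$ to nonempty subsets of $\mathbb{Z}_{>0}$, adjacent vertices getting disjoint sets). The basis $\overline{p}'$: $1+\overline{p}'_k=\prod_{i\ge1}\frac{1}{1-x_i^k}$, $\overline{p}'_\lambda=\prod_i\overline{p}'_{\lambda_i}$; symmetric power series expand uniquely in this basis. Heaps: fix a total order on $V$. A heap on $G$ is an equivalence class of finite words over $V$ under swapping adjacent letters $u\neq v$ nonadjacent in $G$. Size = length; a vertex is used if it occurs. Composition = concatenation. Pieces (letter occurrences) are partially ordered by the transitive closure of: piece $i\prec$ piece $j$ if $i<j$ and the letters are equal or adjacent. A pyramid has a unique minimal piece. Periodic: $H=K^{\circ m}$, $m>1$. Rotation: for a piece $p$, with $V_p$ the heap of pieces $\succeq p$ and $H=U\circ V_p$, $A_p(H)=V_p\circ U$; iterates stabilize at a pyramid $A^\infty_p(H)$ with minimal piece $p$; this defines rotation-equivalence of pyramids, and each class is entirely periodic or entirely aperiodic. Standard word = lexicographically maximal representative. A Lyndon heap is an aperiodic pyramid whose standard word is lexicographically minimal in its rotation class. $\mathcal{L}_G(k)$ = Lyndon heaps of size $k$. *)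

theory Defs
  imports Main "HOL-Library.Multiset"
begin

text \<open>Variables x_0, x_1, ... (indexed by nat; a relabelling of x_1, x_2, ...).
  A monomial is an exponent vector nat => nat with finite support; a formal
  power series is its coefficient function.\<close>

type_synonym mono = "nat \<Rightarrow> nat"
type_synonym pseries = "mono \<Rightarrow> int"

definition finmono :: "mono \<Rightarrow> bool" where
  "finmono \<alpha> \<longleftrightarrow> finite {i. \<alpha> i \<noteq> 0}"

definition mdeg :: "mono \<Rightarrow> nat" where
  "mdeg \<alpha> = (\<Sum>i\<in>{i. \<alpha> i \<noteq> 0}. \<alpha> i)"

definition ps_one :: pseries where
  "ps_one \<alpha> = (if (\<forall>i. \<alpha> i = 0) then 1 else 0)"

definition ps_mult :: "pseries \<Rightarrow> pseries \<Rightarrow> pseries" where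
  "ps_mult f g \<alpha> = (\<Sum>\<beta>\<in>{\<beta>. \<forall>i. \<beta> i \<le> \<alpha> i}. f \<beta> * g (\<lambda>i. \<alpha> i - \<beta> i))"

text \<open>pbar'_k = prod_i 1/(1 - x_i^k) - 1: coefficient 1 on every nonconstant monomial
  all of whose exponents are divisible by k.\<close>
definition pbar1 :: "nat \<Rightarrow> pseries" where
  "pbar1 k \<alpha> = (if (\<exists>i. \<alpha> i \<noteq> 0) \<and> (\<forall>i. k dvd \<alpha> i) then 1 else 0)"

fun pbar_list :: "nat list \<Rightarrow> pseries" where
  "pbar_list [] = ps_one"
| "pbar_list (k # ks) = ps_mult (pbar1 k) (pbar_list ks)"

definition is_partition :: "nat multiset \<Rightarrow> bool" where
  "is_partition lam \<longleftrightarrow> 0 \<notin># lam"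

definition pbar :: "nat multiset \<Rightarrow> pseries" where
  "pbar lam = pbar_list (sorted_list_of_multiset lam)"

text \<open>c is the pbar'-expansion of F (coefficients on partitions; all terms with
  |lambda| > deg alpha vanish at alpha, so each coefficient identity is a finite sum).\<close>
definition is_pbar_expansion :: "pseries \<Rightarrow> (nat multiset \<Rightarrow> int) \<Rightarrow> bool" where
  "is_pbar_expansion F c \<longleftrightarrow>
     (\<forall>lam. \<not> is_partition lam \<longrightarrow> c lam = 0) \<and>
     (\<forall>\<alpha>. finmono \<alpha> \<longrightarrow>
        F \<alpha> = (\<Sum>lam\<in>{lam. is_partition lam \<and> sum_mset lam \<le> mdeg \<alpha>}. c lam * pbar lam \<alpha>))"

definition pbar_coeff :: "pseries \<Rightarrow> nat multiset \<Rightarrow> int" where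
  "pbar_coeff F = (THE c. is_pbar_expansion F c)"

definition simple_graph :: "'a set \<Rightarrow> ('a \<Rightarrow> 'a \<Rightarrow> bool) \<Rightarrow> bool" where
  "simple_graph V E \<longleftrightarrow> finite V \<and> (\<forall>u v. E u v \<longrightarrow> u \<in> V \<and> v \<in> V \<and> u \<noteq> v \<and> E v u)"

definition proper_set_coloring :: "'a set \<Rightarrow> ('a \<Rightarrow> 'a \<Rightarrow> bool) \<Rightarrow> ('a \<Rightarrow> nat set) \<Rightarrow> bool" where
  "proper_set_coloring V E \<kappa> \<longleftrightarrow>
     (\<forall>v. v \<notin> V \<longrightarrow> \<kappa> v = {}) \<and>
     (\<forall>v\<in>V. \<kappa> v \<noteq> {} \<and> finite (\<kappa> v)) \<and>
     (\<forall>u\<in>V. \<forall>v\<in>V. E u v \<longrightarrow> \<kappa> u \<inter> \<kappa> v = {})"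

definition Xbar :: "'a set \<Rightarrow> ('a \<Rightarrow> 'a \<Rightarrow> bool) \<Rightarrow> pseries" where
  "Xbar V E \<alpha> = int (card {\<kappa>. proper_set_coloring V E \<kappa> \<and>
                                (\<forall>i. card {v\<in>V. i \<in> \<kappa> v} = \<alpha> i)})"

text \<open>Heaps are represented by words; heap_eq is the commutation equivalence.\<close>
definition swap_step :: "('a \<Rightarrow> 'a \<Rightarrow> bool) \<Rightarrow> 'a list \<Rightarrow> 'a list \<Rightarrow> bool" where
  "swap_step E xs ys \<longleftrightarrow> (\<exists>as bs u v. xs = as @ u # v # bs \<and> ys = as @ v # u # bs
                                   \<and> u \<noteq> v \<and> \<not> E u v)"

definition heap_eq :: "('a \<Rightarrow> 'a \<Rightarrow> bool) \<Rightarrow> 'a list \<Rightarrow> 'a list \<Rightarrow> bool" where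
  "heap_eq E = (swap_step E)\<^sup>*\<^sup>*"

definition piece_lt :: "('a \<Rightarrow> 'a \<Rightarrow> bool) \<Rightarrow> 'a list \<Rightarrow> nat \<Rightarrow> nat \<Rightarrow> bool" where
  "piece_lt E w = (\<lambda>i j. i < j \<and> j < length w \<and> (w ! i = w ! j \<or> E (w ! i) (w ! j)))\<^sup>+\<^sup>+"

definition piece_le :: "('a \<Rightarrow> 'a \<Rightarrow> bool) \<Rightarrow> 'a list \<Rightarrow> nat \<Rightarrow> nat \<Rightarrow> bool" where
  "piece_le E w i j \<longleftrightarrow> (i = j \<and> j < length w) \<or> piece_lt E w i j"

definition pyramid :: "('a \<Rightarrow> 'a \<Rightarrow> bool) \<Rightarrow> 'a list \<Rightarrow> bool" where
  "pyramid E w \<longleftrightarrow> (\<exists>!p. p < length w \<and> \<not> (\<exists>i. piece_lt E w i p))"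

definition periodic :: "('a \<Rightarrow> 'a \<Rightarrow> bool) \<Rightarrow> 'a list \<Rightarrow> bool" where
  "periodic E w \<longleftrightarrow> (\<exists>K m. m > 1 \<and> heap_eq E w (concat (replicate m K)))"

text \<open>Rotation A_p(H) = V_p o U; afterwards the piece p sits at position 0.\<close>
definition rot_step :: "('a \<Rightarrow> 'a \<Rightarrow> bool) \<Rightarrow> nat \<Rightarrow> 'a list \<Rightarrow> 'a list" where
  "rot_step E p w = nths w {j. piece_le E w p j} @ nths w {j. \<not> piece_le E w p j}"

fun rot_iter :: "('a \<Rightarrow> 'a \<Rightarrow> bool) \<Rightarrow> nat \<Rightarrow> nat \<Rightarrow> 'a list \<Rightarrow> 'a list" where
  "rot_iter E p 0 w = rot_step E p w"
| "rot_iter E p (Suc n) w = rot_step E 0 (rot_iter E p n w)"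

text \<open>rot_rel P Q: Q represents A^infinity_p(P) for some piece p of the pyramid P,
  i.e. the first iterate that is a pyramid with minimal piece p (tracked at
  position 0), after which the iteration is stationary.\<close>
definition rot_rel :: "('a \<Rightarrow> 'a \<Rightarrow> bool) \<Rightarrow> 'a list \<Rightarrow> 'a list \<Rightarrow> bool" where
  "rot_rel E P Q \<longleftrightarrow> pyramid E P \<and>
     (\<exists>p n. p < length P \<and>
        (\<forall>j < length (rot_iter E p n P). piece_le E (rot_iter E p n P) 0 j) \<and>
        heap_eq E (rot_iter E p n P) Q)"

definition rot_equiv :: "('a \<Rightarrow> 'a \<Rightarrow> bool) \<Rightarrow> 'a list \<Rightarrow> 'a list \<Rightarrow> bool" where
  "rot_equiv E = equivclp (\<lambda>x y. pyramid E x \<and> (heap_eq E x y \<or> rot_rel E x y))"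

definition std_word :: "('a::linorder \<Rightarrow> 'a \<Rightarrow> bool) \<Rightarrow> 'a list \<Rightarrow> 'a list" where
  "std_word E w = (THE s. heap_eq E w s \<and> (\<forall>t. heap_eq E w t \<longrightarrow> lexordp_eq t s))"

definition lyndon :: "('a::linorder \<Rightarrow> 'a \<Rightarrow> bool) \<Rightarrow> 'a list \<Rightarrow> bool" where
  "lyndon E w \<longleftrightarrow> pyramid E w \<and> \<not> periodic E w \<and>
     (\<forall>u. rot_equiv E w u \<longrightarrow> lexordp_eq (std_word E w) (std_word E u))"

definition induced :: "('a \<Rightarrow> 'a \<Rightarrow> bool) \<Rightarrow> 'a set \<Rightarrow> 'a \<Rightarrow> 'a \<Rightarrow> bool" where
  "induced E W u v \<longleftrightarrow> E u v \<and> u \<in> W \<and> v \<in> W"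

definition lyndon_heaps :: "('a::linorder \<Rightarrow> 'a \<Rightarrow> bool) \<Rightarrow> 'a set \<Rightarrow> nat \<Rightarrow> 'a list set set" where
  "lyndon_heaps E W k = {{ys. heap_eq (induced E W) xs ys} | xs.
       set xs \<subseteq> W \<and> length xs = k \<and> lyndon (induced E W) xs}"

definition heap_used :: "'a list set \<Rightarrow> 'a set" where
  "heap_used H = (\<Union>w\<in>H. set w)"

definition multichoose :: "nat \<Rightarrow> nat \<Rightarrow> nat" where
  "multichoose n r = (n + r - 1) choose r"

definition good_family ::
  "'a::linorder set \<Rightarrow> ('a \<Rightarrow> 'a \<Rightarrow> bool) \<Rightarrow> nat multiset \<Rightarrow> (nat \<Rightarrow> 'a list set multiset) \<Rightarrow> bool" where
  "good_family V E lam M \<longleftrightarrow>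
     M 0 = {#} \<and>
     (\<forall>k\<ge>1. size (M k) = count lam k) \<and>
     (\<forall>k\<ge>1. odd k \<longrightarrow> set_mset (M k) \<subseteq> lyndon_heaps E V k \<and> (\<forall>H. count (M k) H \<le> 1)) \<and>
     (\<forall>k\<ge>1. 4 dvd k \<longrightarrow> set_mset (M k) \<subseteq> lyndon_heaps E V k) \<and>
     (\<forall>k\<ge>1. k mod 4 = 2 \<longrightarrow> set_mset (M k) \<subseteq> lyndon_heaps E V k \<union> lyndon_heaps E V (k div 2)) \<and>
     V \<subseteq> (\<Union>k. \<Union>H\<in>set_mset (M k). heap_used H)"

end

theory Submission
  imports Defs "HOL-Library.FuncSet" "HOL-Computational_Algebra.Formal_Power_Series"
begin

text \<open>Splitting a set colouring into its colour classes and excluding the uncovered vertices gives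
  \<^term>\<open>Xbar V E\<close> as an alternating sum over W of products of the independence polynomials
  I(x) of G|W, one factor for each variable. By Cartier and Foata, I(-t) is the inverse of the generating
  function H(t) of heaps. Marking a piece of a heap yields t H'(t) = H(t) P(t) with P counting pyramids.
  A pyramid is a power of a unique aperiodic one, and the rotation class of an aperiodic pyramid of size d
  has exactly d elements, so the number of pyramids of size n is the sum of d L(d) over d | n with L(d)
  the number of Lyndon heaps. Hence I(t) is the product of (1 - (-t)^k)^L(k), and
  1 + t^k = (1 - t^(2k)) / (1 - t^k) for odd k turns this into powers of the series 1 + pbar'_k.

  Rotation classes are handled algebraically: two pyramids are rotation equivalent iff P X = X Q for
  some heap X supported on P, and Levi's lemma shows that X and Q are determined by the minimal letter
  of Q and the number of its occurrences in X.\<close>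

subsection \<open>Heaps and pyramids\<close>

text \<open>The residue of k modulo 4 enters through the factors (1 + t^k)^L(k) with k odd. Each
  leaves a denominator 1 - t^k, hence a positive power of 1 + pbar'_k and ordinary binomials, and a
  numerator 1 - t^(2k), which joins the factor of index 2k. So exactly the indices congruent to 2
  modulo 4 carry L(k) + L(k/2), and even indices give negative powers of 1 + pbar'_k, whence
  multiset coefficients with a sign. No infinite product and no logarithm is formed: products are
  cut off at the degree of the monomial at hand and compared through the recursion that x f' = -u f
  imposes on coefficients. Rotation is defined on words and positions, while counting needs
  statements about classes. The bridge is that a step from U V to V U is conjugation by U; the
  number of occurrences of the apex v in the total conjugator tells which piece was rotated to the
  bottom, and it stays the same when the rotation is iterated. The coefficients are given by a
  definite description, so uniqueness must be proved: in lowest degree pbar'_lambda is the power sum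
  p_lambda, which is triangular in the monomials.\<close>

abbreviation wpow :: "'a list \<Rightarrow> nat \<Rightarrow> 'a list" where
  "wpow K m \<equiv> concat (replicate m K)"

lemma wpow_add: "wpow K (m + n) = wpow K m @ wpow K n"
  by (induction m) auto

lemma wpow_Suc_right: "wpow K m @ K = K @ wpow K m"
  by (induction m) auto

lemma wpow_mult: "wpow K (m * n) = wpow (wpow K n) m"
  by (induction m) (auto simp: wpow_add)

lemma length_wpow: "length (wpow K m) = m * length K"
  by (induction m) auto

lemma set_wpow_subset: "set (wpow K m) \<subseteq> set K"
  by auto

lemma set_wpow: "m > 0 \<Longrightarrow> set (wpow K m) = set K"
  by (cases m) auto

lemma count_wpow: "count_list (wpow K m) v = m * count_list K v"
  by (induction m) auto

lemma filter_wpow: "filter P (wpow K m) = wpow (filter P K) m"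
  by (induction m) auto

locale heap_graph =
  fixes E :: "'a \<Rightarrow> 'a \<Rightarrow> bool"
  assumes E_sym: "E u v \<Longrightarrow> E v u" and E_irrefl: "\<not> E u u"
begin

abbreviation heq (infix "\<approx>" 50) where "xs \<approx> ys \<equiv> heap_eq E xs ys"

text \<open>Equality counts as dependence, so that the projection onto the pair (u, u) is available;
  it records the multiplicity of u.\<close>

definition dep :: "'a \<Rightarrow> 'a \<Rightarrow> bool" where
  "dep u v \<longleftrightarrow> u = v \<or> E u v"

lemma dep_refl [simp]: "dep u u" by (simp add: dep_def)
lemma dep_sym: "dep u v \<Longrightarrow> dep v u" using E_sym by (auto simp: dep_def)

definition indep :: "'a set \<Rightarrow> 'a set \<Rightarrow> bool" where
  "indep A B \<longleftrightarrow> (\<forall>a\<in>A. \<forall>b\<in>B. \<not> dep a b)"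

lemma indep_empty [simp]: "indep {} B" "indep A {}"
  by (auto simp: indep_def)

section \<open>Two-letter projections as a complete invariant of heaps\<close>

definition proj :: "'a \<Rightarrow> 'a \<Rightarrow> 'a list \<Rightarrow> 'a list" where
  "proj u v xs = filter (\<lambda>x. x = u \<or> x = v) xs"

lemma proj_append [simp]: "proj u v (xs @ ys) = proj u v xs @ proj u v ys"
  by (simp add: proj_def)

lemma proj_wpow: "proj u v (wpow K m) = wpow (proj u v K) m"
  by (simp add: proj_def filter_wpow)

text \<open>Two letters that may be swapped never survive together in a projection onto a dependent
  pair.\<close>

lemma swap_step_proj: "swap_step E xs ys \<Longrightarrow> dep u v \<Longrightarrow> proj u v xs = proj u v ys"
  using E_sym by (auto simp: swap_step_def proj_def dep_def)

lemma heq_imp_proj: "xs \<approx> ys \<Longrightarrow> dep u v \<Longrightarrow> proj u v xs = proj u v ys"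
  unfolding heap_eq_def
  by (induction rule: rtranclp_induct) (auto simp: swap_step_proj)

lemma heq_refl [simp]: "xs \<approx> xs"
  by (simp add: heap_eq_def)

lemma heq_trans [trans]: "xs \<approx> ys \<Longrightarrow> ys \<approx> zs \<Longrightarrow> xs \<approx> zs"
  by (simp add: heap_eq_def)

lemma swap_step_Cons: "swap_step E xs ys \<Longrightarrow> swap_step E (x # xs) (x # ys)"
  unfolding swap_step_def by (metis append_Cons)

lemma heq_Cons: "xs \<approx> ys \<Longrightarrow> x # xs \<approx> x # ys"
  unfolding heap_eq_def
  by (induction rule: rtranclp_induct) (auto intro: swap_step_Cons rtranclp.rtrancl_into_rtrancl)

lemma heq_move_front: "\<forall>a\<in>set as. \<not> dep x a \<Longrightarrow> x # as @ bs \<approx> as @ x # bs"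
proof (induction as)
  case (Cons a as)
  have "x # a # as @ bs \<approx> a # x # as @ bs"
    unfolding heap_eq_def swap_step_def
    by (rule r_into_rtranclp, rule exI[of _ "[]"]) (use Cons.prems in \<open>auto simp: dep_def\<close>)
  also have "\<dots> \<approx> a # as @ x # bs"
    using Cons by (intro heq_Cons) auto
  finally show ?case by simp
qed simp

text \<open>If x heads \<open>xs\<close>, no letter in front of the first x of \<open>ys\<close> can
  depend on x, because it would come first in the projection onto x and that letter. Hence this x
  moves to the front, and the projections still agree once it is removed.\<close>

lemma proj_eq_imp_heq:
  assumes "\<And>u v. dep u v \<Longrightarrow> proj u v xs = proj u v ys"
  shows "xs \<approx> ys"
  using assms
proof (induction xs arbitrary: ys)
  case Nil
  have "ys = []"
  proof (cases ys)
    case (Cons y ys')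
    then show ?thesis using Nil[of y y] by (simp add: proj_def)
  qed simp
  then show ?case by simp
next
  case (Cons x xs)
  have "x \<in> set ys"
  proof (rule ccontr)
    assume "x \<notin> set ys"
    then have "proj x x ys = []" by (auto simp: proj_def filter_empty_conv)
    then show False using Cons.prems[of x x] by (simp add: proj_def)
  qed
  then obtain a b where ys: "ys = a @ x # b" and xa: "x \<notin> set a"
    by (metis split_list_first)
  have ind: "\<not> dep x y" if in_a: "y \<in> set a" for y
  proof
    assume d: "dep x y"
    obtain a1 a2 where a: "a = a1 @ y # a2" "y \<notin> set a1"
      using split_list_first[OF in_a] by auto
    have "proj x y a1 = []" using a xa by (auto simp: proj_def filter_empty_conv)
    moreover have "x \<noteq> y" using in_a xa by auto
    ultimately show False using Cons.prems[OF d] a ys by (simp add: proj_def)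
  qed
  have "xs \<approx> a @ b"
  proof (rule Cons.IH)
    fix u v assume d: "dep u v"
    show "proj u v xs = proj u v (a @ b)"
    proof (cases "x = u \<or> x = v")
      case True
      then have "proj u v a = []" using d ind xa dep_sym
        by (auto simp: proj_def filter_empty_conv)
      then show ?thesis using Cons.prems[OF d] True by (auto simp: ys proj_def)
    next
      case False
      then show ?thesis using Cons.prems[OF d] by (simp add: ys proj_def)
    qed
  qed
  then have "x # xs \<approx> x # a @ b" by (rule heq_Cons)
  also have "\<dots> \<approx> a @ x # b" by (rule heq_move_front) (use ind in auto)
  finally show ?case by (simp add: ys)
qed

text \<open>Reducing to words over two letters turns the congruence and cancellation laws of heaps
  into laws of lists.\<close>

lemma heq_iff_proj: "xs \<approx> ys \<longleftrightarrow> (\<forall>u v. dep u v \<longrightarrow> proj u v xs = proj u v ys)"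
  using heq_imp_proj proj_eq_imp_heq by blast

lemma heq_sym: "xs \<approx> ys \<Longrightarrow> ys \<approx> xs"
  by (simp add: heq_iff_proj)

lemma heq_append: "a \<approx> a' \<Longrightarrow> b \<approx> b' \<Longrightarrow> a @ b \<approx> a' @ b'"
  by (simp add: heq_iff_proj)

lemma heq_cancel_left: "a @ b \<approx> a' @ b' \<Longrightarrow> a \<approx> a' \<Longrightarrow> b \<approx> b'"
  by (simp add: heq_iff_proj)

lemma heq_wpow: "K \<approx> K' \<Longrightarrow> wpow K m \<approx> wpow K' m"
  by (simp add: heq_iff_proj proj_wpow)

lemma heq_commute: "indep (set a) (set b) \<Longrightarrow> a @ b \<approx> b @ a"
proof (induction a)
  case (Cons x a)
  have "x # a @ b \<approx> x # b @ a"
    using Cons by (intro heq_Cons) (auto simp: indep_def)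
  also have "\<dots> \<approx> b @ x # a"
    using Cons.prems by (intro heq_move_front) (auto simp: indep_def)
  finally show ?case by simp
qed simp

lemma heq_mset: "xs \<approx> ys \<Longrightarrow> mset xs = mset ys"
  unfolding heap_eq_def
  by (induction rule: rtranclp_induct) (auto simp: swap_step_def)

lemma heq_length: "xs \<approx> ys \<Longrightarrow> length xs = length ys"
  by (metis heq_mset size_mset)

lemma heq_set: "xs \<approx> ys \<Longrightarrow> set xs = set ys"
  by (metis heq_mset set_mset_mset)

lemma heq_count: "xs \<approx> ys \<Longrightarrow> count_list xs v = count_list ys v"
  by (metis heq_mset count_mset)

lemma heq_Nil_iff [simp]: "[] \<approx> xs \<longleftrightarrow> xs = []" "xs \<approx> [] \<longleftrightarrow> xs = []"
  using heq_length by fastforce+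

section \<open>Levi's lemma for heaps\<close>

lemma heq_Cons_split:
  assumes "x # w \<approx> y"
  obtains a b where "y = a @ x # b" "\<forall>c\<in>set a. \<not> dep x c" "w \<approx> a @ b"
proof -
  have "x \<in> set y" using heq_set[OF assms] by auto
  then obtain a b where y: "y = a @ x # b" and xa: "x \<notin> set a"
    by (metis split_list_first)
  \<comment> \<open>As in \<open>proj_eq_imp_heq\<close>, a letter c before the first x that depends
    on x would head the projection of \<open>y\<close> onto x and c.\<close>
  have ind: "\<not> dep x c" if in_a: "c \<in> set a" for c
  proof
    assume d: "dep x c"
    obtain a1 a2 where a: "a = a1 @ c # a2" "c \<notin> set a1"
      using split_list_first[OF in_a] by auto
    have "proj x c a1 = []" using a xa by (auto simp: proj_def filter_empty_conv)
    moreover have "x \<noteq> c" using in_a xa by auto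
    ultimately show False using heq_imp_proj[OF assms d] a y by (simp add: proj_def)
  qed
  have "x # w \<approx> x # a @ b"
    using heq_trans[OF assms] heq_sym[OF heq_move_front] ind y by blast
  then have "w \<approx> a @ b"
    using heq_cancel_left[of "[x]" w "[x]" "a @ b"] by simp
  then show ?thesis using that y ind by blast
qed

text \<open>The one-letter case of Levi's lemma: the piece x is either a piece of Z, or a piece of T
  that has passed through all of Z.\<close>

lemma heq_Cons_append:
  assumes "x # w \<approx> Z @ T"
  shows "(\<exists>Z'. Z \<approx> x # Z' \<and> w \<approx> Z' @ T) \<or> (indep {x} (set Z) \<and> (\<exists>T'. T \<approx> x # T' \<and> w \<approx> Z @ T'))"
proof -
  obtain a b where ab: "Z @ T = a @ x # b" "\<forall>c\<in>set a. \<not> dep x c" "w \<approx> a @ b"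
    using heq_Cons_split[OF assms] by blast
  from ab(1) obtain c where "Z @ c = a \<and> T = c @ x # b \<or> Z = a @ c \<and> c @ T = x # b"
    by (auto simp: append_eq_append_conv2)
  then consider "Z @ c = a" "T = c @ x # b" | "Z = a" "T = x # b" | c' where "Z = a @ x # c'" "c' @ T = b"
    by (auto simp: append_eq_Cons_conv)
  then show ?thesis
  proof cases
    case 1
    have "T \<approx> x # c @ b" unfolding 1(2)
      by (rule heq_sym, rule heq_move_front) (use ab(2) 1 in auto)
    then show ?thesis using 1 ab(2,3) by (fastforce simp: indep_def)
  next
    case 2
    then show ?thesis using ab(2,3) heq_refl by (auto simp: indep_def)
  next
    case 3
    have "Z \<approx> x # a @ c'" unfolding 3(1)
      by (rule heq_sym, rule heq_move_front) (use ab(2) 3 in auto)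
    then show ?thesis using 3 ab(3) by fastforce
  qed
qed

text \<open>The pieces of the common product fall into four classes: A in X and Z, B in X and T, C
  in Y and Z, D in Y and T. In one factorisation B precedes C, in the other C precedes B, so no
  letter of B depends on a letter of C.\<close>

lemma levi:
  assumes "X @ Y \<approx> Z @ T"
  obtains A B C D where "X \<approx> A @ B" "Y \<approx> C @ D" "Z \<approx> A @ C" "T \<approx> B @ D" "indep (set B) (set C)"
  using assms
proof (induction X arbitrary: Z T thesis)
  case Nil
  show ?case by (rule Nil(1)[of "[]" "[]" Z T]) (use Nil(2) in auto)
next
  case (Cons x X)
  from heq_Cons_append[of x "X @ Y" Z T] Cons.prems(2)
  consider Z' where "Z \<approx> x # Z'" "X @ Y \<approx> Z' @ T"
    | T' where "indep {x} (set Z)" "T \<approx> x # T'" "X @ Y \<approx> Z @ T'"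
    by auto
  then show ?case
  proof cases
    case 1
    obtain A B C D where *: "X \<approx> A @ B" "Y \<approx> C @ D" "Z' \<approx> A @ C" "T \<approx> B @ D" "indep (set B) (set C)"
      using Cons.IH[OF _ 1(2)] by blast
    show ?thesis
      by (rule Cons.prems(1)[of "x # A" B C D])
         (use * 1 in \<open>auto intro: heq_Cons heq_trans\<close>)
  next
    case 2
    obtain A B C D where *: "X \<approx> A @ B" "Y \<approx> C @ D" "Z \<approx> A @ C" "T' \<approx> B @ D" "indep (set B) (set C)"
      using Cons.IH[OF _ 2(3)] by blast
    have s: "set Z = set A \<union> set C" using heq_set[OF *(3)] by auto
    \<comment> \<open>Being independent of Z, the letter x is independent of A and C: it passes
      behind A and joins B.\<close>
    have "x # X \<approx> x # A @ B" using * by (auto intro: heq_Cons)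
    also have "\<dots> \<approx> A @ x # B"
      by (rule heq_move_front) (use 2(1) s in \<open>auto simp: indep_def\<close>)
    finally have 1: "x # X \<approx> A @ x # B" .
    show ?thesis
      by (rule Cons.prems(1)[of A "x # B" C D])
         (use * 1 2 s in \<open>auto intro: heq_Cons heq_trans simp: indep_def\<close>)
  qed
qed

text \<open>Recording letters instead of pieces loses nothing, since two pieces with the same letter
  are comparable.\<close>

definition mins :: "'a list \<Rightarrow> 'a set" where
  "mins w = {x. \<exists>w'. w \<approx> x # w'}"

lemma mins_cong: "w \<approx> w' \<Longrightarrow> mins w = mins w'"
  unfolding mins_def using heq_trans heq_sym by blast

lemma hd_in_mins: "x \<in> mins (x # w)"
  unfolding mins_def using heq_refl by blast

lemma mins_Nil [simp]: "mins [] = {}"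
  by (auto simp: mins_def)

lemma mins_empty_iff: "mins w = {} \<longleftrightarrow> w = []"
  using hd_in_mins by (cases w) auto

lemma mins_append: "mins (a @ b) = mins a \<union> {x \<in> mins b. indep {x} (set a)}"
proof (intro equalityI subsetI)
  fix x assume "x \<in> mins (a @ b)"
  then obtain w where "x # w \<approx> a @ b" using heq_sym by (auto simp: mins_def)
  then show "x \<in> mins a \<union> {x \<in> mins b. indep {x} (set a)}"
    using heq_Cons_append[of x w a b] by (auto simp: mins_def)
next
  fix x assume "x \<in> mins a \<union> {x \<in> mins b. indep {x} (set a)}"
  then consider w where "a \<approx> x # w" | w where "b \<approx> x # w" "indep {x} (set a)"
    by (auto simp: mins_def)
  then show "x \<in> mins (a @ b)"
  proof cases
    case 1
    then show ?thesis using heq_append[of a "x # w" b b] by (auto simp: mins_def)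
  next
    case 2
    have "a @ b \<approx> a @ x # w" using 2 heq_append by auto
    also have "\<dots> \<approx> x # a @ w"
      by (rule heq_sym, rule heq_move_front) (use 2(2) in \<open>auto simp: indep_def\<close>)
    finally show ?thesis by (auto simp: mins_def)
  qed
qed

lemma mins_subset_set: "mins w \<subseteq> set w"
  unfolding mins_def using heq_set by fastforce

lemma mins_Cons: "mins (x # b) = insert x {y \<in> mins b. \<not> dep x y}"
proof -
  have "mins [x] = {x}" using mins_subset_set[of "[x]"] hd_in_mins[of x "[]"] by auto
  then show ?thesis using mins_append[of "[x]" b] dep_sym by (auto simp: indep_def)
qed

lemma finite_mins: "finite (mins w)"
  using mins_subset_set finite_subset by blast

lemma mins_not_dep: "x \<in> mins w \<Longrightarrow> y \<in> mins w \<Longrightarrow> x \<noteq> y \<Longrightarrow> \<not> dep x y"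
  by (induction w) (auto simp: mins_Cons dest: dep_sym)

definition pyr :: "'a \<Rightarrow> 'a list \<Rightarrow> bool" where
  "pyr v w \<longleftrightarrow> mins w = {v}"

lemma pyr_cong: "w \<approx> w' \<Longrightarrow> pyr v w = pyr v w'"
  by (simp add: pyr_def mins_cong)

lemma pyr_not_Nil: "pyr v w \<Longrightarrow> w \<noteq> []"
  by (auto simp: pyr_def)

lemma pyr_hd: "pyr v w \<Longrightarrow> hd w = v"
  unfolding pyr_def by (cases w) (auto simp: mins_Cons)

lemma pyr_in_set: "pyr v w \<Longrightarrow> v \<in> set w"
  using mins_subset_set by (auto simp: pyr_def)

text \<open>A chain that ends in p has a last step, so minimality only concerns direct predecessors
  and the transitive closure disappears.\<close>

lemma piece_lt_minimal:
  assumes "p < length w"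
  shows "(\<exists>i. piece_lt E w i p) \<longleftrightarrow> (\<exists>i<p. dep (w ! i) (w ! p))"
proof
  assume "\<exists>i. piece_lt E w i p"
  then obtain i where "piece_lt E w i p" by blast
  then show "\<exists>i<p. dep (w ! i) (w ! p)"
    unfolding piece_lt_def by cases (auto simp: dep_def)
next
  assume "\<exists>i<p. dep (w ! i) (w ! p)"
  then show "\<exists>i. piece_lt E w i p"
    unfolding piece_lt_def using assms by (auto simp: dep_def intro!: tranclp.r_into_trancl)
qed

lemma in_mins_iff: "x \<in> mins w \<longleftrightarrow> (\<exists>p<length w. w ! p = x \<and> (\<forall>i<p. \<not> dep (w ! i) x))"
proof (induction w)
  case (Cons y w)
  have "(\<exists>p<length (y # w). (y # w) ! p = x \<and> (\<forall>i<p. \<not> dep ((y # w) ! i) x)) \<longleftrightarrow>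
    y = x \<or> (\<exists>p<length w. w ! p = x \<and> \<not> dep y x \<and> (\<forall>i<p. \<not> dep (w ! i) x))"
    unfolding length_Cons Ex_less_Suc2 All_less_Suc2 by auto
  then show ?case using Cons by (auto simp: mins_Cons)
qed simp

text \<open>Minimal positions correspond bijectively to minimal letters. This replaces a condition
  on positions in a word by one that depends only on the heap.\<close>

lemma pyramid_iff: "pyramid E w \<longleftrightarrow> (\<exists>v. pyr v w)"
proof -
  define M where "M = {p. p < length w \<and> (\<forall>i<p. \<not> dep (w ! i) (w ! p))}"
  have inj: "inj_on ((!) w) M"
  proof (rule inj_onI)
    fix p q assume "p \<in> M" "q \<in> M" "w ! p = w ! q"
    then show "p = q" by (cases p q rule: linorder_cases) (force simp: M_def)+
  qed
  have im: "(!) w ` M = mins w"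
    by (auto simp: M_def in_mins_iff)
  have "pyramid E w \<longleftrightarrow> (\<exists>!p. p \<in> M)"
    unfolding pyramid_def M_def by (simp add: piece_lt_minimal cong: conj_cong)
  also have "\<dots> \<longleftrightarrow> card M = 1" by (auto simp: card_1_singleton_iff)
  also have "\<dots> \<longleftrightarrow> card (mins w) = 1" using card_image[OF inj] im by simp
  finally show ?thesis by (simp add: pyr_def card_1_singleton_iff)
qed

text \<open>Started with V = [v], sift collects in V the letters of b that lie above this occurrence of v
  and in U the remaining ones.\<close>

fun sift :: "'a list \<Rightarrow> 'a list \<Rightarrow> 'a list \<Rightarrow> 'a list \<times> 'a list" where
  "sift U V [] = (U, V)"
| "sift U V (x # b) = (if \<exists>y\<in>set V. dep y x then sift U (V @ [x]) b else sift (U @ [x]) V b)"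

lemma sift_append: "sift U V (b @ c) = (case sift U V b of (U', V') \<Rightarrow> sift U' V' c)"
  by (induction U V b rule: sift.induct) auto

text \<open>A letter that is not collected is independent of everything in V and can move left past
  V.\<close>

lemma sift_heq: "sift U V b = (U', V') \<Longrightarrow> U @ V @ b \<approx> U' @ V'"
proof (induction U V b arbitrary: U' V' rule: sift.induct)
  case (2 U V x b)
  show ?case
  proof (cases "\<exists>y\<in>set V. dep y x")
    case True
    then show ?thesis using 2 by auto
  next
    case False
    have "U @ V @ x # b \<approx> U @ x # V @ b"
      by (rule heq_append[OF heq_refl], rule heq_sym, rule heq_move_front)
         (use False dep_sym in blast)
    also have "\<dots> \<approx> U' @ V'" using 2(2)[OF False, of U' V'] 2(3) False by simp
    finally show ?thesis .
  qed
qed simp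

lemma sift_extends: "sift U V b = (U', V') \<Longrightarrow> \<exists>c d. U' = U @ d \<and> V' = V @ c"
proof (induction U V b arbitrary: U' V' rule: sift.induct)
  case (2 U V x b)
  show ?case
  proof (cases "\<exists>y\<in>set V. dep y x")
    case True
    then show ?thesis using 2(1)[OF True, of U' V'] 2(3) by auto
  next
    case False
    then show ?thesis using 2(2)[OF False, of U' V'] 2(3) by auto
  qed
qed simp

lemma sift_pyr: "sift U V b = (U', V') \<Longrightarrow> pyr v V \<Longrightarrow> pyr v V'"
proof (induction U V b arbitrary: U' V' rule: sift.induct)
  case (2 U V x b)
  show ?case
  proof (cases "\<exists>y\<in>set V. dep y x")
    case True
    have "mins [x] \<subseteq> {x}" using mins_subset_set[of "[x]"] by simp
    moreover have "\<not> indep {x} (set V)" using True dep_sym unfolding indep_def by blast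
    ultimately have "pyr v (V @ [x])"
      using 2(4) by (auto simp: pyr_def mins_append)
    then show ?thesis using 2(1)[OF True, of U' V'] 2(3) True by auto
  next
    case False
    then show ?thesis using 2(2)[OF False, of U' V'] 2(3,4) by auto
  qed
qed simp

text \<open>Each further v depends on the v already in V and is collected. So the number of v in U
  remains the number in front of the chosen piece and identifies that piece.\<close>

lemma sift_count: "sift U V b = (U', V') \<Longrightarrow> v \<in> set V \<Longrightarrow> count_list U' v = count_list U v"
proof (induction U V b arbitrary: U' V' rule: sift.induct)
  case (2 U V x b)
  show ?case
  proof (cases "\<exists>y\<in>set V. dep y x")
    case True
    then show ?thesis using 2(1)[OF True, of U' V'] 2(3,4) by auto
  next
    case False
    then have "x \<noteq> v" using 2(4) dep_refl by blast
    then show ?thesis using 2(2)[OF False, of U' V'] 2(3,4) False by auto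
  qed
qed simp

text \<open>Each letter of c was collected because of a letter of V or an earlier letter of c, and
  both are present again when c is read alone.\<close>

lemma sift_again: "sift U V b = (U', V @ c) \<Longrightarrow> sift U0 V c = (U0, V @ c)"
proof (induction U V b arbitrary: U' c rule: sift.induct)
  case (2 U V x b)
  show ?case
  proof (cases "\<exists>y\<in>set V. dep y x")
    case True
    then have *: "sift U (V @ [x]) b = (U', V @ c)" using 2(3) by simp
    then obtain c' where "V @ c = (V @ [x]) @ c'" using sift_extends by blast
    then show ?thesis using 2(1)[OF True, of U' c'] * True by auto
  next
    case False
    then show ?thesis using 2(2)[OF False, of U' c] 2(3) by auto
  qed
qed simp

lemma sift_indep: "sift U V b = (U', V) \<Longrightarrow> indep (set V) (set b)"
proof (induction U V b arbitrary: U' rule: sift.induct)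
  case (2 U V x b)
  show ?case
  proof (cases "\<exists>y\<in>set V. dep y x")
    case True
    then have "sift U (V @ [x]) b = (U', V)" using 2(3) by simp
    then obtain c' where "V = (V @ [x]) @ c'" using sift_extends by blast
    then show ?thesis by simp
  next
    case False
    then show ?thesis using 2(2)[OF False, of U'] 2(3) by (auto simp: indep_def)
  qed
qed simp

lemma pyr_singleton [simp]: "pyr v [v]"
  by (simp add: pyr_def mins_Cons)

subsection \<open>Rotation\<close>

text \<open>Splitting a chain at its last step describes the pieces above p by a scan from left to
  right, which is the form of \<open>sift\<close>.\<close>

lemma piece_le_rec:
  assumes "p < length w"
  shows "piece_le E w p j \<longleftrightarrow> j < length w \<and> (j = p \<or> (\<exists>i<j. piece_le E w p i \<and> dep (w ! i) (w ! j)))"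
proof
  assume "piece_le E w p j"
  then consider "p = j" | "piece_lt E w p j" by (auto simp: piece_le_def)
  then show "j < length w \<and> (j = p \<or> (\<exists>i<j. piece_le E w p i \<and> dep (w ! i) (w ! j)))"
  proof cases
    case 2
    then show ?thesis unfolding piece_lt_def
    proof cases
      case r_into_trancl
      then show ?thesis using assms by (auto simp: piece_le_def dep_def)
    next
      case (trancl_into_trancl i)
      then show ?thesis by (auto simp: piece_le_def piece_lt_def dep_def)
    qed
  qed (use assms in simp)
next
  assume r: "j < length w \<and> (j = p \<or> (\<exists>i<j. piece_le E w p i \<and> dep (w ! i) (w ! j)))"
  show "piece_le E w p j"
  proof (cases "j = p")
    case False
    then obtain i where i: "i < j" "piece_le E w p i" "dep (w ! i) (w ! j)" using r by blast
    define R where "R = (\<lambda>i j. i < j \<and> j < length w \<and> (w ! i = w ! j \<or> E (w ! i) (w ! j)))"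
    have "R i j" using i r by (auto simp: R_def dep_def)
    moreover have "p = i \<or> R\<^sup>+\<^sup>+ p i" using i(2) unfolding piece_le_def piece_lt_def R_def by blast
    ultimately have "R\<^sup>+\<^sup>+ p j"
      using tranclp.r_into_trancl[of R i j] tranclp.trancl_into_trancl[of R p i j] by blast
    then show ?thesis unfolding piece_le_def piece_lt_def R_def by (rule disjI2)
  qed (use r in \<open>simp add: piece_le_def\<close>)
qed

lemma piece_le_snoc:
  assumes "p < length w"
  shows "j < length w \<Longrightarrow> piece_le E (w @ [x]) p j \<longleftrightarrow> piece_le E w p j"
proof (induction j rule: less_induct)
  case (less j)
  have "piece_le E (w @ [x]) p j \<longleftrightarrow> j = p \<or> (\<exists>i<j. piece_le E (w @ [x]) p i \<and> dep (w ! i) (w ! j))"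
  proof -
    have p: "p < length (w @ [x])" using assms by simp
    have "(w @ [x]) ! i = w ! i" if "i \<le> j" for i
      using that less.prems by (simp add: nth_append)
    then show ?thesis
      unfolding piece_le_rec[OF p, of j] using less.prems by (simp cong: conj_cong)
  qed
  also have "\<dots> \<longleftrightarrow> j = p \<or> (\<exists>i<j. piece_le E w p i \<and> dep (w ! i) (w ! j))"
    using less by auto
  also have "\<dots> \<longleftrightarrow> piece_le E w p j"
    unfolding piece_le_rec[OF assms, of j] using less.prems by simp
  finally show ?case .
qed

lemma piece_le_less: "p < length w \<Longrightarrow> piece_le E w p j \<Longrightarrow> j < length w"
  using piece_le_rec by blast

lemma nths_cong_on: "(\<And>i. i < length xs \<Longrightarrow> i \<in> A \<longleftrightarrow> i \<in> B) \<Longrightarrow> nths xs A = nths xs B"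
  unfolding nths_def by (intro arg_cong[where f = "map fst"] filter_cong) (auto simp: set_zip)

text \<open>Induction at the right end: for a newly appended letter, \<open>piece_le_rec\<close> is
  the test by which \<open>sift\<close> decides to collect it.\<close>

lemma nths_piece_le:
  "sift a [v] b = (U, V) \<Longrightarrow>
     nths (a @ v # b) {j. piece_le E (a @ v # b) (length a) j} = V \<and>
     nths (a @ v # b) {j. \<not> piece_le E (a @ v # b) (length a) j} = U"
proof (induction b arbitrary: U V rule: rev_induct)
  case Nil
  have le: "piece_le E (a @ [v]) (length a) j \<longleftrightarrow> j = length a" if "j \<le> length a" for j
    using that
  proof (induction j rule: less_induct)
    case (less j)
    then show ?case by (subst piece_le_rec) auto
  qed
  have "nths (a @ [v]) {j. piece_le E (a @ [v]) (length a) j} = nths (a @ [v]) {length a}"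
    by (rule nths_cong_on) (auto simp: le)
  moreover have "nths (a @ [v]) {j. \<not> piece_le E (a @ [v]) (length a) j} = nths (a @ [v]) {..<length a}"
    by (rule nths_cong_on) (auto simp: le)
  moreover have "nths a {length a} = []"
    using nths_empty nths_cong_on[of a "{length a}" "{}"] by simp
  then have "nths (a @ [v]) {length a} = [v]" by (simp add: nths_append)
  moreover have "nths (a @ [v]) {..<length a} = a" by simp
  moreover have "U = a" "V = [v]" using Nil by auto
  ultimately show ?case by presburger
next
  case (snoc x b)
  define w where "w = a @ v # b"
  define p where "p = length a"
  have p: "p < length w" by (simp add: w_def p_def)
  obtain U' V' where s: "sift a [v] b = (U', V')" by force
  have IH: "nths w {j. piece_le E w p j} = V'" "nths w {j. \<not> piece_le E w p j} = U'"
    using snoc.IH[OF s] by (auto simp: w_def p_def)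
  have V': "set V' = {w ! j |j. piece_le E w p j}"
    using piece_le_less[OF p] by (auto simp flip: IH(1) simp: set_nths)
  have last: "piece_le E (w @ [x]) p (length w) \<longleftrightarrow> (\<exists>y\<in>set V'. dep y x)"
    unfolding V' using p
    by (subst piece_le_rec) (auto simp: piece_le_snoc nth_append dest: piece_le_less[OF p])
  have 1: "nths w {j. piece_le E (w @ [x]) p j} = V'"
    by (subst nths_cong_on[of w _ "{j. piece_le E w p j}"]) (auto simp: piece_le_snoc p IH)
  have 2: "nths w {j. \<not> piece_le E (w @ [x]) p j} = U'"
    by (subst nths_cong_on[of w _ "{j. \<not> piece_le E w p j}"]) (auto simp: piece_le_snoc p IH)
  have "nths (w @ [x]) {j. piece_le E (w @ [x]) p j} = V \<and>
        nths (w @ [x]) {j. \<not> piece_le E (w @ [x]) p j} = U"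
    using snoc.prems by (auto simp: sift_append s nths_append 1 2 last split: if_splits)
  then show ?case by (simp add: w_def p_def)
qed

lemma rot_step_sift: "sift a [v] b = (U, V) \<Longrightarrow> rot_step E (length a) (a @ v # b) = V @ U"
  using nths_piece_le by (simp add: rot_step_def)

text \<open>Translates the stopping condition of \<open>rot_rel\<close>: U is the word of pieces
  that are not above the front piece.\<close>

lemma above_front_iff:
  assumes "sift [] [v] b = (U, V)"
  shows "(\<forall>j<length (v # b). piece_le E (v # b) 0 j) \<longleftrightarrow> U = []"
proof -
  have "U = nths (v # b) {j. \<not> piece_le E (v # b) 0 j}"
    using nths_piece_le[OF assms] by simp
  then have "U = [] \<longleftrightarrow> set (nths (v # b) {j. \<not> piece_le E (v # b) 0 j}) = {}" by simp
  then show ?thesis unfolding set_nths by blast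
qed

lemma heq_partition:
  assumes "indep A B" "set P \<subseteq> A \<union> B"
  shows "P \<approx> filter (\<lambda>x. x \<in> A) P @ filter (\<lambda>x. x \<notin> A) P"
  using assms(2)
proof (induction P)
  case (Cons x P)
  have "x # P \<approx> x # filter (\<lambda>x. x \<in> A) P @ filter (\<lambda>x. x \<notin> A) P"
    using Cons by (intro heq_Cons) auto
  also have "\<dots> \<approx> filter (\<lambda>x. x \<in> A) (x # P) @ filter (\<lambda>x. x \<notin> A) (x # P)"
  proof (cases "x \<in> A")
    case False
    have "x # filter (\<lambda>x. x \<in> A) P @ filter (\<lambda>x. x \<notin> A) P \<approx>
      filter (\<lambda>x. x \<in> A) P @ x # filter (\<lambda>x. x \<notin> A) P"
      by (rule heq_move_front) (use False Cons.prems assms(1) dep_sym in \<open>auto simp: indep_def\<close>)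
    then show ?thesis using False by simp
  qed simp
  finally show ?case .
qed simp

text \<open>If A and B were both nonempty, P could be sorted as A-letters before B-letters and also
  the other way round. Both halves would then have v as their minimal letter, although A and B are
  disjoint.\<close>

lemma pyr_connected:
  assumes "pyr v P" "indep A B" "set P = A \<union> B"
  shows "A = {} \<or> B = {}"
proof (rule ccontr)
  assume n: "\<not> (A = {} \<or> B = {})"
  define a where "a = filter (\<lambda>x. x \<in> A) P"
  define b where "b = filter (\<lambda>x. x \<notin> A) P"
  have P: "P \<approx> a @ b" unfolding a_def b_def
    using heq_partition assms by blast
  have sa: "set a = A" "set b = B"
  proof -
    have "A \<inter> B = {}" using assms(2) dep_refl unfolding indep_def by blast
    then show "set a = A" "set b = B" using assms(3) by (auto simp: a_def b_def)
  qed
  have ab: "P \<approx> b @ a" using P heq_commute[of a b] assms(2) sa heq_trans by blast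
  have "mins a \<subseteq> {v}" "mins b \<subseteq> {v}"
    using assms(1) mins_cong[OF P] mins_cong[OF ab] by (auto simp: pyr_def mins_append)
  then have "v \<in> A" "v \<in> B"
    using n sa mins_empty_iff mins_subset_set by (metis set_empty subset_singletonD insert_subset)+
  then show False using assms(2) dep_refl unfolding indep_def by blast
qed

text \<open>The support condition makes conjugators comparable: any letter independent of all of P
  could otherwise be appended to X.\<close>

definition conjug :: "'a list \<Rightarrow> 'a list \<Rightarrow> bool" where
  "conjug P Q \<longleftrightarrow> (\<exists>X. set X \<subseteq> set P \<and> P @ X \<approx> X @ Q)"

lemma conj_mset: "P @ X \<approx> X @ Q \<Longrightarrow> mset P = mset Q"
  using heq_mset by fastforce

lemma conj_set: "P @ X \<approx> X @ Q \<Longrightarrow> set P = set Q"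
  using conj_mset by (metis set_mset_mset)

lemma conj_trans: "P @ X \<approx> X @ Q \<Longrightarrow> Q @ Y \<approx> Y @ R \<Longrightarrow> P @ X @ Y \<approx> X @ Y @ R"
proof -
  assume a: "P @ X \<approx> X @ Q" "Q @ Y \<approx> Y @ R"
  have "(P @ X) @ Y \<approx> (X @ Q) @ Y" by (rule heq_append[OF a(1) heq_refl])
  also have "(X @ Q) @ Y = X @ Q @ Y" by simp
  also have "\<dots> \<approx> X @ Y @ R" by (rule heq_append[OF heq_refl a(2)])
  finally show ?thesis by simp
qed

lemma conjug_heq: "P \<approx> Q \<Longrightarrow> conjug P Q"
  unfolding conjug_def by (rule exI[of _ "[]"]) simp

lemma conjug_trans: "conjug P Q \<Longrightarrow> conjug Q R \<Longrightarrow> conjug P R"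
  unfolding conjug_def
proof (elim exE conjE)
  fix X Y assume a: "P @ X \<approx> X @ Q" "Q @ Y \<approx> Y @ R" "set X \<subseteq> set P" "set Y \<subseteq> set Q"
  then show "\<exists>X. set X \<subseteq> set P \<and> P @ X \<approx> X @ R"
    using conj_trans[OF a(1,2)] conj_set[OF a(1)] by (intro exI[of _ "X @ Y"]) auto
qed

text \<open>A rotation step is the conjugation (U V) U = U (V U), and conjugators of successive
  steps multiply. Later steps rotate around the v in front, with no v in U, so only the first step
  contributes occurrences of v to X. Y collects the conjugators of the way back.\<close>

lemma rot_iter_inv:
  assumes P: "P = a @ v # b"
  shows "\<exists>X Y b'. rot_iter E (length a) k P = v # b' \<and> P @ X \<approx> X @ v # b' \<and> set X \<subseteq> set P \<and>
    count_list X v = count_list a v \<and> (v # b') @ Y \<approx> Y @ P \<and> set Y \<subseteq> set P"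
proof (induction k)
  case 0
  obtain U V where s: "sift a [v] b = (U, V)" by force
  obtain c where c: "V = v # c" using sift_extends[OF s] by auto
  have h: "P \<approx> U @ V" using sift_heq[OF s] by (simp add: P)
  have 1: "P @ U \<approx> U @ V @ U" using heq_append[OF h, of U U] by simp
  have 2: "V @ U @ V \<approx> V @ P" using heq_append[OF heq_refl heq_sym[OF h]] by simp
  have 3: "set P = set U \<union> set V" using heq_set[OF h] by auto
  have 4: "count_list U v = count_list a v" using sift_count[OF s] by simp
  show ?case
    by (rule exI[of _ U], rule exI[of _ V], rule exI[of _ "c @ U"])
       (use 1 2 3 4 c rot_step_sift[OF s] in \<open>auto simp: P\<close>)
next
  case (Suc k)
  then obtain X Y b' where IH: "rot_iter E (length a) k P = v # b'" "P @ X \<approx> X @ v # b'"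
    "set X \<subseteq> set P" "count_list X v = count_list a v" "(v # b') @ Y \<approx> Y @ P" "set Y \<subseteq> set P"
    by blast
  obtain U V where s: "sift [] [v] b' = (U, V)" by force
  obtain c where c: "V = v # c" using sift_extends[OF s] by auto
  have h: "v # b' \<approx> U @ V" using sift_heq[OF s] by simp
  have st: "set P = set U \<union> set V" using heq_set[OF h] conj_set[OF IH(2)] by auto
  have r: "rot_iter E (length a) (Suc k) P = V @ U"
    using rot_step_sift[OF s] IH(1) by simp
  have "(v # b') @ U \<approx> U @ V @ U" using heq_append[OF h heq_refl] by simp
  from conj_trans[OF IH(2) this] have 1: "P @ X @ U \<approx> X @ U @ V @ U" .
  have "(V @ U) @ V \<approx> V @ (v # b')" using heq_append[OF heq_refl heq_sym[OF h]] by simp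
  from conj_trans[OF this IH(5)] have 2: "(V @ U) @ V @ Y \<approx> V @ Y @ P" .
  have 4: "count_list U v = 0" using sift_count[OF s] by simp
  show ?case
    by (rule exI[of _ "X @ U"], rule exI[of _ "V @ Y"], rule exI[of _ "c @ U"])
       (use r 1 2 4 st IH c in auto)
qed

text \<open>As long as some piece is not above the front piece, a rotation step increases the
  number of pieces above it, since the support of a pyramid is connected.\<close>

lemma rot_iter_stabilises:
  assumes P: "P = a @ v # b" and pyr: "pyr u P"
  shows "\<exists>k b' V. rot_iter E (length a) k P = v # b' \<and> sift [] [v] b' = ([], V)"
proof (rule ccontr)
  assume neg: "\<not> ?thesis"
  have "\<exists>b' U V. rot_iter E (length a) k P = v # b' \<and> sift [] [v] b' = (U, V) \<and> k < length V" for k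
  proof (induction k)
    case 0
    obtain b' where b': "rot_iter E (length a) 0 P = v # b'" using rot_iter_inv[OF P] by blast
    obtain U V where s: "sift [] [v] b' = (U, V)" by force
    then show ?case using b' sift_extends[OF s] by auto
  next
    case (Suc k)
    then obtain b' U V where s: "rot_iter E (length a) k P = v # b'" "sift [] [v] b' = (U, V)" "k < length V"
      by blast
    have "U \<noteq> []" using neg s by auto
    obtain c where c: "V = [v] @ c" using sift_extends[OF s(2)] by auto
    have r: "rot_iter E (length a) (Suc k) P = v # c @ U"
      using rot_step_sift[OF s(2)] s(1) c by simp
    obtain U2 V2 where s2: "sift [] [v] (c @ U) = (U2, V2)" by force
    \<comment> \<open>In the rotated word the letters of c are all collected again, so the scan
      resumes at U with V already collected and can only add to it.\<close>
    have s3: "sift [] V U = (U2, V2)"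
      using s2 sift_again[of "[]" "[v]" b' U c "[]"] s(2) c by (simp add: sift_append)
    obtain d where d: "V2 = V @ d" using sift_extends[OF s3] by auto
    have "d \<noteq> []"
    proof
      assume "d = []"
      then have ind: "indep (set V) (set U)" using sift_indep s3 d by auto
      have "set P = set V \<union> set U"
        using rot_iter_inv[OF P, of "Suc k"] r c conj_set by fastforce
      from pyr_connected[OF pyr ind this] show False using \<open>U \<noteq> []\<close> c by auto
    qed
    then have "length d \<ge> 1" by (cases d) auto
    then show ?case using r s2 d s(3) by auto
  qed
  from this[of "length P"] obtain b' U V where
    s: "rot_iter E (length a) (length P) P = v # b'" "sift [] [v] b' = (U, V)" "length P < length V"
    by blast
  have "length (v # b') = length P"
    using rot_iter_inv[OF P, of "length P"] s(1) conj_mset by (metis size_mset)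
  moreover have "length (v # b') = length U + length V"
    using heq_length[OF sift_heq[OF s(2)]] by simp
  ultimately show False using s(3) by simp
qed

lemma sift_Nil_pyr: "sift [] [v] b' = ([], V) \<Longrightarrow> pyr v (v # b')"
  using sift_heq[of "[]" "[v]" b' "[]" V] sift_pyr[of "[]" "[v]" b' "[]" V v] pyr_cong by fastforce

text \<open>Every occurrence of v in P gives a rotation with apex v whose conjugator contains as
  many v as precede that occurrence. By \<open>conj_unique\<close> this number characterises the
  result.\<close>

lemma rot_rel_exists:
  assumes P: "P = a @ v # b" and pyr: "pyr u P"
  shows "\<exists>X Q. P @ X \<approx> X @ Q \<and> set X \<subseteq> set P \<and> count_list X v = count_list a v \<and> pyr v Q \<and>
    (\<forall>Q'. Q \<approx> Q' \<longrightarrow> rot_rel E P Q')"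
proof -
  obtain k b' V where k: "rot_iter E (length a) k P = v # b'" "sift [] [v] b' = ([], V)"
    using rot_iter_stabilises[OF assms] by blast
  obtain X where X: "P @ X \<approx> X @ v # b'" "set X \<subseteq> set P" "count_list X v = count_list a v"
    using rot_iter_inv[OF P, of k] k(1) by auto
  have "rot_rel E P Q'" if "v # b' \<approx> Q'" for Q'
    unfolding rot_rel_def
  proof (intro conjI exI)
    show "pyramid E P" using pyr pyramid_iff by blast
    show "length a < length P" by (simp add: P)
    show "\<forall>j<length (rot_iter E (length a) k P). piece_le E (rot_iter E (length a) k P) 0 j"
      unfolding k(1) above_front_iff[OF k(2)] by simp
    show "rot_iter E (length a) k P \<approx> Q'" using k(1) that by simp
  qed
  then show ?thesis using X sift_Nil_pyr[OF k(2)] by blast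
qed

text \<open>Both directions are recorded because \<open>equivclp\<close> may traverse a rotation
  backwards.\<close>

lemma rot_rel_imp:
  assumes "rot_rel E P Q"
  shows "pyramid E Q \<and> conjug P Q \<and> conjug Q P"
proof -
  obtain p n where p: "p < length P"
    "\<forall>j < length (rot_iter E p n P). piece_le E (rot_iter E p n P) 0 j"
    "rot_iter E p n P \<approx> Q"
    using assms by (auto simp: rot_rel_def)
  define a v b where "a = take p P" and "v = P ! p" and "b = drop (Suc p) P"
  have P: "P = a @ v # b" "length a = p"
    using p(1) id_take_nth_drop by (auto simp: a_def v_def b_def)
  obtain X Y b' where X: "rot_iter E (length a) n P = v # b'" "P @ X \<approx> X @ v # b'" "set X \<subseteq> set P"
    "(v # b') @ Y \<approx> Y @ P" "set Y \<subseteq> set P" using rot_iter_inv[OF P(1), of n] by blast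
  obtain U V where s: "sift [] [v] b' = (U, V)" by force
  have "U = []" using above_front_iff[OF s] p(2) X(1) P(2) by simp
  then have "pyr v (v # b')" using s sift_Nil_pyr by simp
  moreover have h: "v # b' \<approx> Q" using X(1) P(2) p(3) by simp
  ultimately have "pyramid E Q" using pyr_cong pyramid_iff by blast
  moreover have "conjug P (v # b')" "conjug (v # b') P"
    using X conj_set[OF X(2)] by (auto simp: conjug_def)
  ultimately show ?thesis using h conjug_heq conjug_trans heq_sym by blast
qed

end

text \<open>Pieces named by a letter and the index among its occurrences. Unlike a position in a
  word, this name survives commutations.\<close>

definition occs :: "'a list \<Rightarrow> ('a \<times> nat) set" where
  "occs w = (SIGMA v:set w. {..<count_list w v})"

lemma card_occs: "card (occs w) = length w"
  by (simp add: occs_def sum_count_set)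

lemma in_occs_iff: "(v, i) \<in> occs w \<longleftrightarrow> i < count_list w v"
  using count_notin[of v w] by (cases "v \<in> set w") (auto simp: occs_def)

lemma occurrence_split: "i < count_list w v \<Longrightarrow> \<exists>a b. w = a @ v # b \<and> count_list a v = i"
proof (induction w arbitrary: i)
  case (Cons x w)
  show ?case
  proof (cases "x = v")
    case True
    show ?thesis
    proof (cases i)
      case 0
      then show ?thesis using True by (intro exI[of _ "[]"] exI[of _ w]) auto
    next
      case (Suc j)
      then obtain a b where "w = a @ v # b" "count_list a v = j"
        using Cons True by fastforce
      then show ?thesis using Suc True by (intro exI[of _ "x # a"] exI[of _ b]) auto
    qed
  next
    case False
    then obtain a b where "w = a @ v # b" "count_list a v = i"
      using Cons by fastforce
    then show ?thesis using False by (intro exI[of _ "x # a"] exI[of _ b]) auto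
  qed
qed simp

lemma count_list_pos_iff: "0 < count_list w v \<longleftrightarrow> v \<in> set w"
  using count_list_0_iff[of w v] by auto

section \<open>Class representatives and factorisations with a pyramid on the right\<close>

context heap_graph
begin

text \<open>With no order on letters in the locale, a class is named by choice; classes are then
  counted as words fixed by \<open>rep\<close>.\<close>

definition rep :: "'a list \<Rightarrow> 'a list" where
  "rep w = (SOME y. w \<approx> y)"

lemma heq_rep: "w \<approx> rep w"
  unfolding rep_def by (rule someI[of _ w]) simp

lemma rep_eq_iff: "rep w = rep w' \<longleftrightarrow> w \<approx> w'"
proof
  assume "w \<approx> w'"
  then have "(\<lambda>y. w \<approx> y) = (\<lambda>y. w' \<approx> y)" using heq_trans heq_sym by blast
  then show "rep w = rep w'" by (simp add: rep_def)
qed (metis heq_rep heq_sym heq_trans)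

lemma rep_rep [simp]: "rep (rep w) = rep w"
  using heq_rep heq_sym rep_eq_iff by blast

lemma heq_subst_left: "X \<approx> A @ C \<Longrightarrow> P \<approx> A \<Longrightarrow> X \<approx> P @ C"
  by (simp add: heq_iff_proj)

lemma heq_subst_right: "X \<approx> C @ D \<Longrightarrow> Q \<approx> D \<Longrightarrow> X \<approx> C @ Q"
  by (simp add: heq_iff_proj)

lemma mins_prefix: "V \<approx> B @ D \<Longrightarrow> mins B \<subseteq> mins V"
  using mins_cong mins_append by blast

lemma pyr_prefix: "pyr v V \<Longrightarrow> V \<approx> B @ D \<Longrightarrow> B \<noteq> [] \<Longrightarrow> pyr v B"
  using mins_prefix[of V B D] mins_empty_iff[of B] by (auto simp: pyr_def)

lemma indep_common: "indep A B \<Longrightarrow> x \<in> A \<Longrightarrow> x \<in> B \<Longrightarrow> False"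
  using dep_refl unfolding indep_def by blast

lemma pyr_wpow: "pyr v Q \<Longrightarrow> 0 < N \<Longrightarrow> pyr v (wpow Q N)"
proof -
  assume a: "pyr v Q" "0 < N"
  then obtain M where N: "N = Suc M" by (cases N) auto
  have "\<not> indep {x} (set Q)" if "x \<in> mins (wpow Q M)" for x
  proof -
    have "x \<in> set Q" using that mins_subset_set[of "wpow Q M"] set_wpow_subset[of M Q] by (meson subsetD)
    then show ?thesis using indep_common by blast
  qed
  then show ?thesis using a(1) N by (auto simp: pyr_def mins_append)
qed

lemma pyr_wpowD: "pyr v (wpow K m) \<Longrightarrow> pyr v K"
proof -
  assume a: "pyr v (wpow K m)"
  then have "K \<noteq> []" "m \<noteq> 0" using pyr_not_Nil[OF a] by auto
  then show ?thesis using pyr_prefix[OF a, of K "wpow K (m - 1)"] by (cases m) auto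
qed

text \<open>In Levi's square B is a left factor of V' and C one of V, so each contains v unless it
  is empty. Equal numbers of v in U and U' make B and C contain v together, which contradicts their
  independence; both are therefore empty.\<close>

lemma pyr_decomp_unique:
  assumes "U @ V \<approx> U' @ V'" "pyr v V" "pyr v V'" "count_list U v = count_list U' v"
  shows "U \<approx> U' \<and> V \<approx> V'"
proof -
  obtain A B C D where l: "U \<approx> A @ B" "V \<approx> C @ D" "U' \<approx> A @ C" "V' \<approx> B @ D" "indep (set B) (set C)"
    using levi[OF assms(1)] by blast
  have B: "B \<noteq> [] \<Longrightarrow> v \<in> set B" using pyr_prefix[OF assms(3) l(4)] pyr_in_set by blast
  have C: "C \<noteq> [] \<Longrightarrow> v \<in> set C" using pyr_prefix[OF assms(2) l(2)] pyr_in_set by blast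
  have "count_list B v = count_list C v"
    using assms(4) heq_count[OF l(1)] heq_count[OF l(3)] by (simp add: count_list_append)
  then have "v \<in> set B \<longleftrightarrow> v \<in> set C" by (metis count_list_0_iff)
  then have "B = []" "C = []" using B C indep_common[OF l(5)] by blast+
  then show ?thesis using l heq_sym heq_trans by (metis append_Nil append_Nil2)
qed

lemma pyr_decomp_exists:
  assumes "w = a @ v # b"
  shows "\<exists>U V. w \<approx> U @ V \<and> pyr v V \<and> count_list U v = count_list a v"
proof -
  obtain U V where s: "sift a [v] b = (U, V)" by force
  have "pyr v V" using sift_pyr[OF s] by simp
  then show ?thesis using sift_heq[OF s] sift_count[OF s, of v] assms by auto
qed

lemma card_pyr_decomp:
  "card {(U, V). rep U = U \<and> rep V = V \<and> w \<approx> U @ V \<and> pyramid E V} = length w"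
proof -
  let ?D = "{(U, V). rep U = U \<and> rep V = V \<and> w \<approx> U @ V \<and> pyramid E V}"
  \<comment> \<open>A factorisation is sent to the name of the piece at the bottom of V: its letter
    and the number of equal letters below it.\<close>
  define f where "f = (\<lambda>(U, V). (hd V, count_list U (hd V)) :: 'a \<times> nat)"
  have pyr: "pyr (hd V) V" if "pyramid E V" for V
    using that pyramid_iff pyr_hd by metis
  have "bij_betw f ?D (occs w)"
    unfolding bij_betw_def
  proof
    show "inj_on f ?D"
    proof (rule inj_onI)
      fix x y assume xy: "x \<in> ?D" "y \<in> ?D" "f x = f y"
      obtain U V U' V' where [simp]: "x = (U, V)" "y = (U', V')" by (cases x, cases y) auto
      have "U @ V \<approx> U' @ V'" using xy heq_trans[OF heq_sym[of w "U @ V"]] by simp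
      then have "U \<approx> U' \<and> V \<approx> V'"
        using pyr_decomp_unique[of U V U' V' "hd V"] pyr[of V] pyr[of V'] xy by (auto simp: f_def)
      then have "rep U = rep U'" "rep V = rep V'" using rep_eq_iff by auto
      then show "x = y" using xy by auto
    qed
    show "f ` ?D = occs w"
    proof (intro equalityI subsetI)
      fix x assume "x \<in> f ` ?D"
      then obtain U V where x: "x = (hd V, count_list U (hd V))" "w \<approx> U @ V" "pyramid E V"
        by (auto simp: f_def)
      have "hd V \<in> set V" using pyr[OF x(3)] pyr_in_set by blast
      then have "0 < count_list V (hd V)" using count_list_pos_iff by metis
      then show "x \<in> occs w"
        using heq_count[OF x(2), of "hd V"] by (simp add: x(1) in_occs_iff count_list_append)
    next
      fix x assume "x \<in> occs w"
      then obtain v i where x: "x = (v, i)" "i < count_list w v" by (cases x) (auto simp: in_occs_iff)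
      then obtain a b where ab: "w = a @ v # b" "count_list a v = i"
        using occurrence_split[OF x(2)] by auto
      then obtain U V where UV: "w \<approx> U @ V" "pyr v V" "count_list U v = i"
        using pyr_decomp_exists[OF ab(1)] by auto
      have "w \<approx> rep U @ rep V" using heq_trans[OF UV(1) heq_append[OF heq_rep heq_rep]] .
      moreover have "pyr v (rep V)" using UV(2) pyr_cong[OF heq_rep] by simp
      moreover have "count_list (rep U) v = i" using UV(3) heq_count[OF heq_rep[of U]] by simp
      ultimately show "x \<in> f ` ?D"
        using x pyr_hd by (intro image_eqI[of _ _ "(rep U, rep V)"]) (auto simp: f_def pyramid_iff)
    qed
  qed
  from bij_betw_same_card[OF this] show ?thesis by (simp add: card_occs)
qed

subsection \<open>Conjugacy classes of pyramids\<close>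

lemma conj_wpow: "P @ X \<approx> X @ Q \<Longrightarrow> wpow P N @ X \<approx> X @ wpow Q N"
proof (induction N)
  case (Suc N)
  have "wpow P (Suc N) @ X = P @ wpow P N @ X" by simp
  also have "\<dots> \<approx> P @ X @ wpow Q N" by (rule heq_append[OF heq_refl Suc.IH[OF Suc.prems]])
  also have "\<dots> = (P @ X) @ wpow Q N" by simp
  also have "\<dots> \<approx> (X @ Q) @ wpow Q N" by (rule heq_append[OF Suc.prems heq_refl])
  finally show ?case by simp
qed simp

text \<open>Levi's lemma applied to P^N X = X Q^N. Once the overlap C is empty, X splits off P^N on
  the left, and the remainder is a left factor of Q^N and so has apex v.\<close>

lemma conj_prefix:
  assumes "P @ X \<approx> X @ Q" "pyr v Q" "set X \<subseteq> set P" "length X < N"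
  shows "\<exists>Y. wpow P N \<approx> X @ Y \<and> pyr v Y"
proof -
  obtain A B C D where l: "wpow P N \<approx> A @ B" "X \<approx> C @ D" "X \<approx> A @ C" "wpow Q N \<approx> B @ D"
    "indep (set B) (set C)"
    using levi[OF conj_wpow[OF assms(1), of N]] by blast
  \<comment> \<open>A letter of P occurs at least N times in P^N, but A has at most
    \<open>length X\<close> pieces, fewer than N. So every letter of P is left over for B, and C,
    supported on P and independent of B, is empty.\<close>
  have sub: "set P \<subseteq> set B"
  proof
    fix u assume "u \<in> set P"
    then have "0 < count_list P u" using count_list_pos_iff by metis
    then have "N \<le> N * count_list P u" by simp
    also have "\<dots> = count_list A u + count_list B u"
      using heq_count[OF l(1), of u] by (simp add: count_wpow count_list_append)
    also have "count_list A u < N"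
      using count_le_length[of A u] heq_length[OF l(3)] assms(4) by simp
    finally show "u \<in> set B" using count_list_pos_iff[of B u] by simp
  qed
  have "set C \<subseteq> set P" using heq_set[OF l(2)] assms(3) by auto
  then have C: "C = []" using sub indep_common[OF l(5)] by (metis subsetD list.set_intros(1) neq_Nil_conv)
  have "B \<noteq> []" using sub conj_set[OF assms(1)] pyr_in_set[OF assms(2)] by auto
  then have "pyr v B" using pyr_prefix[OF pyr_wpow[OF assms(2)] l(4)] assms(4) by simp
  moreover have "wpow P N \<approx> X @ B"
    using l(1) heq_append[OF heq_sym[OF l(3)] heq_refl[of B]] C heq_trans by auto
  ultimately show ?thesis by blast
qed

text \<open>Both conjugators split off the same sufficiently high power of P and leave a pyramid
  with apex v, so \<open>pyr_decomp_unique\<close> applies.\<close>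

lemma conj_unique:
  assumes "P @ X \<approx> X @ Q" "pyr v Q" "set X \<subseteq> set P"
    and "P @ X' \<approx> X' @ Q'" "pyr v Q'" "set X' \<subseteq> set P"
    and "count_list X v = count_list X' v"
  shows "X \<approx> X' \<and> Q \<approx> Q'"
proof -
  define N where "N = Suc (length X + length X')"
  obtain Y where Y: "wpow P N \<approx> X @ Y" "pyr v Y" using conj_prefix[OF assms(1-3), of N] N_def by auto
  obtain Y' where Y': "wpow P N \<approx> X' @ Y'" "pyr v Y'" using conj_prefix[OF assms(4-6), of N] N_def by auto
  have X: "X \<approx> X'"
    using pyr_decomp_unique[of X Y X' Y' v] Y Y' assms(7) heq_trans heq_sym by blast
  have "X @ Q \<approx> P @ X" by (rule heq_sym[OF assms(1)])
  also have "\<dots> \<approx> P @ X'" by (rule heq_append[OF heq_refl X])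
  also have "\<dots> \<approx> X' @ Q'" by (rule assms(4))
  finally have "Q \<approx> Q'" using X heq_cancel_left by blast
  with X show ?thesis ..
qed

text \<open>If B is empty, P itself is a left factor of X and is cancelled. Otherwise v lies in B
  and not in C, so all v of X lie in A, and P = A B contains at least one more.\<close>

lemma conj_reduce:
  assumes "P @ X \<approx> X @ Q" "pyr v Q" "set X \<subseteq> set P"
  shows "\<exists>X'. P @ X' \<approx> X' @ Q \<and> set X' \<subseteq> set P \<and> count_list X' v < count_list P v"
  using assms
proof (induction "length X" arbitrary: X rule: less_induct)
  case less
  obtain A B C D where l: "P \<approx> A @ B" "X \<approx> C @ D" "X \<approx> A @ C" "Q \<approx> B @ D" "indep (set B) (set C)"
    using levi[OF less.prems(1)] by blast
  show ?case
  proof (cases "B = []")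
    case True
    have 1: "X \<approx> P @ C" using heq_subst_left[OF l(3), of P] l(1) True by simp
    have 2: "X \<approx> C @ Q" using heq_subst_right[OF l(2), of Q] l(4) True by simp
    have "P @ C \<approx> C @ Q" using 1 2 heq_sym heq_trans by blast
    moreover have "P \<noteq> []" using conj_set[OF less.prems(1)] pyr_in_set[OF less.prems(2)] by auto
    then have "length C < length X" using heq_length[OF 1] by simp
    moreover have "set C \<subseteq> set P" using heq_set[OF l(2)] less.prems(3) by auto
    ultimately show ?thesis using less.hyps less.prems(2) by blast
  next
    case False
    have vB: "v \<in> set B" using pyr_prefix[OF less.prems(2) l(4) False] pyr_in_set by blast
    then have "v \<notin> set C" using indep_common[OF l(5)] by blast
    then have "count_list C v = 0" by simp
    moreover have "0 < count_list B v" using vB count_list_pos_iff by metis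
    ultimately have "count_list X v < count_list P v"
      using heq_count[OF l(1), of v] heq_count[OF l(3), of v] by (simp add: count_list_append)
    then show ?thesis using less.prems by blast
  qed
qed

text \<open>Cancel X on the left of X Q Y = P X Y = P^(N+1) = X Y P.\<close>

lemma conj_complement:
  assumes "P @ X \<approx> X @ Q" "wpow P N \<approx> X @ Y"
  shows "Q @ Y \<approx> Y @ P"
proof -
  have "X @ Q @ Y \<approx> P @ X @ Y" using heq_append[OF heq_sym[OF assms(1)] heq_refl[of Y]] by simp
  also have "\<dots> \<approx> P @ wpow P N" by (rule heq_append[OF heq_refl heq_sym[OF assms(2)]])
  also have "\<dots> = wpow P N @ P" by (rule wpow_Suc_right[symmetric])
  also have "\<dots> \<approx> X @ Y @ P" using heq_append[OF assms(2) heq_refl] by simp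
  finally show ?thesis using heq_cancel_left heq_refl by blast
qed

lemma conjug_sym:
  assumes "conjug P Q" "pyramid E Q"
  shows "conjug Q P"
proof -
  obtain X v where X: "P @ X \<approx> X @ Q" "set X \<subseteq> set P" "pyr v Q"
    using assms pyramid_iff by (auto simp: conjug_def)
  obtain Y where Y: "wpow P (Suc (length X)) \<approx> X @ Y" using conj_prefix[OF X(1,3,2)] by blast
  have "set Y \<subseteq> set P" using heq_set[OF Y] set_wpow_subset by fastforce
  then show ?thesis using conj_complement[OF X(1) Y] conj_set[OF X(1)] by (auto simp: conjug_def)
qed

text \<open>For the converse a single rotation suffices: after \<open>conj_reduce\<close> the number
  of v in the conjugator is the index of an occurrence of v in P, and by \<open>conj_unique\<close>
  rotating that piece to the bottom yields Q.\<close>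

lemma rot_equiv_iff:
  assumes P: "pyramid E P"
  shows "rot_equiv E P Q \<longleftrightarrow> pyramid E Q \<and> conjug P Q"
proof
  assume "rot_equiv E P Q"
  then show "pyramid E Q \<and> conjug P Q" unfolding rot_equiv_def
  proof (induction rule: equivclp_induct)
    case base
    show ?case using P conjug_heq heq_refl by blast
  next
    case (step y z)
    have "pyramid E z \<and> conjug y z" using step(2)
    proof
      assume "pyramid E y \<and> (y \<approx> z \<or> rot_rel E y z)"
      then show ?thesis using rot_rel_imp conjug_heq pyr_cong pyramid_iff by meson
    next
      assume "pyramid E z \<and> (z \<approx> y \<or> rot_rel E z y)"
      then show ?thesis using rot_rel_imp conjug_heq heq_sym by blast
    qed
    then show ?case using step conjug_trans by blast
  qed
next
  assume Q: "pyramid E Q \<and> conjug P Q"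
  then obtain X v where X: "P @ X \<approx> X @ Q" "set X \<subseteq> set P" "pyr v Q"
    using pyramid_iff by (auto simp: conjug_def)
  obtain X' where X': "P @ X' \<approx> X' @ Q" "set X' \<subseteq> set P" "count_list X' v < count_list P v"
    using conj_reduce[OF X(1,3,2)] by blast
  obtain a b where ab: "P = a @ v # b" "count_list a v = count_list X' v"
    using occurrence_split[OF X'(3)] by blast
  obtain u where u: "pyr u P" using P pyramid_iff by blast
  obtain X2 Q2 where X2: "P @ X2 \<approx> X2 @ Q2" "set X2 \<subseteq> set P" "count_list X2 v = count_list a v" "pyr v Q2"
    "\<forall>Q'. Q2 \<approx> Q' \<longrightarrow> rot_rel E P Q'"
    using rot_rel_exists[OF ab(1) u] by blast
  have "Q2 \<approx> Q" using conj_unique[OF X2(1,4,2) X'(1) X(3) X'(2)] X2(3) ab(2) by simp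
  then have "rot_rel E P Q" using X2(5) by blast
  then show "rot_equiv E P Q" unfolding rot_equiv_def using P by (intro r_into_equivclp) simp
qed

section \<open>Commuting heaps and primitive roots\<close>

lemma comm_root:
  assumes "mins P \<subseteq> {v}" "mins Z \<subseteq> {v}" "P @ Z \<approx> Z @ P"
  shows "\<exists>R a b. P \<approx> wpow R a \<and> Z \<approx> wpow R b"
  using assms
proof (induction "length P + length Z" arbitrary: P Z rule: less_induct)
  case less
  show ?case
  proof (cases "P = [] \<or> Z = []")
    case True
    then have "(P \<approx> wpow Z 0 \<and> Z \<approx> wpow Z 1) \<or> (P \<approx> wpow P 1 \<and> Z \<approx> wpow P 0)" by auto
    then show ?thesis by blast
  next
    case False
    obtain A B C D where l: "P \<approx> A @ B" "Z \<approx> C @ D" "Z \<approx> A @ C" "P \<approx> B @ D" "indep (set B) (set C)"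
      using levi[OF less.prems(3)] by blast
    have mB: "mins B \<subseteq> {v}" and mC: "mins C \<subseteq> {v}"
      using mins_prefix[OF l(4)] mins_prefix[OF l(2)] less.prems by auto
    \<comment> \<open>Nonempty B and C would share v. So one of P and Z is a left factor of the
      other, and cancelling it gives a Euclidean algorithm; \<open>mins P \<subseteq> {v}\<close> in
      place of \<open>pyr v P\<close> lets it end at the empty word.\<close>
    have "B = [] \<or> C = []"
    proof (rule ccontr)
      assume "\<not> ?thesis"
      then have "v \<in> mins B" "v \<in> mins C" using mB mC mins_empty_iff by blast+
      then show False using mins_subset_set indep_common[OF l(5)] by blast
    qed
    then show ?thesis
    proof
      assume B: "B = []"
      have 1: "Z \<approx> P @ C" using heq_subst_left[OF l(3), of P] l(1) B by simp
      have 2: "Z \<approx> C @ P" using heq_subst_right[OF l(2), of P] l(4) B by simp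
      have 3: "length P + length C < length P + length Z" using heq_length[OF 1] False by simp
      have "P @ C \<approx> C @ P" using 1 2 heq_sym heq_trans by blast
      from less.hyps[OF 3 less.prems(1) mC this]
      obtain R a b where R: "P \<approx> wpow R a" "C \<approx> wpow R b" by blast
      have "Z \<approx> wpow R (a + b)" using heq_trans[OF 1 heq_append[OF R]] by (simp add: wpow_add)
      then show ?thesis using R by blast
    next
      assume C: "C = []"
      have 1: "P \<approx> Z @ B" using heq_subst_left[OF l(1), of Z] l(3) C by simp
      have 2: "P \<approx> B @ Z" using heq_subst_right[OF l(4), of Z] l(2) C by simp
      have 3: "length Z + length B < length P + length Z" using heq_length[OF 1] False by simp
      have "Z @ B \<approx> B @ Z" using 1 2 heq_sym heq_trans by blast
      from less.hyps[OF 3 less.prems(2) mB this]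
      obtain R a b where R: "Z \<approx> wpow R a" "B \<approx> wpow R b" by blast
      have "P \<approx> wpow R (a + b)" using heq_trans[OF 1 heq_append[OF R]] by (simp add: wpow_add)
      then show ?thesis using R by blast
    qed
  qed
qed

lemma periodic_Nil: "periodic E []"
  unfolding periodic_def by (intro exI[of _ "[]"] exI[of _ 2]) simp

text \<open>Exponent 0 is excluded because the empty heap counts as periodic.\<close>

lemma aperiodic_root:
  assumes "\<not> periodic E P" "P \<approx> wpow R a"
  shows "a = 1"
proof -
  have "\<not> 1 < a" using assms by (auto simp: periodic_def)
  moreover have "a \<noteq> 0" using assms periodic_Nil by (metis heq_Nil_iff(2) concat.simps(1) replicate_0)
  ultimately show ?thesis by simp
qed

text \<open>A minimal letter of Z is minimal in Z P = P Z. Since it occurs in P, it must be minimal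
  in P already, hence equal to u, and \<open>comm_root\<close> applies.\<close>

lemma commuting_power:
  assumes "pyr u P" "\<not> periodic E P" "set Z \<subseteq> set P" "P @ Z \<approx> Z @ P"
  shows "\<exists>b. Z \<approx> wpow P b"
proof -
  have P: "mins P \<subseteq> {u}" using assms(1) by (simp add: pyr_def)
  have "mins Z \<subseteq> mins (P @ Z)" using mins_prefix[OF assms(4)] .
  moreover have "\<not> indep {z} (set P)" if "z \<in> mins Z" for z
    using that mins_subset_set assms(3) indep_common by blast
  ultimately have Z: "mins Z \<subseteq> {u}" using P by (auto simp: mins_append)
  obtain R a b where R: "P \<approx> wpow R a" "Z \<approx> wpow R b" using comm_root[OF P Z assms(4)] by blast
  have "a = 1" using aperiodic_root[OF assms(2) R(1)] .
  then have "R \<approx> P" using R(1) heq_sym by simp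
  then show ?thesis using R(2) heq_wpow heq_trans by blast
qed

text \<open>With T the common power, both K J and J K are left factors of T T. Their projections
  have equal length, so they agree as prefixes; hence K and J commute and have a common
  root.\<close>

lemma root_unique:
  assumes "pyr v K" "\<not> periodic E K" "pyr v' J" "\<not> periodic E J" "wpow K m \<approx> wpow J l" "0 < m" "0 < l"
  shows "K \<approx> J"
proof -
  obtain m' l' where ml: "m = Suc m'" "l = Suc l'" using assms(6,7) by (metis Suc_pred)
  have "pyr v (wpow J l)" using pyr_wpow[OF assms(1,6)] pyr_cong[OF assms(5)] by simp
  then have vJ: "pyr v J" by (rule pyr_wpowD)
  have "(K @ J) @ wpow J l' @ wpow K m' \<approx> K @ wpow K m @ wpow K m'"
    using heq_append[OF heq_refl[of K] heq_append[OF heq_sym[OF assms(5)] heq_refl]] ml by simp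
  also have "\<dots> = wpow K m @ wpow K m" using wpow_Suc_right[of m' K] ml by simp
  also have "\<dots> \<approx> wpow J l @ wpow J l" by (rule heq_append[OF assms(5,5)])
  also have "\<dots> = J @ wpow J l @ wpow J l'" using wpow_Suc_right[of l' J] ml by simp
  also have "\<dots> \<approx> (J @ K) @ wpow K m' @ wpow J l'"
    using heq_append[OF heq_refl[of J] heq_append[OF heq_sym[OF assms(5)] heq_refl]] ml by simp
  finally have *: "(K @ J) @ wpow J l' @ wpow K m' \<approx> (J @ K) @ wpow K m' @ wpow J l'" .
  have "K @ J \<approx> J @ K"
  proof (rule proj_eq_imp_heq)
    fix u w assume "dep u w"
    then have "proj u w (K @ J) @ proj u w (wpow J l' @ wpow K m') =
      proj u w (J @ K) @ proj u w (wpow K m' @ wpow J l')"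
      using heq_imp_proj[OF *] by simp
    moreover have "length (proj u w (K @ J)) = length (proj u w (J @ K))" by simp
    ultimately show "proj u w (K @ J) = proj u w (J @ K)" using append_eq_append_conv by blast
  qed
  then obtain R a b where R: "K \<approx> wpow R a" "J \<approx> wpow R b"
    using comm_root[of K v J] assms(1) vJ by (auto simp: pyr_def)
  have "a = 1" "b = 1" using aperiodic_root[OF assms(2) R(1)] aperiodic_root[OF assms(4) R(2)] .
  then have "K \<approx> R" "J \<approx> R" using R by auto
  then show ?thesis using heq_sym heq_trans by blast
qed

text \<open>Conjugating K^m amounts to passing some copies of K and then rotating K itself. Dividing
  the number of v in Y by that in K gives K^c followed by a rotation of K into J, with the same
  number of v as Y; \<open>conj_unique\<close> then identifies P with J^m.\<close>

lemma periodic_conjug: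
  assumes "pyramid E P" "pyramid E Q" "conjug P Q" "periodic E Q"
  shows "periodic E P"
proof -
  obtain K m where K: "Q \<approx> wpow K m" "1 < m" using assms(4) by (auto simp: periodic_def)
  obtain u v where u: "pyr u Q" and v: "pyr v P" using assms pyramid_iff by blast
  have uK: "pyr u K" using u K(1) pyr_cong pyr_wpowD by blast
  obtain Y where Y: "Q @ Y \<approx> Y @ P" "set Y \<subseteq> set Q" using conjug_sym[OF assms(3,2)] by (auto simp: conjug_def)
  define n where "n = count_list K v"
  have sQ: "set K = set Q" using heq_set[OF K(1)] set_wpow[of m K] K(2) by simp
  have "v \<in> set K" using sQ conj_set[OF Y(1)] pyr_in_set[OF v] by simp
  then have n: "0 < n" using count_list_pos_iff by (metis n_def)
  define c where "c = count_list Y v div n"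
  have "count_list Y v mod n < count_list K v" using n by (simp add: n_def)
  from occurrence_split[OF this]
  obtain a b where ab: "K = a @ v # b" "count_list a v = count_list Y v mod n" by auto
  obtain X J where X: "K @ X \<approx> X @ J" "set X \<subseteq> set K" "count_list X v = count_list a v" "pyr v J"
    using rot_rel_exists[OF ab(1) uK] by blast
  define X2 where "X2 = wpow K c @ X"
  have "K @ wpow K c \<approx> wpow K c @ K" using wpow_Suc_right[of c K] by simp
  from conj_trans[OF this X(1)] have "K @ X2 \<approx> X2 @ J" by (simp add: X2_def)
  then have "wpow K m @ X2 \<approx> X2 @ wpow J m" by (rule conj_wpow)
  then have 1: "Q @ X2 \<approx> X2 @ wpow J m"
    using heq_trans[OF heq_append[OF K(1) heq_refl[of X2]]] by simp
  have 2: "pyr v (wpow J m)" using pyr_wpow[OF X(4)] K(2) by simp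
  have 3: "set X2 \<subseteq> set Q" using X(2) sQ set_wpow_subset[of c K] by (auto simp: X2_def)
  have 4: "count_list X2 v = count_list Y v"
    using X(3) ab(2) by (simp add: X2_def count_list_append count_wpow c_def flip: n_def)
  have "P \<approx> wpow J m" using conj_unique[OF Y(1) v Y(2) 1 2 3] 4 by simp
  then show ?thesis using K(2) by (auto simp: periodic_def)
qed

text \<open>Each piece of P names one rotation. \<open>conj_reduce\<close> shows that all rotations
  arise in this way; aperiodicity is what keeps different pieces from giving the same heap.\<close>

lemma card_rot_class:
  assumes P: "pyramid E P" "\<not> periodic E P"
  shows "card (rep ` {Q. rot_equiv E P Q}) = length P"
proof -
  obtain u where u: "pyr u P" using P(1) pyramid_iff by blast
  define good where "good = (\<lambda>v i Q. \<exists>X. P @ X \<approx> X @ Q \<and> set X \<subseteq> set P \<and> count_list X v = i \<and> pyr v Q)"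
  define F where "F = (\<lambda>(v, i). SOME Q. good v i Q)"
  have F: "good v i (F (v, i))" if vi: "(v, i) \<in> occs P" for v i
  proof -
    obtain a b where "P = a @ v # b" "count_list a v = i"
      using occurrence_split[of i P v] vi by (auto simp: in_occs_iff)
    then have "\<exists>Q. good v i Q" using rot_rel_exists[OF _ u] unfolding good_def by metis
    then show ?thesis unfolding F_def by (auto intro: someI)
  qed
  have "bij_betw (rep \<circ> F) (occs P) (rep ` {Q. rot_equiv E P Q})"
    unfolding bij_betw_def
  proof
    show "inj_on (rep \<circ> F) (occs P)"
    proof (rule inj_onI)
      fix x y assume xy: "x \<in> occs P" "y \<in> occs P" "(rep \<circ> F) x = (rep \<circ> F) y"
      obtain v i w j where [simp]: "x = (v, i)" "y = (w, j)" by (cases x, cases y) auto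
      have h: "F x \<approx> F y" using xy(3) by (simp add: rep_eq_iff)
      obtain X where X: "P @ X \<approx> X @ F x" "set X \<subseteq> set P" "count_list X v = i" "pyr v (F x)"
        using F[of v i] xy(1) by (auto simp: good_def)
      obtain X' where X': "P @ X' \<approx> X' @ F y" "set X' \<subseteq> set P" "count_list X' w = j" "pyr w (F y)"
        using F[of w j] xy(2) by (auto simp: good_def)
      have [simp]: "w = v" using X(4) X'(4) mins_cong[OF h] by (simp add: pyr_def)
      \<comment> \<open>Y leads back from \<open>F x\<close> to P, since X Y is a power of P. Then
        X' Y conjugates P to itself, so it is a power of the aperiodic P as well.\<close>
      obtain Y where Y: "wpow P (Suc (length X)) \<approx> X @ Y"
        using conj_prefix[OF X(1,4,2)] by blast
      have sY: "set Y \<subseteq> set P" using heq_set[OF Y] set_wpow_subset[of "Suc (length X)" P] by auto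
      have QY: "F x @ Y \<approx> Y @ P" by (rule conj_complement[OF X(1) Y])
      have "P @ X' \<approx> X' @ F x"
        using X'(1) heq_append[OF heq_refl heq_sym[OF h]] heq_trans by blast
      from conj_trans[OF this QY] have "P @ (X' @ Y) \<approx> (X' @ Y) @ P" by simp
      then obtain b where b: "X' @ Y \<approx> wpow P b"
        using commuting_power[OF u P(2), of "X' @ Y"] X'(2) sY by auto
      have lt: "i < count_list P v" "j < count_list P v" using xy by (auto simp: in_occs_iff)
      have 1: "j + count_list Y v = b * count_list P v"
        using heq_count[OF b, of v] X'(3) by (simp add: count_wpow count_list_append)
      have 2: "i + count_list Y v = Suc (length X) * count_list P v"
        using heq_count[OF Y, of v] X(3) unfolding count_wpow by (simp add: count_list_append)
      \<comment> \<open>Adding \<open>count_list Y v\<close> turns i and j into multiples of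
        \<open>count_list P v\<close>. So they are congruent, and both lie below this
        modulus.\<close>
      have "b * count_list P v + i = Suc (length X) * count_list P v + j" using 1 2 by simp
      then have "(b * count_list P v + i) mod count_list P v = (Suc (length X) * count_list P v + j) mod count_list P v"
        by simp
      then have "i = j" unfolding mod_mult_self3 using lt by simp
      then show "x = y" by simp
    qed
    show "(rep \<circ> F) ` occs P = rep ` {Q. rot_equiv E P Q}"
    proof (intro equalityI subsetI)
      fix q assume "q \<in> (rep \<circ> F) ` occs P"
      then obtain v i where vi: "(v, i) \<in> occs P" "q = rep (F (v, i))" by auto
      have "rot_equiv E P (F (v, i))"
        unfolding rot_equiv_iff[OF P(1)] using F[OF vi(1)] pyramid_iff
        by (auto simp: good_def conjug_def)
      then show "q \<in> rep ` {Q. rot_equiv E P Q}" using vi(2) by blast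
    next
      fix q assume "q \<in> rep ` {Q. rot_equiv E P Q}"
      then obtain Q where Q: "q = rep Q" "rot_equiv E P Q" by blast
      then obtain X v where X: "P @ X \<approx> X @ Q" "set X \<subseteq> set P" "pyr v Q"
        using pyramid_iff rot_equiv_iff[OF P(1)] by (auto simp: conjug_def)
      obtain X' where X': "P @ X' \<approx> X' @ Q" "set X' \<subseteq> set P" "count_list X' v < count_list P v"
        using conj_reduce[OF X(1,3,2)] by blast
      then have i: "(v, count_list X' v) \<in> occs P" by (simp add: in_occs_iff)
      obtain X2 where "P @ X2 \<approx> X2 @ F (v, count_list X' v)" "set X2 \<subseteq> set P"
        "count_list X2 v = count_list X' v" "pyr v (F (v, count_list X' v))"
        using F[OF i] by (auto simp: good_def)
      then have "F (v, count_list X' v) \<approx> Q" using conj_unique X' X(3) by blast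
      then have "rep (F (v, count_list X' v)) = rep Q" by (simp only: rep_eq_iff)
      then have "q = rep (F (v, count_list X' v))" using Q(1) by simp
      then show "q \<in> (rep \<circ> F) ` occs P" by (intro image_eqI[OF _ i]) simp
    qed
  qed
  from bij_betw_same_card[OF this] show ?thesis by (simp add: card_occs)
qed

end

subsection \<open>Counting heaps\<close>

lemma finite_has_lex_min:
  fixes S :: "'a::linorder list set"
  assumes "finite S" "S \<noteq> {}"
  shows "\<exists>m\<in>S. \<forall>x\<in>S. lexordp_eq m x"
  using assms
proof (induction rule: finite_ne_induct)
  case (insert x F)
  then obtain m where m: "m \<in> F" "\<forall>y\<in>F. lexordp_eq m y" by blast
  show ?case
  proof (cases "lexordp_eq m x")
    case True
    then show ?thesis using m by blast
  next
    case False
    then have "lexordp_eq x m" using lexordp_eq_linear by blast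
    then show ?thesis using m lexordp_eq_trans lexordp_eq_refl by (intro bexI[of _ x]) blast+
  qed
qed (simp add: lexordp_eq_refl)

lemma finite_has_lex_max:
  fixes S :: "'a::linorder list set"
  assumes "finite S" "S \<noteq> {}"
  shows "\<exists>m\<in>S. \<forall>x\<in>S. lexordp_eq x m"
  using assms
proof (induction rule: finite_ne_induct)
  case (insert x F)
  then obtain m where m: "m \<in> F" "\<forall>y\<in>F. lexordp_eq y m" by blast
  show ?case
  proof (cases "lexordp_eq x m")
    case True
    then show ?thesis using m by blast
  next
    case False
    then have "lexordp_eq m x" using lexordp_eq_linear by blast
    then show ?thesis using m lexordp_eq_trans lexordp_eq_refl by (intro bexI[of _ x]) blast+
  qed
qed (simp add: lexordp_eq_refl)

lemma sum_Pow_minus_one_power: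
  "finite A \<Longrightarrow> (\<Sum>S\<in>Pow A. (-1) ^ card S) = (if A = {} then 1 else 0 :: int)"
proof -
  assume A: "finite A"
  show ?thesis
  proof (cases "A = {}")
    case False
    then have "{} \<subset> A" by auto
    from card_subsupersets_even_odd[OF A this]
    have "card {x \<in> Pow A. even (card x)} = card {x \<in> Pow A. odd (card x)}" by (simp add: Pow_def)
    then show ?thesis using sum_alternating_cancels[of "Pow A" card] A False by simp
  qed simp
qed

context heap_graph
begin

definition heaps :: "'a set \<Rightarrow> nat \<Rightarrow> 'a list set" where
  "heaps W n = {w. rep w = w \<and> set w \<subseteq> W \<and> length w = n}"

definition pyramids :: "'a set \<Rightarrow> nat \<Rightarrow> 'a list set" where
  "pyramids W n = {w \<in> heaps W n. pyramid E w}"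

definition aperiodic_pyramids :: "'a set \<Rightarrow> nat \<Rightarrow> 'a list set" where
  "aperiodic_pyramids W n = {w \<in> pyramids W n. \<not> periodic E w}"

definition indep_sets :: "'a set \<Rightarrow> nat \<Rightarrow> 'a set set" where
  "indep_sets W j = {S. S \<subseteq> W \<and> card S = j \<and> (\<forall>u\<in>S. \<forall>v\<in>S. \<not> E u v)}"

lemma finite_heaps: "finite W \<Longrightarrow> finite (heaps W n)"
  unfolding heaps_def by (rule finite_subset[OF _ finite_lists_length_eq[of W n]]) auto

lemma finite_pyramids: "finite W \<Longrightarrow> finite (pyramids W n)"
  unfolding pyramids_def using finite_heaps by simp

lemma finite_aperiodic_pyramids: "finite W \<Longrightarrow> finite (aperiodic_pyramids W n)"
  unfolding aperiodic_pyramids_def using finite_pyramids by simp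

lemma rep_in_heaps: "set w \<subseteq> W \<Longrightarrow> length w = n \<Longrightarrow> rep w \<in> heaps W n"
  using heq_set[OF heq_rep[of w]] heq_length[OF heq_rep[of w]] by (simp add: heaps_def)

lemma pyramid_cong: "w \<approx> w' \<Longrightarrow> pyramid E w = pyramid E w'"
  by (simp add: pyramid_iff pyr_cong)

lemma periodic_cong: "w \<approx> w' \<Longrightarrow> periodic E w = periodic E w'"
  unfolding periodic_def using heq_trans heq_sym by blast

lemma pyramid_not_Nil: "pyramid E w \<Longrightarrow> w \<noteq> []"
  using pyramid_iff pyr_not_Nil by blast

lemma heaps_recurrence:
  assumes "finite W"
  shows "n * card (heaps W n) = (\<Sum>k\<le>n. card (pyramids W k) * card (heaps W (n - k)))"
proof -
  define D where "D = (\<lambda>w. {(U, V). rep U = U \<and> rep V = V \<and> w \<approx> U @ V \<and> pyramid E V})"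
  let ?S = "SIGMA k:{..n}. pyramids W k \<times> heaps W (n - k)"
  \<comment> \<open>A positive cardinality proves finiteness; for n = 0 it is zero, so this case
    needs that no pyramid is empty.\<close>
  have fD: "finite (D w)" if "w \<in> heaps W n" for w
  proof (cases n)
    case 0
    then have "w = []" using that by (auto simp: heaps_def)
    then have "D w = {}" using pyramid_not_Nil by (auto simp: D_def)
    then show ?thesis by simp
  next
    case (Suc m)
    then show ?thesis using that card_pyr_decomp[of w] unfolding D_def heaps_def
      by (intro card_ge_0_finite) simp
  qed
  have "n * card (heaps W n) = (\<Sum>w\<in>heaps W n. card (D w))"
    using card_pyr_decomp by (simp add: D_def heaps_def)
  also have "\<dots> = card (SIGMA w:heaps W n. D w)"
    using fD finite_heaps[OF assms] by simp
  also have "\<dots> = card ?S"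
  proof (rule bij_betw_same_card[of "\<lambda>(w, U, V). (length V, V, U)"], unfold bij_betw_def, intro conjI)
    show "inj_on (\<lambda>(w, U, V). (length V, V, U)) (SIGMA w:heaps W n. D w)"
    proof (rule inj_onI)
      fix x y assume xy: "x \<in> (SIGMA w:heaps W n. D w)" "y \<in> (SIGMA w:heaps W n. D w)"
        "(case x of (w, U, V) \<Rightarrow> (length V, V, U)) = (case y of (w, U, V) \<Rightarrow> (length V, V, U))"
      obtain w U V w' U' V' where [simp]: "x = (w, U, V)" "y = (w', U', V')" by (cases x, cases y) auto
      have "w \<approx> U @ V" "w' \<approx> U @ V" "rep w = w" "rep w' = w'" using xy by (auto simp: D_def heaps_def)
      then have "w = w'" by (metis rep_eq_iff)
      then show "x = y" using xy by simp
    qed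
    show "(\<lambda>(w, U, V). (length V, V, U)) ` (SIGMA w:heaps W n. D w) = ?S"
    proof (intro equalityI subsetI)
      fix x assume "x \<in> (\<lambda>(w, U, V). (length V, V, U)) ` (SIGMA w:heaps W n. D w)"
      then obtain w U V where x: "x = (length V, V, U)" "w \<in> heaps W n" "(U, V) \<in> D w" by auto
      then have h: "w \<approx> U @ V" by (simp add: D_def)
      show "x \<in> ?S" using x heq_set[OF h] heq_length[OF h] by (auto simp: D_def heaps_def pyramids_def)
    next
      fix x assume "x \<in> ?S"
      then obtain k U V where x: "x = (k, V, U)" "k \<le> n" "V \<in> pyramids W k" "U \<in> heaps W (n - k)" by auto
      have "rep (U @ V) \<in> heaps W n"
        by (rule rep_in_heaps) (use x in \<open>auto simp: heaps_def pyramids_def\<close>)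
      moreover have "(U, V) \<in> D (rep (U @ V))"
        using x heq_sym[OF heq_rep[of "U @ V"]] by (simp add: D_def heaps_def pyramids_def)
      moreover have "x = (length V, V, U)" using x by (simp add: pyramids_def heaps_def)
      ultimately show "x \<in> (\<lambda>(w, U, V). (length V, V, U)) ` (SIGMA w:heaps W n. D w)"
        by (intro image_eqI[of _ _ "(rep (U @ V), U, V)"]) auto
    qed
  qed
  also have "\<dots> = (\<Sum>k\<le>n. card (pyramids W k \<times> heaps W (n - k)))"
    using finite_heaps[OF assms] finite_pyramids[OF assms] by (intro card_SigmaI) auto
  finally show ?thesis by (simp add: card_cartesian_product)
qed

text \<open>Minimal letters are pairwise independent, so the others remain minimal after one has
  been removed.\<close>

lemma heq_extract_mins:
  "distinct xs \<Longrightarrow> set xs \<subseteq> mins T \<Longrightarrow> \<exists>H. T \<approx> xs @ H"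
proof (induction xs arbitrary: T)
  case Nil
  show ?case by (rule exI[of _ T]) simp
next
  case (Cons x xs)
  then obtain T' where T': "T \<approx> x # T'" by (auto simp: mins_def)
  have "set xs \<subseteq> mins T'"
    using Cons.prems by (auto simp: mins_cong[OF T'] mins_Cons)
  then obtain H where "T' \<approx> xs @ H" using Cons.IH[of T'] Cons.prems by auto
  then show ?case using heq_trans[OF T' heq_Cons] by auto
qed

lemma indep_subset_mins:
  "distinct xs \<Longrightarrow> \<forall>u\<in>set xs. \<forall>v\<in>set xs. \<not> E u v \<Longrightarrow> set xs \<subseteq> mins (xs @ H)"
proof (induction xs)
  case (Cons x xs)
  then have "\<not> dep x y" if "y \<in> set xs" for y using that by (auto simp: dep_def)
  then show ?case using Cons by (auto simp: mins_Cons)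
qed simp

lemma finite_indep_sets: "finite W \<Longrightarrow> finite (indep_sets W j)"
  unfolding indep_sets_def by simp

text \<open>Cartier and Foata: the alternating sum over the sets of minimal letters that can be split off
  a heap vanishes unless the heap is empty.\<close>

lemma cartier_foata:
  assumes W: "finite W"
  shows "(\<Sum>j\<le>n. (-1) ^ j * int (card (indep_sets W j)) * int (card (heaps W (n - j)))) =
    (if n = 0 then 1 else 0)"
proof -
  \<comment> \<open>The letters of an independent set commute, so any enumeration of it represents
    the same heap.\<close>
  define enum where "enum = (\<lambda>S :: 'a set. SOME xs. set xs = S \<and> distinct xs)"
  have enum: "set (enum S) = S \<and> distinct (enum S)" if "finite S" for S
    unfolding enum_def using finite_distinct_list[OF that] by (rule someI_ex)
  let ?A = "SIGMA T:heaps W n. Pow (mins T)"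
  let ?B = "SIGMA j:{..n}. indep_sets W j \<times> heaps W (n - j)"
  \<comment> \<open>Putting an independent set below a heap H yields a heap T in which this set
    consists of minimal letters. Summing over pairs (T, S) with T fixed gives an alternating sum
    over all subsets of \<open>mins T\<close>.\<close>
  define f where "f = (\<lambda>(j :: nat, S, H). (rep (enum S @ H), S))"
  have S: "finite S \<and> set (enum S) = S \<and> distinct (enum S) \<and> length (enum S) = j"
    if "S \<in> indep_sets W j" for S j
  proof -
    have "finite S" using that finite_subset[OF _ W] by (auto simp: indep_sets_def)
    moreover then have "length (enum S) = card S" using enum distinct_card by metis
    ultimately show ?thesis using enum that by (auto simp: indep_sets_def)
  qed
  have "bij_betw f ?B ?A" unfolding bij_betw_def
  proof
    show "inj_on f ?B"
    proof (rule inj_onI)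
      fix x y assume xy: "x \<in> ?B" "y \<in> ?B" "f x = f y"
      obtain j S H j' S' H' where [simp]: "x = (j, S, H)" "y = (j', S', H')" by (cases x, cases y) auto
      have [simp]: "S' = S" and h: "enum S @ H \<approx> enum S @ H'" using xy by (auto simp: f_def rep_eq_iff)
      have "H \<approx> H'" using heq_cancel_left[OF h] by simp
      then have "rep H = rep H'" by (simp add: rep_eq_iff)
      then show "x = y" using xy by (auto simp: heaps_def indep_sets_def)
    qed
    show "f ` ?B = ?A"
    proof (intro equalityI subsetI)
      fix x assume "x \<in> f ` ?B"
      then obtain j S' H where x: "x = (rep (enum S' @ H), S')" "j \<le> n" "S' \<in> indep_sets W j"
        "H \<in> heaps W (n - j)" by (auto simp: f_def)
      have "S' \<subseteq> mins (enum S' @ H)"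
        using indep_subset_mins[of "enum S'" H] S[OF x(3)] x(3) by (auto simp: indep_sets_def)
      then have "S' \<subseteq> mins (rep (enum S' @ H))" using mins_cong[OF heq_rep] by blast
      moreover have "rep (enum S' @ H) \<in> heaps W n"
        by (rule rep_in_heaps) (use x S[OF x(3)] in \<open>auto simp: heaps_def indep_sets_def\<close>)
      ultimately show "x \<in> ?A" using x(1) by auto
    next
      fix x assume "x \<in> ?A"
      then obtain T S' where x: "x = (T, S')" "T \<in> heaps W n" "S' \<subseteq> mins T" by auto
      have fin: "finite S'" using x(3) finite_mins finite_subset by blast
      obtain H where H: "T \<approx> enum S' @ H" using heq_extract_mins[of "enum S'" T] enum[OF fin] x(3) by auto
      have "S' \<subseteq> W" using x(2,3) mins_subset_set by (fastforce simp: heaps_def)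
      moreover have "\<not> E u v" if "u \<in> S'" "v \<in> S'" for u v
        using that x(3) mins_not_dep[of u T v] E_irrefl by (auto simp: dep_def)
      ultimately have I: "S' \<in> indep_sets W (card S')" by (auto simp: indep_sets_def)
      have len: "n = card S' + length H" using heq_length[OF H] S[OF I] x(2) by (simp add: heaps_def)
      have "set H \<subseteq> W" using heq_set[OF H] x(2) by (auto simp: heaps_def)
      then have "rep H \<in> heaps W (n - card S')" using len by (intro rep_in_heaps) auto
      moreover have "T = rep (enum S' @ rep H)"
      proof -
        have "T \<approx> enum S' @ rep H" using heq_subst_right[OF H heq_sym[OF heq_rep]] .
        then show ?thesis using x(2) rep_eq_iff[of T "enum S' @ rep H"] by (simp add: heaps_def)
      qed
      ultimately show "x \<in> f ` ?B" using x(1) I len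
        by (intro image_eqI[of _ _ "(card S', S', rep H)"]) (auto simp: f_def)
    qed
  qed
  then have "(\<Sum>(T, S)\<in>?A. (-1) ^ card S) = (\<Sum>x\<in>?B. case f x of (T, S) \<Rightarrow> ((-1) ^ card S :: int))"
    by (rule sum.reindex_bij_betw[symmetric])
  also have "\<dots> = (\<Sum>(j, S, H)\<in>?B. (-1) ^ j)"
    by (rule sum.cong) (auto simp: f_def indep_sets_def)
  also have "\<dots> = (\<Sum>j\<le>n. \<Sum>(S, H)\<in>indep_sets W j \<times> heaps W (n - j). (-1) ^ j)"
    using finite_heaps[OF W] finite_indep_sets[OF W] by (subst sum.Sigma) (auto intro!: sum.cong)
  also have "\<dots> = (\<Sum>j\<le>n. (-1) ^ j * int (card (indep_sets W j)) * int (card (heaps W (n - j))))"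
    by (simp add: card_cartesian_product mult_ac)
  finally have 1: "(\<Sum>(T, S)\<in>?A. (-1) ^ card S) =
    (\<Sum>j\<le>n. (-1) ^ j * int (card (indep_sets W j)) * int (card (heaps W (n - j))))" .
  have "(\<Sum>(T, S)\<in>?A. (-1) ^ card S :: int) = (\<Sum>T\<in>heaps W n. \<Sum>S\<in>Pow (mins T). (-1) ^ card S)"
    using finite_heaps[OF W] finite_mins by (subst sum.Sigma) auto
  also have "\<dots> = (\<Sum>T\<in>heaps W n. if T = [] then 1 else 0)"
    using finite_mins by (simp add: sum_Pow_minus_one_power mins_empty_iff)
  also have "\<dots> = (if n = 0 then 1 else 0)"
  proof (cases "n = 0")
    case True
    have "rep [] = []" using heq_rep[of "[]"] by simp
    then have "heaps W n = {[]}" using True by (auto simp: heaps_def)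
    then show ?thesis using True by simp
  next
    case False
    then show ?thesis by (auto simp: heaps_def intro!: sum.neutral)
  qed
  finally show ?thesis using 1 by simp
qed

text \<open>Take the largest exponent m for which w is an m-th power; it is bounded by the length of
  w, and a periodic root would produce a larger one.\<close>

lemma primitive_root_exists:
  assumes "pyramid E w"
  shows "\<exists>K m. 0 < m \<and> w \<approx> wpow K m \<and> pyramid E K \<and> \<not> periodic E K"
proof -
  define P where "P = (\<lambda>m. \<exists>K. w \<approx> wpow K m)"
  have w: "w \<noteq> []" using assms pyramid_not_Nil by blast
  have P1: "P 1" unfolding P_def by (rule exI[of _ w]) simp
  have bound: "m \<le> length w" if Pm: "P m" for m
  proof -
    obtain K where K: "w \<approx> wpow K m" using Pm by (auto simp: P_def)
    then have "length w = m * length K" using heq_length[OF K] by (simp add: length_wpow)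
    moreover from this have "1 \<le> length K" using w by (cases K) auto
    ultimately show ?thesis using mult_le_mono2[of 1 "length K" m] by simp
  qed
  define m where "m = (GREATEST m. P m)"
  have "P m" unfolding m_def using GreatestI_nat[of P, OF P1] bound by blast
  have max: "P l \<Longrightarrow> l \<le> m" for l unfolding m_def using Greatest_le_nat[of P] bound by blast
  have "\<exists>K. w \<approx> wpow K m" using \<open>P m\<close> by (simp only: P_def)
  then obtain K where K: "w \<approx> wpow K m" by (elim exE)
  have m: "0 < m" using max[OF P1] by simp
  have "pyramid E K" using assms K pyramid_iff pyr_cong pyr_wpowD by metis
  moreover have "\<not> periodic E K"
  proof
    assume "periodic E K"
    then obtain J l where J: "1 < l" "K \<approx> wpow J l" by (auto simp: periodic_def)
    have "w \<approx> wpow J (m * l)" using heq_trans[OF K heq_wpow[OF J(2)]] by (simp add: wpow_mult)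
    then have "P (m * l)" unfolding P_def by (rule exI)
    then have "m * l \<le> m" by (rule max)
    then show False using m J(1) by simp
  qed
  ultimately show ?thesis using m K by blast
qed

lemma card_pyramids:
  assumes W: "finite W" and n: "0 < n"
  shows "card (pyramids W n) = (\<Sum>d | d dvd n. card (aperiodic_pyramids W d))"
proof -
  let ?S = "SIGMA d:{d. d dvd n}. aperiodic_pyramids W d"
  define f where "f = (\<lambda>(d, K). rep (wpow K (n div d)))"
  have "bij_betw f ?S (pyramids W n)" unfolding bij_betw_def
  proof
    show "inj_on f ?S"
    proof (rule inj_onI)
      fix x y assume xy: "x \<in> ?S" "y \<in> ?S" "f x = f y"
      obtain d K e J where [simp]: "x = (d, K)" "y = (e, J)" by (cases x, cases y) auto
      have h: "wpow K (n div d) \<approx> wpow J (n div e)" using xy by (simp add: f_def rep_eq_iff)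
      have KJ: "pyramid E K" "\<not> periodic E K" "pyramid E J" "\<not> periodic E J" "rep K = K" "rep J = J"
        "length K = d" "length J = e" "d dvd n" "e dvd n"
        using xy by (auto simp: aperiodic_pyramids_def pyramids_def heaps_def)
      then have "0 < n div d" "0 < n div e" using n by (auto simp: div_greater_zero_iff dvd_imp_le dest: dvd_pos_nat)
      then have "K \<approx> J" using root_unique[OF _ KJ(2) _ KJ(4) h] KJ(1,3) pyramid_iff by blast
      then have "K = J" using rep_eq_iff KJ(5,6) by metis
      then show "x = y" using KJ by auto
    qed
    show "f ` ?S = pyramids W n"
    proof (intro equalityI subsetI)
      fix w assume "w \<in> f ` ?S"
      then obtain d K where w: "w = rep (wpow K (n div d))" "d dvd n" "K \<in> aperiodic_pyramids W d"
        by (auto simp: f_def)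
      have p: "0 < n div d" using w(2) n by (auto simp: div_greater_zero_iff dvd_imp_le dest: dvd_pos_nat)
      have "rep (wpow K (n div d)) \<in> heaps W n"
        by (rule rep_in_heaps)
           (use w(2,3) set_wpow[OF p, of K] in \<open>auto simp: length_wpow aperiodic_pyramids_def pyramids_def heaps_def\<close>)
      moreover have "pyramid E (wpow K (n div d))"
        using w(3) pyr_wpow[OF _ p] unfolding aperiodic_pyramids_def pyramids_def pyramid_iff by blast
      ultimately show "w \<in> pyramids W n" using w(1) pyramid_cong[OF heq_rep] by (simp add: pyramids_def)
    next
      fix w assume w: "w \<in> pyramids W n"
      then have "pyramid E w" by (simp add: pyramids_def)
      from primitive_root_exists[OF this]
      obtain K m where K: "0 < m" "w \<approx> wpow K m" "pyramid E K" "\<not> periodic E K" by blast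
      have len: "n = m * length K" using heq_length[OF K(2)] w by (simp add: length_wpow pyramids_def heaps_def)
      have K0: "0 < length K" using pyramid_not_Nil[OF K(3)] by simp
      have "set K \<subseteq> W" using heq_set[OF K(2)] set_wpow[OF K(1), of K] w by (simp add: pyramids_def heaps_def)
      then have "rep K \<in> aperiodic_pyramids W (length K)"
        using rep_in_heaps[of K W "length K"] K(3,4) pyramid_cong[OF heq_rep[of K]] periodic_cong[OF heq_rep[of K]]
        by (simp add: aperiodic_pyramids_def pyramids_def)
      moreover have "w = rep (wpow (rep K) (n div length K))"
      proof -
        have "n div length K = m" using len K0 by simp
        moreover have "w \<approx> wpow (rep K) m" using heq_trans[OF K(2) heq_wpow[OF heq_rep]] .
        then have "rep w = rep (wpow (rep K) m)" by (simp add: rep_eq_iff)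
        ultimately show ?thesis using w by (simp add: pyramids_def heaps_def)
      qed
      ultimately show "w \<in> f ` ?S" using len
        by (intro image_eqI[of _ _ "(length K, rep K)"]) (auto simp: f_def)
    qed
  qed
  from bij_betw_same_card[OF this] have "card (pyramids W n) = card ?S" by simp
  also have "\<dots> = (\<Sum>d | d dvd n. card (aperiodic_pyramids W d))"
    using finite_aperiodic_pyramids[OF W] n by (intro card_SigmaI) auto
  finally show ?thesis .
qed

end

section \<open>Lyndon heaps as representatives of rotation classes\<close>

locale ordered_heap_graph = heap_graph E for E :: "'a::linorder \<Rightarrow> 'a \<Rightarrow> bool"
begin

text \<open>A heap class is finite and the lexicographic order is linear, so the definite
  description in \<open>std_word\<close> denotes.\<close>

lemma std_word_props:
  shows heq_std_word: "w \<approx> std_word E w"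
    and std_word_max: "w \<approx> t \<Longrightarrow> lexordp_eq t (std_word E w)"
proof -
  have "{t. w \<approx> t} \<subseteq> {xs. set xs \<subseteq> set w \<and> length xs = length w}"
    using heq_set heq_length by (metis (mono_tags, lifting) mem_Collect_eq order_refl subsetI)
  then have fin: "finite {t. w \<approx> t}"
    using finite_lists_length_eq[of "set w" "length w"] finite_subset by blast
  moreover have "{t. w \<approx> t} \<noteq> {}" using heq_refl by blast
  ultimately obtain s where s: "s \<in> {t. w \<approx> t}" "\<forall>t\<in>{t. w \<approx> t}. lexordp_eq t s"
    using finite_has_lex_max by blast
  have "std_word E w = s"
    unfolding std_word_def by (rule the_equality) (use s lexordp_eq_antisym in auto)
  then show "w \<approx> std_word E w" "w \<approx> t \<Longrightarrow> lexordp_eq t (std_word E w)" using s by auto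
qed

lemma std_word_cong: "w \<approx> w' \<Longrightarrow> std_word E w = std_word E w'"
proof -
  assume "w \<approx> w'"
  then have "(\<lambda>t. w \<approx> t) = (\<lambda>t. w' \<approx> t)" using heq_trans heq_sym by blast
  then show ?thesis by (simp add: std_word_def)
qed

definition lyndon_words :: "'a set \<Rightarrow> nat \<Rightarrow> 'a list set" where
  "lyndon_words W n = {w \<in> heaps W n. lyndon E w}"

lemma rot_equiv_sym: "rot_equiv E x y \<Longrightarrow> rot_equiv E y x"
  unfolding rot_equiv_def by (rule equivclp_sym)

lemma rot_equiv_trans: "rot_equiv E x y \<Longrightarrow> rot_equiv E y z \<Longrightarrow> rot_equiv E x z"
  unfolding rot_equiv_def by (rule equivclp_trans)

lemma rot_equiv_refl: "rot_equiv E x x"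
  unfolding rot_equiv_def by (rule equivclp_refl)

lemma lyndon_cong: "w \<approx> w' \<Longrightarrow> lyndon E w \<Longrightarrow> lyndon E w'"
proof -
  assume h: "w \<approx> w'" and l: "lyndon E w"
  have "pyramid E w'" using l h pyramid_cong by (auto simp: lyndon_def)
  then have "rot_equiv E w w'" using l rot_equiv_iff conjug_heq[OF h] by (simp add: lyndon_def)
  then show ?thesis
    using l std_word_cong[OF h] pyramid_cong[OF h] periodic_cong[OF h] rot_equiv_trans
    unfolding lyndon_def by metis
qed

text \<open>Rotation classes partition the aperiodic pyramids of size d and have d elements each; it
  remains to find exactly one Lyndon word per class. A least standard word exists by finiteness. Two
  Lyndon words of one class bound each other's standard words, and equal standard words mean equal
  heaps.\<close>

lemma card_aperiodic_pyramids:
  assumes W: "finite W"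
  shows "card (aperiodic_pyramids W d) = d * card (lyndon_words W d)"
proof -
  define C where "C = (\<lambda>L. {Q \<in> aperiodic_pyramids W d. rot_equiv E L Q})"
  have C: "C L = rep ` {Q. rot_equiv E L Q}" if L: "L \<in> aperiodic_pyramids W d" for L
  proof (intro equalityI subsetI)
    fix Q assume "Q \<in> C L"
    then have "rot_equiv E L Q" "rep Q = Q"
      by (auto simp: C_def aperiodic_pyramids_def pyramids_def heaps_def)
    then show "Q \<in> rep ` {Q. rot_equiv E L Q}" by (intro image_eqI[of _ _ Q]) auto
  next
    fix q assume "q \<in> rep ` {Q. rot_equiv E L Q}"
    then obtain Q where Q: "q = rep Q" "rot_equiv E L Q" by auto
    have L': "pyramid E L" "\<not> periodic E L" "set L \<subseteq> W" "length L = d"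
      using L by (auto simp: aperiodic_pyramids_def pyramids_def heaps_def)
    have pc: "pyramid E Q" "conjug L Q" using Q(2) rot_equiv_iff[OF L'(1)] by auto
    then obtain X where X: "L @ X \<approx> X @ Q" by (auto simp: conjug_def)
    have q: "q \<approx> Q" using Q(1) heq_rep heq_sym by blast
    have "pyramid E q" using pc(1) pyramid_cong[OF q] by simp
    moreover have "conjug L q" using pc(2) conjug_trans conjug_heq[OF heq_sym[OF q]] by blast
    moreover have "\<not> periodic E q"
      using periodic_conjug[OF L'(1) calculation] L'(2) by blast
    moreover have "q \<in> heaps W d" unfolding Q(1)
      by (rule rep_in_heaps) (use L'(3,4) conj_set[OF X] heq_length[OF X] in auto)
    ultimately show "q \<in> C L"
      using rot_equiv_iff[OF L'(1)] by (simp add: C_def aperiodic_pyramids_def pyramids_def)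
  qed
  have lyn: "L \<in> aperiodic_pyramids W d" if "L \<in> lyndon_words W d" for L
    using that by (simp add: lyndon_words_def aperiodic_pyramids_def pyramids_def lyndon_def)
  have "aperiodic_pyramids W d = (\<Union>L\<in>lyndon_words W d. C L)"
  proof (intro equalityI subsetI)
    fix Q assume Q: "Q \<in> aperiodic_pyramids W d"
    have "finite (C Q)" using finite_aperiodic_pyramids[OF W] by (simp add: C_def)
    moreover have QC: "Q \<in> C Q" using Q rot_equiv_refl by (simp add: C_def)
    ultimately obtain m where "m \<in> std_word E ` C Q" "\<forall>x\<in>std_word E ` C Q. lexordp_eq m x"
      using finite_has_lex_min[of "std_word E ` C Q"] by blast
    then obtain L where L: "L \<in> C Q" "\<forall>x\<in>C Q. lexordp_eq (std_word E L) (std_word E x)" by auto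
    have QL: "rot_equiv E Q L" and La: "L \<in> aperiodic_pyramids W d" using L(1) by (auto simp: C_def)
    have "lexordp_eq (std_word E L) (std_word E u)" if "rot_equiv E L u" for u
    proof -
      have "rot_equiv E Q u" using QL that rot_equiv_trans by blast
      then have "rep u \<in> C Q" using C[OF Q] by auto
      then show ?thesis using L(2) std_word_cong[OF heq_rep[of u]] by simp
    qed
    then have "L \<in> lyndon_words W d"
      using La by (simp add: lyndon_words_def lyndon_def aperiodic_pyramids_def pyramids_def)
    moreover have "Q \<in> C L" using Q QL rot_equiv_sym by (auto simp: C_def)
    ultimately show "Q \<in> (\<Union>L\<in>lyndon_words W d. C L)" by blast
  qed (auto simp: C_def)
  moreover have "card (\<Union>L\<in>lyndon_words W d. C L) = (\<Sum>L\<in>lyndon_words W d. card (C L))"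
  proof (rule card_UN_disjoint)
    show "finite (lyndon_words W d)" using finite_heaps[OF W] by (simp add: lyndon_words_def)
    show "\<forall>L\<in>lyndon_words W d. finite (C L)" using finite_aperiodic_pyramids[OF W] by (simp add: C_def)
    show "\<forall>L\<in>lyndon_words W d. \<forall>M\<in>lyndon_words W d. L \<noteq> M \<longrightarrow> C L \<inter> C M = {}"
    proof (intro ballI impI, rule ccontr)
      fix L M assume LM: "L \<in> lyndon_words W d" "M \<in> lyndon_words W d" "L \<noteq> M" "C L \<inter> C M \<noteq> {}"
      then obtain Q where "rot_equiv E L Q" "rot_equiv E M Q" by (auto simp: C_def)
      then have "rot_equiv E L M" "rot_equiv E M L" using rot_equiv_sym rot_equiv_trans by blast+
      then have "std_word E L = std_word E M"
        using LM(1,2) lexordp_eq_antisym by (auto simp: lyndon_words_def lyndon_def)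
      then have "L \<approx> M" using heq_std_word heq_sym heq_trans by metis
      then have "rep L = rep M" by (simp add: rep_eq_iff)
      then show False using LM by (simp add: lyndon_words_def heaps_def)
    qed
  qed
  moreover have "card (C L) = d" if "L \<in> lyndon_words W d" for L
    using C[OF lyn[OF that]] card_rot_class[of L] that
    by (simp add: lyndon_words_def lyndon_def heaps_def)
  ultimately show ?thesis by simp
qed

lemma bij_lyndon_words:
  "bij_betw (\<lambda>w. {ys. w \<approx> ys}) (lyndon_words W k)
     {{ys. xs \<approx> ys} | xs. set xs \<subseteq> W \<and> length xs = k \<and> lyndon E xs}"
  unfolding bij_betw_def
proof
  show "inj_on (\<lambda>w. {ys. w \<approx> ys}) (lyndon_words W k)"
  proof (rule inj_onI)
    fix x y assume xy: "x \<in> lyndon_words W k" "y \<in> lyndon_words W k" "{ys. x \<approx> ys} = {ys. y \<approx> ys}"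
    then have "x \<approx> y" using heq_refl heq_sym by blast
    then have "rep x = rep y" by (simp add: rep_eq_iff)
    then show "x = y" using xy by (simp add: lyndon_words_def heaps_def)
  qed
  show "(\<lambda>w. {ys. w \<approx> ys}) ` lyndon_words W k =
    {{ys. xs \<approx> ys} | xs. set xs \<subseteq> W \<and> length xs = k \<and> lyndon E xs}"
  proof (intro equalityI subsetI)
    fix H assume "H \<in> {{ys. xs \<approx> ys} | xs. set xs \<subseteq> W \<and> length xs = k \<and> lyndon E xs}"
    then obtain xs where xs: "H = {ys. xs \<approx> ys}" "set xs \<subseteq> W" "length xs = k" "lyndon E xs" by blast
    have "rep xs \<in> lyndon_words W k"
      using rep_in_heaps[OF xs(2,3)] lyndon_cong[OF heq_rep xs(4)] by (simp add: lyndon_words_def)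
    moreover have "H = {ys. rep xs \<approx> ys}" using xs(1) heq_rep heq_sym heq_trans by blast
    ultimately show "H \<in> (\<lambda>w. {ys. w \<approx> ys}) ` lyndon_words W k" by blast
  qed (auto simp: lyndon_words_def heaps_def)
qed

end

subsection \<open>Euler products in one variable\<close>

unbundle fps_syntax

definition geo :: "nat \<Rightarrow> int fps" where
  "geo k = Abs_fps (\<lambda>n. if k dvd n then 1 else 0)"

lemma geo_nth [simp]: "geo k $ n = (if k dvd n then 1 else 0)"
  by (simp add: geo_def)

lemma geo_mult:
  assumes "0 < k"
  shows "(1 - fps_X ^ k) * geo k = 1"
proof (rule fps_ext)
  fix n
  have "((1 - fps_X ^ k) * geo k) $ n = geo k $ n - (if n < k then 0 else geo k $ (n - k))"
    by (simp add: left_diff_distrib fps_X_power_mult_nth)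
  also have "\<dots> = 1 $ n"
    using assms by (auto simp: dvd_minus_self dest: dvd_imp_le)
  finally show "((1 - fps_X ^ k) * geo k) $ n = (1 :: int fps) $ n" .
qed

text \<open>One-variable counterpart of 1 + \<open>pbar1 k\<close> for odd k and of its inverse for
  even k.\<close>

definition euler_factor :: "nat \<Rightarrow> int fps" where
  "euler_factor k = (if odd k then geo k else 1 - fps_X ^ k)"

lemma euler_factor_0: "0 < k \<Longrightarrow> euler_factor k $ 0 = 1"
  by (simp add: euler_factor_def)

section \<open>Logarithmic derivatives of integer power series\<close>

lemma fps_X_mult_deriv_nth: "(fps_X * fps_deriv f) $ n = int n * f $ n"
  by (cases n) auto

text \<open>A division-free way to say that -u is the logarithmic derivative x f'/f. With this sign,
  the reciprocal of the heap series is related to the pyramid series itself.\<close>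

definition log_deriv_rel :: "int fps \<Rightarrow> int fps \<Rightarrow> bool" where
  "log_deriv_rel f u \<longleftrightarrow> fps_X * fps_deriv f = - (u * f)"

lemma log_deriv_rel_one: "log_deriv_rel 1 0"
  by (simp add: log_deriv_rel_def)

lemma log_deriv_rel_mult: "log_deriv_rel f u \<Longrightarrow> log_deriv_rel g v \<Longrightarrow> log_deriv_rel (f * g) (u + v)"
proof -
  assume a: "log_deriv_rel f u" "log_deriv_rel g v"
  have "fps_X * fps_deriv (f * g) = f * (fps_X * fps_deriv g) + (fps_X * fps_deriv f) * g"
    by (simp add: algebra_simps)
  then show ?thesis using a unfolding log_deriv_rel_def by (simp add: algebra_simps)
qed

lemma log_deriv_rel_euler_factor:
  assumes "0 < k"
  shows "log_deriv_rel (euler_factor k) (fps_const ((if odd k then -1 else 1) * int k) * (geo k - 1))"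
proof -
  let ?x = "fps_X :: int fps"
  define D where "D = 1 - ?x ^ k"
  have DG: "D * geo k = 1" using geo_mult[OF assms] by (simp add: D_def)
  have XD: "?x * fps_deriv D = - (fps_const (int k) * ?x ^ k)"
    by (rule fps_ext, unfold fps_X_mult_deriv_nth) (use assms in \<open>simp add: D_def\<close>)
  have Xk: "D * (geo k - 1) = ?x ^ k" using DG by (simp add: right_diff_distrib) (simp add: D_def)
  show ?thesis
  proof (cases "odd k")
    case False
    then show ?thesis using XD Xk
      by (simp add: log_deriv_rel_def euler_factor_def mult_ac flip: D_def)
  next
    case True
    \<comment> \<open>Differentiating D * \<open>geo k\<close> = 1 expresses the derivative of
      \<open>geo k\<close> through that of D; a further factor \<open>geo k\<close> then cancels
      D.\<close>
    have "fps_deriv (D * geo k) = 0" using DG by simp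
    then have "?x * (D * fps_deriv (geo k) + fps_deriv D * geo k) = 0" by (simp add: fps_deriv_mult)
    then have "D * (?x * fps_deriv (geo k)) = - (?x * fps_deriv D) * geo k"
      by (simp add: algebra_simps add_eq_0_iff)
    also have "\<dots> = fps_const (int k) * (D * (geo k - 1)) * geo k" by (simp add: XD Xk)
    also have "\<dots> = D * (fps_const (int k) * (geo k - 1) * geo k)" by (simp add: mult_ac)
    finally have "geo k * D * (?x * fps_deriv (geo k)) = geo k * D * (fps_const (int k) * (geo k - 1) * geo k)"
      by (simp add: mult.assoc)
    then have "?x * fps_deriv (geo k) = fps_const (int k) * (geo k - 1) * geo k"
      using DG by (simp add: mult.commute[of "geo k"])
    then show ?thesis using True
      by (simp add: log_deriv_rel_def euler_factor_def flip: fps_const_neg)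
  qed
qed

lemma log_deriv_rel_nth:
  assumes "log_deriv_rel f u"
  shows "int n * f $ n = - (\<Sum>k\<le>n. u $ k * f $ (n - k))"
proof -
  have "int n * f $ n = (- (u * f)) $ n"
    using assms by (simp only: log_deriv_rel_def flip: fps_X_mult_deriv_nth)
  also have "\<dots> = - (\<Sum>k\<le>n. u $ k * f $ (n - k))" by (simp add: fps_mult_nth atLeast0AtMost)
  finally show ?thesis .
qed

text \<open>Since u has no constant term, \<open>log_deriv_rel_nth\<close> determines each
  coefficient of positive index from earlier ones. Agreement of u and v up to N is all that a
  truncated product can provide.\<close>

lemma log_deriv_rel_unique:
  assumes "log_deriv_rel f u" "log_deriv_rel g v" "f $ 0 = g $ 0" "u $ 0 = 0"
    and uv: "\<And>n. n \<le> N \<Longrightarrow> u $ n = v $ n"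
  shows "n \<le> N \<Longrightarrow> f $ n = g $ n"
proof (induction n rule: less_induct)
  case (less n)
  show ?case
  proof (cases n)
    case (Suc m)
    have "u $ k * f $ (n - k) = v $ k * g $ (n - k)" if "k \<le> n" for k
      using that less Suc uv[of k] uv[of 0] assms(4) by (cases k) auto
    then have "int n * f $ n = int n * g $ n"
      unfolding log_deriv_rel_nth[OF assms(1)] log_deriv_rel_nth[OF assms(2)]
      by (intro arg_cong[where f = uminus] sum.cong) auto
    then show ?thesis using Suc by simp
  qed (use assms in simp)
qed

definition euler_product :: "nat multiset \<Rightarrow> int fps" where
  "euler_product m = prod_mset (image_mset euler_factor m)"

lemma euler_product_0: "0 \<notin># m \<Longrightarrow> euler_product m $ 0 = 1"
  by (induction m) (auto simp: euler_product_def euler_factor_0 fps_mult_nth_0)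

lemma log_deriv_rel_euler_product:
  "0 \<notin># m \<Longrightarrow> log_deriv_rel (euler_product m)
     (\<Sum>k\<in>#m. fps_const ((if odd k then -1 else 1) * int k) * (geo k - 1))"
proof (induction m)
  case empty
  then show ?case using log_deriv_rel_one by (simp add: euler_product_def)
next
  case (add k m)
  then have "log_deriv_rel (euler_factor k) (fps_const ((if odd k then -1 else 1) * int k) * (geo k - 1))"
    by (intro log_deriv_rel_euler_factor) auto
  from log_deriv_rel_mult[OF this] add show ?case by (simp add: euler_product_def)
qed

text \<open>Multiplicity of \<open>euler_factor k\<close>: the numerator 1 - x^(2j) of 1 + x^j for
  odd j is credited to k = 2j, which is congruent to 2 modulo 4.\<close>

definition exponent :: "(nat \<Rightarrow> nat) \<Rightarrow> nat \<Rightarrow> nat" where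
  "exponent L k = (if k mod 4 = 2 then L k + L (k div 2) else L k)"

text \<open>For odd n all divisors are odd. For even n the divisors 2d with d odd contribute an
  extra 2 d L(d), which turns the term -d L(d) of the odd divisor d into d L(d).\<close>

lemma even_odd_divisor_sum:
  assumes "0 < n"
  shows "(\<Sum>k | k dvd n. (if odd k then -1 else 1) * int k * int (exponent L k)) =
    (-1) ^ n * (\<Sum>d | d dvd n. int d * int (L d))"
proof -
  let ?D = "{k. k dvd n}"
  have fin: "finite ?D" using assms by simp
  let ?s = "\<lambda>k. (if odd k then -1 else 1) * int k"
  have "(\<Sum>k\<in>?D. ?s k * int (exponent L k)) =
    (\<Sum>k\<in>?D. ?s k * int (L k)) + (\<Sum>k\<in>?D. if k mod 4 = 2 then ?s k * int (L (k div 2)) else 0)"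
    by (subst sum.distrib[symmetric]) (intro sum.cong, auto simp: exponent_def distrib_left)
  also have "(\<Sum>k\<in>?D. if k mod 4 = 2 then ?s k * int (L (k div 2)) else 0) =
    (\<Sum>k\<in>{k\<in>?D. k mod 4 = 2}. int k * int (L (k div 2)))"
  proof -
    have "?s k = int k" if "k mod 4 = 2" for k using that by presburger
    then show ?thesis unfolding sum.inter_filter[OF fin] by (intro sum.cong) auto
  qed
  \<comment> \<open>Here k = 2d with d odd; for even n, 2d divides n exactly when d does.\<close>
  also have "\<dots> = (\<Sum>d\<in>{d\<in>?D. odd d \<and> even n}. 2 * int d * int (L d))"
  proof (rule sum.reindex_bij_witness[of _ "\<lambda>d. 2 * d" "\<lambda>k. k div 2"])
    fix k assume k: "k \<in> {k\<in>?D. k mod 4 = 2}"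
    then have "k mod 4 = 2" by simp
    then have e: "2 * (k div 2) = k" "odd (k div 2)" "even k" by presburger+
    then show "2 * (k div 2) = k" by blast
    have "even n" using k e(3) dvd_trans by blast
    moreover have "k div 2 dvd n" using k e(1) by (metis (mono_tags, lifting) dvd_mult_right mem_Collect_eq dvd_trans dvd_refl)
    ultimately show "k div 2 \<in> {d\<in>?D. odd d \<and> even n}" using e(2) by simp
    show "2 * int (k div 2) * int (L (k div 2)) = int k * int (L (k div 2))"
      by (metis e(1) of_nat_mult of_nat_numeral)
  next
    fix d assume d: "d \<in> {d\<in>?D. odd d \<and> even n}"
    then have "coprime 2 d" by simp
    then have "2 * d dvd n" using d by (intro divides_mult) auto
    moreover have "odd d" using d by simp
    then have "2 * d mod 4 = 2" by presburger
    ultimately show "2 * d \<in> {k\<in>?D. k mod 4 = 2}" by simp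
  qed auto
  also have "\<dots> = (\<Sum>d\<in>?D. if odd d \<and> even n then 2 * int d * int (L d) else 0)"
    by (rule sum.inter_filter[OF fin])
  also have "(\<Sum>k\<in>?D. ?s k * int (L k)) + \<dots> =
    (\<Sum>k\<in>?D. ?s k * int (L k) + (if odd k \<and> even n then 2 * int k * int (L k) else 0))"
    by (rule sum.distrib[symmetric])
  also have "\<dots> = (\<Sum>k\<in>?D. (-1) ^ n * (int k * int (L k)))"
  proof (rule sum.cong[OF refl])
    fix k assume "k \<in> ?D"
    then have "odd n \<Longrightarrow> odd k" using dvd_trans by blast
    then show "?s k * int (L k) + (if odd k \<and> even n then 2 * int k * int (L k) else 0) =
      (-1) ^ n * (int k * int (L k))"
      by (cases "even n"; cases "even k") simp_all
  qed
  finally show ?thesis by (simp add: sum_distrib_left)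
qed

text \<open>The infinite product cut off at N; omitted factors differ from 1 only in degrees above
  N.\<close>

definition truncated_exponents :: "(nat \<Rightarrow> nat) \<Rightarrow> nat \<Rightarrow> nat multiset" where
  "truncated_exponents L N = (\<Sum>k\<in>{1..N}. replicate_mset (exponent L k) k)"

lemma count_truncated_exponents:
  "count (truncated_exponents L N) k = (if k \<in> {1..N} then exponent L k else 0)"
  unfolding truncated_exponents_def count_sum by (auto simp: if_distrib sum.delta cong: if_cong)

lemma zero_notin_truncated_exponents: "0 \<notin># truncated_exponents L N"
  using count_truncated_exponents[of L N 0] by (simp add: not_in_iff)

lemma sum_mset_replicates:
  "finite A \<Longrightarrow> (\<Sum>x\<in>#(\<Sum>k\<in>A. replicate_mset (c k) k). h x) = (\<Sum>k\<in>A. of_nat (c k) * (h k :: int fps))"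
  by (induction rule: finite_induct) (simp_all add: sum_mset_replicate_mset)

text \<open>The hypotheses say that the generating function of the numbers a is the reciprocal of the
  alternating generating function of the numbers i, with logarithmic derivative given by b.\<close>

lemma euler_product_coeff:
  fixes a b i L :: "nat \<Rightarrow> nat"
  assumes ab: "\<And>n. n * a n = (\<Sum>k\<le>n. b k * a (n - k))"
    and ia: "\<And>n. (\<Sum>j\<le>n. (-1) ^ j * int (i j) * int (a (n - j))) = (if n = 0 then 1 else 0)"
    and bL: "\<And>n. 0 < n \<Longrightarrow> b n = (\<Sum>d | d dvd n. d * L d)" and b0: "b 0 = 0"
    and i0: "i 0 = 1"
    and n: "n \<le> N"
  shows "euler_product (truncated_exponents L N) $ n = int (i n)"
proof -
  define A B J where "A = Abs_fps (\<lambda>n. int (a n))" and "B = Abs_fps (\<lambda>n. int (b n))"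
    and "J = Abs_fps (\<lambda>n. (-1) ^ n * int (i n))"
  have JA: "J * A = 1"
    by (rule fps_ext) (use ia in \<open>simp add: fps_mult_nth J_def A_def atLeast0AtMost\<close>)
  have XA: "fps_X * fps_deriv A = B * A"
  proof (rule fps_ext)
    fix n
    have "(fps_X * fps_deriv A) $ n = int n * int (a n)" by (simp add: fps_X_mult_deriv_nth A_def)
    also have "\<dots> = int (\<Sum>k\<le>n. b k * a (n - k))" by (metis ab of_nat_mult)
    also have "\<dots> = (B * A) $ n" by (simp add: fps_mult_nth A_def B_def atLeast0AtMost)
    finally show "(fps_X * fps_deriv A) $ n = (B * A) $ n" .
  qed
  have "fps_deriv (J * A) = 0" using JA by simp
  then have "fps_X * (J * fps_deriv A + fps_deriv J * A) = 0" by (simp add: fps_deriv_mult)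
  then have "(fps_X * fps_deriv J) * A = - (J * (fps_X * fps_deriv A))"
    by (simp add: algebra_simps add_eq_0_iff)
  also have "\<dots> = - (B * J) * A" by (simp add: XA mult_ac)
  \<comment> \<open>Multiplication by J, the inverse of A, removes the factor A.\<close>
  finally have "(fps_X * fps_deriv J) * A * J = - (B * J) * A * J" by (rule arg_cong)
  then have "(fps_X * fps_deriv J) * (J * A) = - (B * J) * (J * A)"
    by (simp only: mult.assoc mult.commute[of A J])
  then have J: "log_deriv_rel J B" using JA by (simp add: log_deriv_rel_def)
  \<comment> \<open>The substitution of -t for t turns J into I and puts the sign (-1)^n on the
    coefficients of B, the same sign that \<open>even_odd_divisor_sum\<close> produces.\<close>
  define I U where "I = Abs_fps (\<lambda>n. int (i n))" and "U = Abs_fps (\<lambda>n. (-1) ^ n * int (b n))"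
  have LI: "log_deriv_rel I U" unfolding log_deriv_rel_def
  proof (rule fps_ext)
    fix n
    have "(fps_X * fps_deriv I) $ n = int n * int (i n)" by (simp add: fps_X_mult_deriv_nth I_def)
    also have "\<dots> = (-1) ^ n * (int n * J $ n)" by (simp add: J_def)
    also have "\<dots> = - (\<Sum>k\<le>n. (-1) ^ n * (B $ k * J $ (n - k)))"
      by (simp add: log_deriv_rel_nth[OF J] sum_distrib_left)
    also have "(\<Sum>k\<le>n. (-1) ^ n * (B $ k * J $ (n - k))) = (\<Sum>k\<le>n. U $ k * I $ (n - k))"
    proof (rule sum.cong[OF refl])
      fix k assume "k \<in> {..n}"
      then have "(-1) ^ n = (-1 :: int) ^ k * (-1) ^ (n - k)" by (simp flip: power_add)
      then show "(-1) ^ n * (B $ k * J $ (n - k)) = U $ k * I $ (n - k)"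
        by (simp add: B_def J_def U_def I_def)
    qed
    finally show "(fps_X * fps_deriv I) $ n = (- (U * I)) $ n"
      by (simp add: fps_mult_nth atLeast0AtMost)
  qed
  define v where "v = (\<Sum>k\<in>#truncated_exponents L N. fps_const ((if odd k then -1 else 1) * int k) * (geo k - 1))"
  have LE: "log_deriv_rel (euler_product (truncated_exponents L N)) v"
    unfolding v_def by (rule log_deriv_rel_euler_product[OF zero_notin_truncated_exponents])
  have Uv: "U $ m = v $ m" if m: "m \<le> N" for m
  proof -
    have "v = (\<Sum>k\<in>{1..N}. of_nat (exponent L k) * (fps_const ((if odd k then -1 else 1) * int k) * (geo k - 1)))"
      unfolding v_def truncated_exponents_def by (rule sum_mset_replicates) simp
    then have "v $ m = (\<Sum>k\<in>{1..N}. int (exponent L k) * ((if odd k then -1 else 1) * int k * (geo k - 1) $ m))"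
      by (simp add: fps_sum_nth mult.assoc flip: fps_of_nat)
    also have "\<dots> = U $ m"
    proof (cases "m = 0")
      case True
      then show ?thesis using b0 by (simp add: U_def)
    next
      case False
      have "(\<Sum>k\<in>{1..N}. int (exponent L k) * ((if odd k then -1 else 1) * int k * (geo k - 1) $ m)) =
        (\<Sum>k | k dvd m. (if odd k then -1 else 1) * int k * int (exponent L k))"
      proof (rule sum.mono_neutral_cong_right)
        show "{k. k dvd m} \<subseteq> {1..N}"
        proof
          fix k assume "k \<in> {k. k dvd m}"
          then have "0 < k" "k \<le> m" using False by (auto dest: dvd_imp_le intro!: Nat.gr0I)
          then show "k \<in> {1..N}" using m by simp
        qed
      qed (use False in auto)
      also have "\<dots> = (-1) ^ m * int (b m)" using False bL[of m] even_odd_divisor_sum[of m L] by simp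
      finally show ?thesis by (simp add: U_def)
    qed
    finally show ?thesis ..
  qed
  have "I $ n = euler_product (truncated_exponents L N) $ n"
  proof (rule log_deriv_rel_unique[OF LI LE _ _ Uv n])
    show "I $ 0 = euler_product (truncated_exponents L N) $ 0"
      using i0 euler_product_0[OF zero_notin_truncated_exponents] by (simp add: I_def)
    show "U $ 0 = 0" using b0 by (simp add: U_def)
  qed
  then show ?thesis by (simp add: I_def)
qed

subsection \<open>The basis of the expansion\<close>

definition divisors_of :: "mono \<Rightarrow> mono set" where
  "divisors_of \<alpha> = {\<beta>. \<forall>i. \<beta> i \<le> \<alpha> i}"

definition supp :: "mono \<Rightarrow> nat set" where
  "supp \<alpha> = {i. \<alpha> i \<noteq> 0}"

lemma finite_supp: "finmono \<alpha> \<Longrightarrow> finite (supp \<alpha>)"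
  by (simp add: finmono_def supp_def)

lemma in_divisors_of: "\<beta> \<in> divisors_of \<alpha> \<longleftrightarrow> (\<forall>i. \<beta> i \<le> \<alpha> i)"
  by (simp add: divisors_of_def)

lemma ps_mult_alt: "ps_mult f g \<alpha> = (\<Sum>\<beta>\<in>divisors_of \<alpha>. f \<beta> * g (\<lambda>i. \<alpha> i - \<beta> i))"
  by (simp add: ps_mult_def divisors_of_def)

lemma supp_mono: "\<beta> \<in> divisors_of \<alpha> \<Longrightarrow> supp \<beta> \<subseteq> supp \<alpha>"
  unfolding in_divisors_of supp_def using le_zero_eq by (metis (mono_tags, lifting) mem_Collect_eq subsetI)

lemma finmono_divisor: "finmono \<alpha> \<Longrightarrow> \<beta> \<in> divisors_of \<alpha> \<Longrightarrow> finmono \<beta>"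
  using supp_mono[of \<beta> \<alpha>] finite_subset unfolding finmono_def supp_def by blast

lemma diff_divisor: "(\<lambda>i. \<alpha> i - \<beta> i) \<in> divisors_of \<alpha>" for \<alpha> \<beta> :: mono
  by (simp add: in_divisors_of)

lemma mdeg_alt: "finite A \<Longrightarrow> supp \<alpha> \<subseteq> A \<Longrightarrow> mdeg \<alpha> = (\<Sum>i\<in>A. \<alpha> i)"
  unfolding mdeg_def supp_def by (rule sum.mono_neutral_left) auto

lemma mdeg_split:
  assumes "finmono \<alpha>" "\<beta> \<in> divisors_of \<alpha>"
  shows "mdeg \<alpha> = mdeg \<beta> + mdeg (\<lambda>i. \<alpha> i - \<beta> i)"
proof -
  note fin = finite_supp[OF assms(1)]
  have "mdeg \<beta> + mdeg (\<lambda>i. \<alpha> i - \<beta> i) = (\<Sum>i\<in>supp \<alpha>. \<beta> i + (\<alpha> i - \<beta> i))"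
    using mdeg_alt[OF fin supp_mono[OF assms(2)]] mdeg_alt[OF fin supp_mono[OF diff_divisor[of \<alpha> \<beta>]]]
    by (simp add: sum.distrib)
  also have "\<dots> = mdeg \<alpha>"
    unfolding mdeg_alt[OF fin order_refl] using assms(2) by (intro sum.cong) (auto simp: in_divisors_of)
  finally show ?thesis by simp
qed

lemma mdeg_pos: "finmono \<alpha> \<Longrightarrow> \<alpha> i \<noteq> 0 \<Longrightarrow> 0 < mdeg \<alpha>"
  unfolding mdeg_def finmono_def by (rule sum_pos2[of _ i]) auto

lemma bij_divisors_PiE:
  "bij_betw (\<lambda>\<beta>. restrict \<beta> (supp \<alpha>)) (divisors_of \<alpha>) (PiE (supp \<alpha>) (\<lambda>i. {..\<alpha> i}))"
proof (rule bij_betw_byWitness[where f' = "\<lambda>g i. if i \<in> supp \<alpha> then g i else 0"])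
  show "\<forall>\<beta>\<in>divisors_of \<alpha>. (\<lambda>i. if i \<in> supp \<alpha> then restrict \<beta> (supp \<alpha>) i else 0) = \<beta>"
  proof
    fix \<beta> assume b: "\<beta> \<in> divisors_of \<alpha>"
    show "(\<lambda>i. if i \<in> supp \<alpha> then restrict \<beta> (supp \<alpha>) i else 0) = \<beta>"
    proof
      fix i show "(if i \<in> supp \<alpha> then restrict \<beta> (supp \<alpha>) i else 0) = \<beta> i"
        using b[unfolded in_divisors_of, rule_format, of i] by (simp add: supp_def)
    qed
  qed
  show "\<forall>g\<in>PiE (supp \<alpha>) (\<lambda>i. {..\<alpha> i}). restrict (\<lambda>i. if i \<in> supp \<alpha> then g i else 0) (supp \<alpha>) = g"
    by (auto simp: PiE_def extensional_def restrict_def fun_eq_iff)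
qed (auto simp: in_divisors_of)

lemma finite_divisors: "finmono \<alpha> \<Longrightarrow> finite (divisors_of \<alpha>)"
  by (subst bij_betw_finite[OF bij_divisors_PiE]) (auto intro: finite_PiE finite_supp)

lemma sum_divisors_prod:
  fixes h :: "nat \<Rightarrow> nat \<Rightarrow> int"
  assumes "finmono \<alpha>"
  shows "(\<Sum>\<beta>\<in>divisors_of \<alpha>. \<Prod>i\<in>supp \<alpha>. h i (\<beta> i)) = (\<Prod>i\<in>supp \<alpha>. \<Sum>b\<le>\<alpha> i. h i b)"
proof -
  have "(\<Prod>i\<in>supp \<alpha>. \<Sum>b\<le>\<alpha> i. h i b) = (\<Sum>g\<in>PiE (supp \<alpha>) (\<lambda>i. {..\<alpha> i}). \<Prod>i\<in>supp \<alpha>. h i (g i))"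
    by (rule prod_sum_PiE) (use finite_supp[OF assms] in auto)
  also have "\<dots> = (\<Sum>\<beta>\<in>divisors_of \<alpha>. \<Prod>i\<in>supp \<alpha>. h i (restrict \<beta> (supp \<alpha>) i))"
    by (rule sum.reindex_bij_betw[OF bij_divisors_PiE, symmetric])
  finally show ?thesis by simp
qed

text \<open>The product of f(x_i) over all variables. Omitting variables with exponent 0 is correct
  for series with constant term 1.\<close>

definition mult_series :: "int fps \<Rightarrow> pseries" where
  "mult_series f \<alpha> = (\<Prod>i\<in>supp \<alpha>. f $ \<alpha> i)"

lemma mult_series_superset:
  "finite A \<Longrightarrow> supp \<alpha> \<subseteq> A \<Longrightarrow> f $ 0 = 1 \<Longrightarrow> mult_series f \<alpha> = (\<Prod>i\<in>A. f $ \<alpha> i)"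
  unfolding mult_series_def by (rule prod.mono_neutral_left) (auto simp: supp_def)

text \<open>Coefficients factor over the variables, so products of one-variable series carry over to
  infinitely many variables.\<close>

lemma ps_mult_mult_series:
  assumes "finmono \<alpha>" "f $ 0 = 1" "g $ 0 = 1"
  shows "ps_mult (mult_series f) (mult_series g) \<alpha> = mult_series (f * g) \<alpha>"
proof -
  note fin = finite_supp[OF assms(1)]
  have "ps_mult (mult_series f) (mult_series g) \<alpha> =
    (\<Sum>\<beta>\<in>divisors_of \<alpha>. \<Prod>i\<in>supp \<alpha>. f $ \<beta> i * g $ (\<alpha> i - \<beta> i))"
    unfolding ps_mult_alt
  proof (rule sum.cong[OF refl])
    fix \<beta> assume "\<beta> \<in> divisors_of \<alpha>"
    then show "mult_series f \<beta> * mult_series g (\<lambda>i. \<alpha> i - \<beta> i) = (\<Prod>i\<in>supp \<alpha>. f $ \<beta> i * g $ (\<alpha> i - \<beta> i))"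
      using mult_series_superset[OF fin supp_mono assms(2)]
        mult_series_superset[OF fin supp_mono[OF diff_divisor] assms(3)]
      by (simp add: prod.distrib)
  qed
  also have "\<dots> = mult_series (f * g) \<alpha>"
    using sum_divisors_prod[OF assms(1), of "\<lambda>i b. f $ b * g $ (\<alpha> i - b)"]
    by (simp add: mult_series_def fps_mult_nth atLeast0AtMost)
  finally show ?thesis .
qed

lemma one_plus_pbar1:
  assumes "finmono \<alpha>"
  shows "mult_series (geo k) \<alpha> = ps_one \<alpha> + pbar1 k \<alpha>"
proof -
  have "mult_series (geo k) \<alpha> = (if \<forall>i. k dvd \<alpha> i then 1 else 0)"
  proof (cases "\<forall>i. k dvd \<alpha> i")
    case False
    then obtain i where "\<not> k dvd \<alpha> i" by blast
    moreover then have "i \<in> supp \<alpha>" by (auto simp: supp_def intro: ccontr)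
    ultimately show ?thesis using finite_supp[OF assms]
      by (auto simp: mult_series_def intro!: prod_zero bexI[of _ i])
  qed (simp add: mult_series_def)
  then show ?thesis by (auto simp: ps_one_def pbar1_def)
qed

lemma ps_mult_one:
  assumes "finmono \<alpha>"
  shows "ps_mult ps_one f \<alpha> = f \<alpha>"
proof -
  have "ps_mult ps_one f \<alpha> = (\<Sum>\<beta>\<in>{\<lambda>i. 0}. ps_one \<beta> * f (\<lambda>i. \<alpha> i - \<beta> i))"
    unfolding ps_mult_alt
    by (rule sum.mono_neutral_right)
       (use finite_divisors[OF assms] in \<open>auto simp: in_divisors_of ps_one_def fun_eq_iff\<close>)
  then show ?thesis by (simp add: ps_one_def)
qed

lemma ps_mult_cong:
  assumes "finmono \<alpha>" "\<And>\<beta>. finmono \<beta> \<Longrightarrow> f \<beta> = f' \<beta>" "\<And>\<beta>. finmono \<beta> \<Longrightarrow> g \<beta> = g' \<beta>"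
  shows "ps_mult f g \<alpha> = ps_mult f' g' \<alpha>"
  unfolding ps_mult_alt
  by (intro sum.cong refl arg_cong2[where f = "(*)"] assms(2,3) finmono_divisor[OF assms(1)] diff_divisor)

lemma mult_series_geo_mult:
  assumes "finmono \<alpha>" "f $ 0 = 1"
  shows "mult_series (geo k * f) \<alpha> = mult_series f \<alpha> + ps_mult (pbar1 k) (mult_series f) \<alpha>"
proof -
  have "mult_series (geo k * f) \<alpha> = ps_mult (\<lambda>\<beta>. ps_one \<beta> + pbar1 k \<beta>) (mult_series f) \<alpha>"
    using ps_mult_mult_series[OF assms(1) _ assms(2), of "geo k"]
      ps_mult_cong[OF assms(1), of "mult_series (geo k)" "\<lambda>\<beta>. ps_one \<beta> + pbar1 k \<beta>"] one_plus_pbar1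
    by simp
  also have "\<dots> = ps_mult ps_one (mult_series f) \<alpha> + ps_mult (pbar1 k) (mult_series f) \<alpha>"
    by (simp add: ps_mult_alt distrib_right sum.distrib)
  finally show ?thesis by (simp add: ps_mult_one[OF assms(1)])
qed

text \<open>Both sides sum over pairs of exponent vectors whose sum is at most that of \<alpha>.
  This lets a new factor enter at its place in the sorted list that defines
  \<open>pbar\<close>.\<close>

lemma ps_mult_left_commute:
  assumes "finmono \<alpha>"
  shows "ps_mult f (ps_mult g h) \<alpha> = ps_mult g (ps_mult f h) \<alpha>"
proof -
  let ?S = "SIGMA \<beta>:divisors_of \<alpha>. divisors_of (\<lambda>i. \<alpha> i - \<beta> i)"
  have fin: "\<forall>\<beta>\<in>divisors_of \<alpha>. finite (divisors_of (\<lambda>i. \<alpha> i - \<beta> i))"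
    using finite_divisors finmono_divisor[OF assms diff_divisor] by blast
  have expand: "ps_mult f (ps_mult g h) \<alpha> =
    (\<Sum>(\<beta>, \<gamma>)\<in>?S. f \<beta> * (g \<gamma> * h (\<lambda>i. \<alpha> i - \<beta> i - \<gamma> i)))" for f g
    unfolding ps_mult_alt sum_distrib_left
    by (subst sum.Sigma[OF finite_divisors[OF assms] fin]) simp
  have S: "(\<beta>, \<gamma>) \<in> ?S \<longleftrightarrow> (\<forall>i. \<beta> i + \<gamma> i \<le> \<alpha> i)" for \<beta> \<gamma>
  proof -
    have "\<beta> i \<le> \<alpha> i \<and> \<gamma> i \<le> \<alpha> i - \<beta> i \<longleftrightarrow> \<beta> i + \<gamma> i \<le> \<alpha> i" for i by arith
    then show ?thesis by (simp add: in_divisors_of flip: all_conj_distrib)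
  qed
  have swap: "(\<gamma>, \<beta>) \<in> ?S" if "(\<beta>, \<gamma>) \<in> ?S" for \<beta> \<gamma>
    using that unfolding S by (simp add: add.commute)
  show ?thesis unfolding expand
  proof (rule sum.reindex_bij_witness[of _ "\<lambda>(\<beta>, \<gamma>). (\<gamma>, \<beta>)" "\<lambda>(\<beta>, \<gamma>). (\<gamma>, \<beta>)"])
    fix x assume x: "x \<in> ?S"
    obtain \<beta> \<gamma> where x_eq: "x = (\<beta>, \<gamma>)" by (cases x)
    show "(case x of (\<beta>, \<gamma>) \<Rightarrow> (\<gamma>, \<beta>)) \<in> ?S"
      unfolding x_eq prod.case by (rule swap) (use x x_eq in \<open>simp only:\<close>)
  next
    fix x assume x: "x \<in> ?S"
    obtain \<beta> \<gamma> where x_eq: "x = (\<beta>, \<gamma>)" by (cases x)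
    show "(case x of (\<beta>, \<gamma>) \<Rightarrow> (\<gamma>, \<beta>)) \<in> ?S"
      unfolding x_eq prod.case by (rule swap) (use x x_eq in \<open>simp only:\<close>)
  qed (auto simp: diff_right_commute mult_ac add.commute)
qed

lemma pbar_list_insort:
  "finmono \<alpha> \<Longrightarrow> pbar_list (insort k ks) \<alpha> = ps_mult (pbar1 k) (pbar_list ks) \<alpha>"
proof (induction ks arbitrary: \<alpha>)
  case (Cons j ks)
  show ?case
  proof (cases "k \<le> j")
    case False
    have "pbar_list (insort k (j # ks)) \<alpha> = ps_mult (pbar1 j) (ps_mult (pbar1 k) (pbar_list ks)) \<alpha>"
      using False ps_mult_cong[OF Cons.prems refl Cons.IH] by simp
    then show ?thesis using ps_mult_left_commute[OF Cons.prems] by simp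
  qed simp
qed simp

lemma pbar_add_mset:
  "finmono \<alpha> \<Longrightarrow> pbar (add_mset k lam) \<alpha> = ps_mult (pbar1 k) (pbar lam) \<alpha>"
proof -
  have "pbar lam = (\<lambda>\<beta>. pbar_list (sorted_list_of_multiset lam) \<beta>)" by (simp add: pbar_def fun_eq_iff)
  then show "finmono \<alpha> \<Longrightarrow> ?thesis" by (simp add: pbar_def pbar_list_insort)
qed

lemma pbar_empty: "pbar {#} = ps_one"
  by (simp add: pbar_def)

lemma pbar1_nonzero_deg:
  assumes "finmono \<beta>" "pbar1 k \<beta> \<noteq> 0"
  shows "k \<le> mdeg \<beta>" "0 < mdeg \<beta>"
proof -
  obtain i where i: "\<beta> i \<noteq> 0" "k dvd \<beta> i" using assms(2) by (auto simp: pbar1_def split: if_splits)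
  have "k \<le> \<beta> i" using i by (simp add: dvd_imp_le)
  also have "\<dots> \<le> mdeg \<beta>" unfolding mdeg_def using assms(1) i(1)
    by (intro member_le_sum) (auto simp: finmono_def)
  finally show "k \<le> mdeg \<beta>" .
  show "0 < mdeg \<beta>" using mdeg_pos[OF assms(1) i(1)] .
qed

text \<open>Every monomial of \<open>pbar1 k\<close> has degree at least k, and degrees add in
  products.\<close>

lemma pbar_vanishes: "finmono \<alpha> \<Longrightarrow> mdeg \<alpha> < sum_mset lam \<Longrightarrow> pbar lam \<alpha> = 0"
proof (induction lam arbitrary: \<alpha>)
  case (add k lam)
  have "pbar1 k \<beta> * pbar lam (\<lambda>i. \<alpha> i - \<beta> i) = 0" if b: "\<beta> \<in> divisors_of \<alpha>" for \<beta>
  proof (cases "pbar1 k \<beta> = 0")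
    case False
    then have "k \<le> mdeg \<beta>" using pbar1_nonzero_deg finmono_divisor[OF add.prems(1) b] by blast
    then have "mdeg (\<lambda>i. \<alpha> i - \<beta> i) < sum_mset lam"
      using mdeg_split[OF add.prems(1) b] add.prems(2) by simp
    then show ?thesis using add.IH finmono_divisor[OF add.prems(1) diff_divisor] by simp
  qed simp
  then show ?case unfolding pbar_add_mset[OF add.prems(1)] ps_mult_alt by (rule sum.neutral[OF ballI])
qed simp

text \<open>Cancellation of 1 + \<open>pbar1 k\<close>: as \<open>pbar1 k\<close> has no constant
  term, the product with it at \<alpha> only involves smaller degrees.\<close>

lemma one_plus_pbar1_inj:
  assumes "\<And>\<beta>. finmono \<beta> \<Longrightarrow> F \<beta> + ps_mult (pbar1 k) F \<beta> = G \<beta> + ps_mult (pbar1 k) G \<beta>"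
  shows "finmono \<alpha> \<Longrightarrow> F \<alpha> = G \<alpha>"
proof (induction "mdeg \<alpha>" arbitrary: \<alpha> rule: less_induct)
  case less
  have "ps_mult (pbar1 k) F \<alpha> = ps_mult (pbar1 k) G \<alpha>"
    unfolding ps_mult_alt
  proof (rule sum.cong[OF refl])
    fix \<beta> assume b: "\<beta> \<in> divisors_of \<alpha>"
    show "pbar1 k \<beta> * F (\<lambda>i. \<alpha> i - \<beta> i) = pbar1 k \<beta> * G (\<lambda>i. \<alpha> i - \<beta> i)"
    proof (cases "pbar1 k \<beta> = 0")
      case False
      then have "0 < mdeg \<beta>" using pbar1_nonzero_deg finmono_divisor[OF less.prems b] by blast
      then have "mdeg (\<lambda>i. \<alpha> i - \<beta> i) < mdeg \<alpha>" using mdeg_split[OF less.prems b] by simp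
      then show ?thesis using less.hyps finmono_divisor[OF less.prems diff_divisor] by simp
    qed simp
  qed
  then show ?case using assms[OF less.prems] by simp
qed

section \<open>Expansions cut off by degree\<close>

definition partitions_le :: "nat \<Rightarrow> nat multiset set" where
  "partitions_le N = {lam. is_partition lam \<and> sum_mset lam \<le> N}"

lemma partition_parts_bound:
  assumes "is_partition lam"
  shows "size lam \<le> sum_mset lam" and "k \<in># lam \<Longrightarrow> 0 < k \<and> k \<le> sum_mset lam"
proof -
  show "size lam \<le> sum_mset lam" using assms unfolding is_partition_def
    by (induction lam) (auto intro: add_mono simp: Suc_le_eq)
  assume "k \<in># lam"
  then obtain mu where "lam = add_mset k mu" by (metis insert_DiffM)
  then show "0 < k \<and> k \<le> sum_mset lam" using assms by (auto simp: is_partition_def)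
qed

lemma finite_partitions_le: "finite (partitions_le N)"
proof (rule finite_subset)
  show "partitions_le N \<subseteq> (\<Union>n\<le>N. multisets_of_size {..N} n)"
  proof
    fix lam assume "lam \<in> partitions_le N"
    then have l: "is_partition lam" "sum_mset lam \<le> N" by (auto simp: partitions_le_def)
    then have "size lam \<le> N" "set_mset lam \<subseteq> {..N}"
      using partition_parts_bound[OF l(1)] by (auto intro: order_trans)
    then show "lam \<in> (\<Union>n\<le>N. multisets_of_size {..N} n)" by (auto simp: multisets_of_size_def)
  qed
qed auto

definition pbar_sum :: "(nat multiset \<Rightarrow> int) \<Rightarrow> pseries" where
  "pbar_sum c \<alpha> = (\<Sum>lam\<in>partitions_le (mdeg \<alpha>). c lam * pbar lam \<alpha>)"

lemma is_pbar_expansion_iff: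
  "is_pbar_expansion F c \<longleftrightarrow>
     (\<forall>lam. \<not> is_partition lam \<longrightarrow> c lam = 0) \<and> (\<forall>\<alpha>. finmono \<alpha> \<longrightarrow> F \<alpha> = pbar_sum c \<alpha>)"
  by (simp add: is_pbar_expansion_def pbar_sum_def partitions_le_def)

text \<open>Provides one cut-off for monomials of different degrees, as is needed when an expansion
  is multiplied by a series.\<close>

lemma pbar_sum_bound:
  assumes "finmono \<alpha>" "mdeg \<alpha> \<le> N"
  shows "pbar_sum c \<alpha> = (\<Sum>lam\<in>partitions_le N. c lam * pbar lam \<alpha>)"
  unfolding pbar_sum_def
proof (rule sum.mono_neutral_left[OF finite_partitions_le])
  show "partitions_le (mdeg \<alpha>) \<subseteq> partitions_le N" using assms(2) by (auto simp: partitions_le_def)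
  show "\<forall>lam\<in>partitions_le N - partitions_le (mdeg \<alpha>). c lam * pbar lam \<alpha> = 0"
    using pbar_vanishes[OF assms(1)] by (auto simp: partitions_le_def not_le)
qed

text \<open>The factor \<open>pbar1 k\<close> adds a part k to each partition; those that then
  exceed the degree of \<alpha> contribute zero by \<open>pbar_vanishes\<close>.\<close>

lemma pbar1_mult_pbar_sum:
  assumes "finmono \<alpha>" "0 < k"
  shows "ps_mult (pbar1 k) (pbar_sum c) \<alpha> = pbar_sum (\<lambda>mu. if k \<in># mu then c (mu - {#k#}) else 0) \<alpha>"
proof -
  let ?N = "mdeg \<alpha>"
  have "ps_mult (pbar1 k) (pbar_sum c) \<alpha> =
    (\<Sum>\<beta>\<in>divisors_of \<alpha>. \<Sum>lam\<in>partitions_le ?N. c lam * (pbar1 k \<beta> * pbar lam (\<lambda>i. \<alpha> i - \<beta> i)))"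
    unfolding ps_mult_alt
  proof (rule sum.cong[OF refl])
    fix \<beta> assume "\<beta> \<in> divisors_of \<alpha>"
    then have "mdeg (\<lambda>i. \<alpha> i - \<beta> i) \<le> ?N" using mdeg_split[OF assms(1)] by simp
    from pbar_sum_bound[OF finmono_divisor[OF assms(1) diff_divisor] this]
    show "pbar1 k \<beta> * pbar_sum c (\<lambda>i. \<alpha> i - \<beta> i) =
      (\<Sum>lam\<in>partitions_le ?N. c lam * (pbar1 k \<beta> * pbar lam (\<lambda>i. \<alpha> i - \<beta> i)))"
      by (simp add: sum_distrib_left mult_ac)
  qed
  also have "\<dots> = (\<Sum>lam\<in>partitions_le ?N. c lam * pbar (add_mset k lam) \<alpha>)"
    by (subst sum.swap) (simp add: pbar_add_mset[OF assms(1)] ps_mult_alt sum_distrib_left)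
  also have "\<dots> = (\<Sum>lam\<in>{lam\<in>partitions_le ?N. add_mset k lam \<in> partitions_le ?N}. c lam * pbar (add_mset k lam) \<alpha>)"
    by (rule sum.mono_neutral_right[OF finite_partitions_le])
       (use assms in \<open>auto simp: partitions_le_def is_partition_def not_le intro!: pbar_vanishes\<close>)
  also have "\<dots> = (\<Sum>mu\<in>{mu\<in>partitions_le ?N. k \<in># mu}. c (mu - {#k#}) * pbar mu \<alpha>)"
  proof (rule sum.reindex_bij_witness[of _ "\<lambda>mu. mu - {#k#}" "add_mset k"])
    fix mu assume mu: "mu \<in> {mu\<in>partitions_le ?N. k \<in># mu}"
    then have e: "add_mset k (mu - {#k#}) = mu" by simp
    then show "add_mset k (mu - {#k#}) = mu" .
    from arg_cong[OF this, of sum_mset] have "k + sum_mset (mu - {#k#}) = sum_mset mu" by simp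
    then show "mu - {#k#} \<in> {lam\<in>partitions_le ?N. add_mset k lam \<in> partitions_le ?N}"
      using mu e assms(2) by (auto simp: partitions_le_def is_partition_def dest: in_diffD)
  qed (use assms in \<open>auto simp: partitions_le_def is_partition_def\<close>)
  also have "\<dots> = pbar_sum (\<lambda>mu. if k \<in># mu then c (mu - {#k#}) else 0) \<alpha>"
    unfolding pbar_sum_def sum.inter_filter[OF finite_partitions_le] by (intro sum.cong) auto
  finally show ?thesis .
qed

subsection \<open>Binomial coefficients\<close>

text \<open>The coefficient of y^r in (1 + y)^n for odd k and in (1 + y)^(-n) for even k, where y
  stands for \<open>pbar1 k\<close>.\<close>

definition signed_choice :: "nat \<Rightarrow> nat \<Rightarrow> nat \<Rightarrow> int" where
  "signed_choice k n r = (if odd k then int (n choose r) else (-1) ^ r * int (multichoose n r))"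

text \<open>For n = 0 the truncated subtraction in \<open>multichoose\<close> gives 0 choose 0,
  which is the desired value 1.\<close>

lemma signed_choice_0 [simp]: "signed_choice k n 0 = 1"
  by (simp add: signed_choice_def multichoose_def)

lemma signed_choice_zero_Suc [simp]: "signed_choice k 0 (Suc r) = 0"
  by (simp add: signed_choice_def multichoose_def)

lemma signed_choice_odd:
  "odd k \<Longrightarrow> signed_choice k (Suc n) (Suc r) = signed_choice k n (Suc r) + signed_choice k n r"
  by (simp add: signed_choice_def)

text \<open>Pascal's rule read as (1 + y)^(-n) = (1 + y) (1 + y)^(-n-1).\<close>

lemma signed_choice_even:
  "even k \<Longrightarrow> signed_choice k n (Suc r) = signed_choice k (Suc n) (Suc r) + signed_choice k (Suc n) r"
  by (simp add: signed_choice_def multichoose_def algebra_simps)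

text \<open>Coefficient of \<open>pbar lam\<close> in the product of the powers of 1 +
  \<open>pbar1 k\<close> with exponent plus or minus \<open>count m k\<close>; a part missing from
  \<open>lam\<close> contributes the constant term 1.\<close>

definition expansion_coeff :: "nat multiset \<Rightarrow> nat multiset \<Rightarrow> int" where
  "expansion_coeff m lam = (\<Prod>k\<in>set_mset lam. signed_choice k (count m k) (count lam k))"

lemma expansion_coeff_split:
  "expansion_coeff m lam = signed_choice k (count m k) (count lam k) *
     (\<Prod>j\<in>set_mset lam - {k}. signed_choice j (count m j) (count lam j))"
proof (cases "k \<in># lam")
  case True
  then show ?thesis by (simp add: expansion_coeff_def prod.remove[of _ k])
next
  case False
  then show ?thesis by (simp add: expansion_coeff_def not_in_iff)
qed

lemma expansion_coeff_rest:
  assumes "k \<in># mu"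
  shows "(\<Prod>j\<in>set_mset (mu - {#k#}) - {k}. signed_choice j (count m j) (count (mu - {#k#}) j)) =
    (\<Prod>j\<in>set_mset mu - {k}. signed_choice j (count (add_mset k m) j) (count mu j))"
    "(\<Prod>j\<in>set_mset (mu - {#k#}) - {k}. signed_choice j (count (add_mset k m) j) (count (mu - {#k#}) j)) =
    (\<Prod>j\<in>set_mset mu - {k}. signed_choice j (count m j) (count mu j))"
proof -
  have "set_mset (mu - {#k#}) - {k} = set_mset mu - {k}"
    using assms by (metis insert_Diff_single insert_DiffM set_mset_add_mset_insert Diff_insert_absorb Diff_insert2 Diff_idemp insert_Diff_if singletonI)
  then show "(\<Prod>j\<in>set_mset (mu - {#k#}) - {k}. signed_choice j (count m j) (count (mu - {#k#}) j)) =
    (\<Prod>j\<in>set_mset mu - {k}. signed_choice j (count (add_mset k m) j) (count mu j))"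
    "(\<Prod>j\<in>set_mset (mu - {#k#}) - {k}. signed_choice j (count (add_mset k m) j) (count (mu - {#k#}) j)) =
    (\<Prod>j\<in>set_mset mu - {k}. signed_choice j (count m j) (count mu j))"
    by (auto intro!: prod.cong)
qed

lemma expansion_coeff_not_in:
  "k \<notin># mu \<Longrightarrow> expansion_coeff (add_mset k m) mu = expansion_coeff m mu"
  unfolding expansion_coeff_def by (rule prod.cong) auto

text \<open>Pascal's rule at the factor k. The second summand is the shift of
  \<open>pbar1_mult_pbar_sum\<close>, so this is multiplication by 1 +
  \<open>pbar1 k\<close>.\<close>

lemma expansion_coeff_odd:
  assumes "odd k"
  shows "expansion_coeff (add_mset k m) mu =
    expansion_coeff m mu + (if k \<in># mu then expansion_coeff m (mu - {#k#}) else 0)"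
proof (cases "k \<in># mu")
  case True
  then obtain r where r: "count mu k = Suc r" by (metis count_greater_zero_iff gr0_implies_Suc)
  have "(\<Prod>j\<in>set_mset mu - {k}. signed_choice j (count (add_mset k m) j) (count mu j)) =
    (\<Prod>j\<in>set_mset mu - {k}. signed_choice j (count m j) (count mu j))"
    by (rule prod.cong) auto
  then show ?thesis
    unfolding expansion_coeff_split[of _ _ k] expansion_coeff_rest[OF True]
    using True r by (simp add: signed_choice_odd[OF assms] distrib_right)
qed (simp add: expansion_coeff_not_in)

text \<open>Solved for the smaller multiset, because an additional even part divides by 1 +
  \<open>pbar1 k\<close>.\<close>

lemma expansion_coeff_even:
  assumes "even k"
  shows "expansion_coeff m mu =
    expansion_coeff (add_mset k m) mu + (if k \<in># mu then expansion_coeff (add_mset k m) (mu - {#k#}) else 0)"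
proof (cases "k \<in># mu")
  case True
  then obtain r where r: "count mu k = Suc r" by (metis count_greater_zero_iff gr0_implies_Suc)
  have "(\<Prod>j\<in>set_mset mu - {k}. signed_choice j (count (add_mset k m) j) (count mu j)) =
    (\<Prod>j\<in>set_mset mu - {k}. signed_choice j (count m j) (count mu j))"
    by (rule prod.cong) auto
  then show ?thesis
    unfolding expansion_coeff_split[of _ _ k] expansion_coeff_rest[OF True]
    using True r by (simp add: signed_choice_even[OF assms, of "count m k" r] distrib_right)
qed (simp add: expansion_coeff_not_in)

lemma pbar_sum_add: "pbar_sum (\<lambda>mu. c mu + d mu) \<alpha> = pbar_sum c \<alpha> + pbar_sum d \<alpha>"
  by (simp add: pbar_sum_def distrib_right sum.distrib)

text \<open>Adding a part to m multiplies both sides by 1 plus a basis element if the part is odd,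
  and divides by it if the part is even.\<close>

lemma mult_series_euler_product:
  "0 \<notin># m \<Longrightarrow> finmono \<alpha> \<Longrightarrow> mult_series (euler_product m) \<alpha> = pbar_sum (expansion_coeff m) \<alpha>"
proof (induction m arbitrary: \<alpha>)
  case empty
  have z: "expansion_coeff {#} lam = (if lam = {#} then 1 else 0)" for lam
  proof (cases "lam = {#}")
    case False
    then obtain k where k: "k \<in># lam" by blast
    then obtain r where "count lam k = Suc r" by (metis count_greater_zero_iff gr0_implies_Suc)
    then show ?thesis using False k unfolding expansion_coeff_def by (auto intro!: prod_zero bexI[of _ k])
  qed (simp add: expansion_coeff_def)
  have "pbar_sum (expansion_coeff {#}) \<alpha> = (\<Sum>lam\<in>{{#}}. expansion_coeff {#} lam * pbar lam \<alpha>)"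
    unfolding pbar_sum_def
    by (rule sum.mono_neutral_right[OF finite_partitions_le]) (auto simp: z partitions_le_def is_partition_def)
  also have "\<dots> = mult_series 1 \<alpha>"
    using finite_supp[OF empty(2)]
    by (auto simp: z pbar_empty ps_one_def mult_series_def supp_def card_gt_0_iff)
  finally show ?case by (simp add: euler_product_def)
next
  case (add k m)
  have k: "0 < k" and m0: "0 \<notin># m" using add.prems(1) by auto
  have e0: "euler_product m $ 0 = 1" "euler_product (add_mset k m) $ 0 = 1"
    using euler_product_0 add.prems(1) m0 by blast+
  have IH: "mult_series (euler_product m) \<beta> = pbar_sum (expansion_coeff m) \<beta>" if "finmono \<beta>" for \<beta>
    using add.IH[OF m0 that] .
  show ?case
  proof (cases "odd k")
    case True
    then have "euler_product (add_mset k m) = geo k * euler_product m"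
      by (simp add: euler_product_def euler_factor_def)
    then have "mult_series (euler_product (add_mset k m)) \<alpha> =
      pbar_sum (expansion_coeff m) \<alpha> + ps_mult (pbar1 k) (pbar_sum (expansion_coeff m)) \<alpha>"
      using mult_series_geo_mult[OF add.prems(2) e0(1)] IH[OF add.prems(2)]
        ps_mult_cong[OF add.prems(2) refl IH] by simp
    also have "\<dots> = pbar_sum (expansion_coeff (add_mset k m)) \<alpha>"
      unfolding pbar1_mult_pbar_sum[OF add.prems(2) k] pbar_sum_add[symmetric]
      unfolding expansion_coeff_odd[OF True, abs_def] ..
    finally show ?thesis .
  next
    case False
    then have "euler_product (add_mset k m) = (1 - fps_X ^ k) * euler_product m"
      by (simp add: euler_product_def euler_factor_def)
    then have "geo k * euler_product (add_mset k m) = ((1 - fps_X ^ k) * geo k) * euler_product m"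
      by (simp only: mult.assoc mult.left_commute)
    then have ep: "euler_product m = geo k * euler_product (add_mset k m)"
      by (simp only: geo_mult[OF k] mult_1_left)
    show ?thesis
    \<comment> \<open>Multiplying both sides by 1 + \<open>pbar1 k\<close> leads back to the product
      over m, where the induction hypothesis is available.\<close>
    proof (rule one_plus_pbar1_inj[of _ k, OF _ add.prems(2)])
      fix \<beta> assume b: "finmono \<beta>"
      have "mult_series (euler_product (add_mset k m)) \<beta> +
        ps_mult (pbar1 k) (mult_series (euler_product (add_mset k m))) \<beta> = mult_series (euler_product m) \<beta>"
        unfolding ep by (rule mult_series_geo_mult[OF b e0(2), symmetric])
      also have "\<dots> = pbar_sum (expansion_coeff m) \<beta>" by (rule IH[OF b])
      also have "\<dots> = pbar_sum (expansion_coeff (add_mset k m)) \<beta> +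
        ps_mult (pbar1 k) (pbar_sum (expansion_coeff (add_mset k m))) \<beta>"
        unfolding pbar1_mult_pbar_sum[OF b k] pbar_sum_add[symmetric]
        using expansion_coeff_even[of k m] False by presburger
      finally show "mult_series (euler_product (add_mset k m)) \<beta> +
        ps_mult (pbar1 k) (mult_series (euler_product (add_mset k m))) \<beta> =
        pbar_sum (expansion_coeff (add_mset k m)) \<beta> +
        ps_mult (pbar1 k) (pbar_sum (expansion_coeff (add_mset k m))) \<beta>" .
    qed
  qed
qed

subsection \<open>Uniqueness of the expansion\<close>

text \<open>In its lowest degree \<open>pbar lam\<close> is a product of power sums, whose monomials
  arise by adding up some of the parts. The number of variables reaches the number of parts only if
  no two parts are added.\<close>

lemma pbar_top_degree:
  assumes "finmono \<alpha>" "mdeg \<alpha> = sum_mset lam" "is_partition lam" "pbar lam \<alpha> \<noteq> 0"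
  shows "card (supp \<alpha>) \<le> size lam \<and>
    (card (supp \<alpha>) = size lam \<longrightarrow> image_mset \<alpha> (mset_set (supp \<alpha>)) = lam)"
  using assms
proof (induction lam arbitrary: \<alpha>)
  case empty
  then have "supp \<alpha> = {}" by (auto simp: pbar_empty ps_one_def supp_def split: if_splits)
  then show ?case by simp
next
  case (add k lam)
  have k: "0 < k" and lam: "is_partition lam" using add.prems(3) by (auto simp: is_partition_def)
  obtain \<beta> where b: "\<beta> \<in> divisors_of \<alpha>" "pbar1 k \<beta> \<noteq> 0" "pbar lam (\<lambda>i. \<alpha> i - \<beta> i) \<noteq> 0"
    using add.prems(4) unfolding pbar_add_mset[OF add.prems(1)] ps_mult_alt
    by (metis (no_types, lifting) mult_eq_0_iff sum.neutral)
  define \<gamma> where "\<gamma> = (\<lambda>i. \<alpha> i - \<beta> i)"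
  have fb: "finmono \<beta>" and fg: "finmono \<gamma>"
    using finmono_divisor[OF add.prems(1)] b(1) diff_divisor by (auto simp: \<gamma>_def)
  \<comment> \<open>The total degree is least possible, so both factors have exactly their least
    degree; \<beta>, with some exponent at least k, is then the single power x_i^k.\<close>
  have "k \<le> mdeg \<beta>" using pbar1_nonzero_deg[OF fb b(2)] by simp
  moreover have "sum_mset lam \<le> mdeg \<gamma>" using pbar_vanishes[OF fg] b(3) by (force simp: \<gamma>_def)
  ultimately have deg: "mdeg \<beta> = k" "mdeg \<gamma> = sum_mset lam"
    using mdeg_split[OF add.prems(1) b(1)] add.prems(2) by (auto simp: \<gamma>_def)
  obtain i where i: "\<beta> i \<noteq> 0" "k dvd \<beta> i" using b(2) by (auto simp: pbar1_def split: if_splits)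
  have "k \<le> \<beta> i" using i by (simp add: dvd_imp_le)
  have mb: "mdeg \<beta> = \<beta> i + (\<Sum>j\<in>supp \<beta> - {i}. \<beta> j)"
    using i(1) finite_supp[OF fb] by (simp add: mdeg_alt[OF _ order_refl] sum.remove[of _ i] supp_def)
  have bi: "\<beta> i = k" using mb deg(1) \<open>k \<le> \<beta> i\<close> by simp
  then have "(\<Sum>j\<in>supp \<beta> - {i}. \<beta> j) = 0" using mb deg(1) by simp
  then have "\<forall>j\<in>supp \<beta> - {i}. \<beta> j = 0" using finite_supp[OF fb] by (subst (asm) sum_eq_0_iff) auto
  then have bj: "\<beta> j = 0" if "j \<noteq> i" for j using that by (auto simp: supp_def)
  have al: "\<alpha> i = \<gamma> i + k" "\<And>j. j \<noteq> i \<Longrightarrow> \<alpha> j = \<gamma> j"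
    using b(1) bi bj by (auto simp: \<gamma>_def in_divisors_of)
  have s: "supp \<alpha> = insert i (supp \<gamma>)"
  proof (rule set_eqI)
    fix j show "j \<in> supp \<alpha> \<longleftrightarrow> j \<in> insert i (supp \<gamma>)"
      using al k by (cases "j = i") (auto simp: supp_def)
  qed
  have IH: "card (supp \<gamma>) \<le> size lam"
    "card (supp \<gamma>) = size lam \<Longrightarrow> image_mset \<gamma> (mset_set (supp \<gamma>)) = lam"
    using add.IH[OF fg deg(2) lam] b(3) by (auto simp: \<gamma>_def)
  note fin = finite_supp[OF fg]
  show ?case
  proof (intro conjI impI)
    show "card (supp \<alpha>) \<le> size (add_mset k lam)"
      unfolding s using IH(1) card_insert_le_m1[of "Suc (size lam)" "supp \<gamma>" i] by simp
    assume e: "card (supp \<alpha>) = size (add_mset k lam)"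
    then have i': "i \<notin> supp \<gamma>" and "card (supp \<gamma>) = size lam"
      using IH(1) fin unfolding s by (auto simp: card_insert_if split: if_splits)
    then have "image_mset \<gamma> (mset_set (supp \<gamma>)) = lam" using IH(2) by simp
    moreover have "image_mset \<alpha> (mset_set (supp \<gamma>)) = image_mset \<gamma> (mset_set (supp \<gamma>))"
    proof (rule image_mset_cong)
      fix j assume "j \<in># mset_set (supp \<gamma>)"
      then have "j \<noteq> i" using i' fin by auto
      then show "\<alpha> j = \<gamma> j" by (rule al(2))
    qed
    moreover have "\<alpha> i = k" using al(1) i' by (simp add: supp_def)
    ultimately show "image_mset \<alpha> (mset_set (supp \<alpha>)) = add_mset k lam"
      unfolding s using i' fin by simp
  qed
qed

lemma pbar_nonneg: "finmono \<alpha> \<Longrightarrow> 0 \<le> pbar lam \<alpha>"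
proof (induction lam arbitrary: \<alpha>)
  case (add k lam)
  then show ?case unfolding pbar_add_mset[OF add.prems] ps_mult_alt
    by (intro sum_nonneg mult_nonneg_nonneg add.IH finmono_divisor[OF add.prems diff_divisor])
       (auto simp: pbar1_def)
qed (simp add: pbar_empty ps_one_def)

text \<open>All coefficients are nonnegative, so it suffices to exhibit one factorisation: split off
  a variable whose exponent is k.\<close>

lemma pbar_pos:
  "finmono \<alpha> \<Longrightarrow> image_mset \<alpha> (mset_set (supp \<alpha>)) = lam \<Longrightarrow> 0 < pbar lam \<alpha>"
proof (induction lam arbitrary: \<alpha>)
  case empty
  then have "supp \<alpha> = {}" using finite_supp by (simp add: mset_set_empty_iff)
  then show ?case by (simp add: pbar_empty ps_one_def supp_def)
next
  case (add k lam)
  note fin = finite_supp[OF add.prems(1)]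
  have "k \<in># image_mset \<alpha> (mset_set (supp \<alpha>))" using add.prems(2) by simp
  then obtain i where i: "i \<in> supp \<alpha>" "\<alpha> i = k" using fin by auto
  define \<beta> where "\<beta> = (\<lambda>j. if j = i then k else 0)"
  define \<gamma> where "\<gamma> = (\<lambda>j. \<alpha> j - \<beta> j)"
  have b: "\<beta> \<in> divisors_of \<alpha>" using i by (simp add: in_divisors_of \<beta>_def)
  have fg: "finmono \<gamma>" unfolding \<gamma>_def by (rule finmono_divisor[OF add.prems(1) diff_divisor])
  have "supp \<gamma> = supp \<alpha> - {i}" using i by (auto simp: supp_def \<gamma>_def \<beta>_def split: if_splits)
  moreover have "image_mset \<gamma> (mset_set (supp \<alpha> - {i})) = image_mset \<alpha> (mset_set (supp \<alpha> - {i}))"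
    using fin by (intro image_mset_cong) (auto simp: \<gamma>_def \<beta>_def)
  moreover have "add_mset k (image_mset \<alpha> (mset_set (supp \<alpha> - {i}))) = add_mset k lam"
    using add.prems(2) i fin by (simp add: mset_set.remove[of _ i])
  ultimately have pg: "0 < pbar lam \<gamma>" using add.IH[OF fg] by simp
  show ?case unfolding pbar_add_mset[OF add.prems(1)] ps_mult_alt
  proof (rule sum_pos2[OF finite_divisors[OF add.prems(1)] b])
    have "0 < k" using i by (auto simp: supp_def)
    then have "pbar1 k \<beta> = 1" by (auto simp: pbar1_def \<beta>_def)
    then show "0 < pbar1 k \<beta> * pbar lam (\<lambda>j. \<alpha> j - \<beta> j)" using pg by (simp add: \<gamma>_def)
  next
    fix \<beta>' assume "\<beta>' \<in> divisors_of \<alpha>"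
    show "0 \<le> pbar1 k \<beta>' * pbar lam (\<lambda>j. \<alpha> j - \<beta>' j)"
      using pbar_nonneg[OF finmono_divisor[OF add.prems(1) diff_divisor]] by (simp add: pbar1_def)
  qed
qed

lemma partition_monomial:
  assumes "is_partition lam"
  shows "\<exists>\<alpha>. finmono \<alpha> \<and> image_mset \<alpha> (mset_set (supp \<alpha>)) = lam"
proof -
  obtain xs where xs: "mset xs = lam" by (metis ex_mset)
  define \<alpha> where "\<alpha> = (\<lambda>i. if i < length xs then xs ! i else 0)"
  have s: "supp \<alpha> = {0..<length xs}"
  proof -
    have "xs ! i \<noteq> 0" if "i < length xs" for i
      using partition_parts_bound(2)[OF assms, of "xs ! i"] nth_mem[OF that] by (simp flip: xs)
    then show ?thesis by (auto simp: supp_def \<alpha>_def)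
  qed
  have "image_mset \<alpha> (mset_set {0..<length xs}) = mset (map \<alpha> [0..<length xs])" by simp
  also have "map \<alpha> [0..<length xs] = map ((!) xs) [0..<length xs]" by (simp add: \<alpha>_def)
  also have "\<dots> = xs" by (rule map_nth)
  finally show ?thesis using s xs unfolding finmono_def supp_def
    by (intro exI[of _ \<alpha>]) (simp add: supp_def)
qed

text \<open>Among the partitions of least size with nonzero coefficient take one with the most
  parts, and test at the monomial with these parts as exponents. By \<open>pbar_top_degree\<close>
  any other contributing partition would need more parts.\<close>

lemma pbar_sum_zero:
  assumes zero: "\<And>\<alpha>. finmono \<alpha> \<Longrightarrow> pbar_sum d \<alpha> = 0" and "is_partition lam0"
  shows "d lam0 = 0"
proof (rule ccontr)
  assume nz: "d lam0 \<noteq> 0"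
  define P where "P = (\<lambda>n. \<exists>lam. is_partition lam \<and> sum_mset lam = n \<and> d lam \<noteq> 0)"
  have "P (sum_mset lam0)" using nz assms(2) by (auto simp: P_def)
  define n where "n = (LEAST n. P n)"
  have Pn: "P n" unfolding n_def by (rule LeastI) fact
  define T where "T = {lam \<in> partitions_le n. d lam \<noteq> 0}"
  have T: "is_partition lam \<and> sum_mset lam = n" if "lam \<in> T" for lam
  proof -
    have "P (sum_mset lam)" using that by (auto simp: P_def T_def partitions_le_def)
    then have "n \<le> sum_mset lam" unfolding n_def by (rule Least_le)
    then show ?thesis using that by (auto simp: T_def partitions_le_def)
  qed
  have finT: "finite T" unfolding T_def using finite_partitions_le by simp
  have "T \<noteq> {}" using Pn by (auto simp: P_def T_def partitions_le_def)
  then have "Max (size ` T) \<in> size ` T" using finT by (intro Max_in) auto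
  then obtain lam where lam: "lam \<in> T" "size lam = Max (size ` T)" by auto
  have max: "size mu \<le> size lam" if "mu \<in> T" for mu using that finT lam(2) by simp
  obtain \<alpha> where al: "finmono \<alpha>" "image_mset \<alpha> (mset_set (supp \<alpha>)) = lam"
    using partition_monomial T[OF lam(1)] by blast
  have deg: "mdeg \<alpha> = n"
    using mdeg_alt[OF finite_supp[OF al(1)] order_refl] al(2) T[OF lam(1)] by (simp add: sum_unfold_sum_mset)
  have card: "card (supp \<alpha>) = size lam" using al(2) by (metis size_image_mset size_mset_set)
  have "pbar_sum d \<alpha> = (\<Sum>mu\<in>{lam}. d mu * pbar mu \<alpha>)"
    unfolding pbar_sum_def deg
  proof (rule sum.mono_neutral_right[OF finite_partitions_le])
    show "{lam} \<subseteq> partitions_le n" using lam(1) by (simp add: T_def)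
    show "\<forall>mu\<in>partitions_le n - {lam}. d mu * pbar mu \<alpha> = 0"
    proof (intro ballI, rule ccontr)
      fix mu assume mu: "mu \<in> partitions_le n - {lam}" "d mu * pbar mu \<alpha> \<noteq> 0"
      then have muT: "mu \<in> T" and ne: "pbar mu \<alpha> \<noteq> 0" by (auto simp: T_def)
      have "card (supp \<alpha>) \<le> size mu \<and> (card (supp \<alpha>) = size mu \<longrightarrow> image_mset \<alpha> (mset_set (supp \<alpha>)) = mu)"
        using pbar_top_degree[OF al(1) _ _ ne] T[OF muT] deg by simp
      then show False using max[OF muT] card al(2) mu(1) by auto
    qed
  qed
  moreover have "d lam \<noteq> 0" using lam(1) by (simp add: T_def)
  ultimately show False using zero[OF al(1)] pbar_pos[OF al] by simp
qed

lemma pbar_coeff_eqI: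
  assumes "is_pbar_expansion F c"
  shows "pbar_coeff F = c"
  unfolding pbar_coeff_def
proof (rule the_equality[of "is_pbar_expansion F", OF assms])
  fix c' assume c': "is_pbar_expansion F c'"
  show "c' = c"
  proof
    fix lam
    show "c' lam = c lam"
    proof (cases "is_partition lam")
      case True
      have "c' lam - c lam = 0"
      proof (rule pbar_sum_zero[OF _ True])
        fix \<alpha> assume "finmono \<alpha>"
        then have "pbar_sum c' \<alpha> = pbar_sum c \<alpha>" using assms c' by (simp add: is_pbar_expansion_iff)
        then show "pbar_sum (\<lambda>mu. c' mu - c mu) \<alpha> = 0"
          by (simp add: pbar_sum_def left_diff_distrib sum_subtractf)
      qed
      then show ?thesis by simp
    next
      case False
      then show ?thesis using assms c' by (simp add: is_pbar_expansion_iff)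
    qed
  qed
qed

subsection \<open>Inclusion and exclusion\<close>

text \<open>With T = V - W a fixed x contributes the alternating sum over the subsets of
  \<open>V - u x\<close>, which vanishes unless \<open>u x = V\<close>.\<close>

lemma inclusion_exclusion_cover:
  assumes F: "finite F" and V: "finite V" and u: "\<And>x. x \<in> F \<Longrightarrow> u x \<subseteq> V"
  shows "int (card {x \<in> F. u x = V}) =
    (\<Sum>W\<in>Pow V. (-1) ^ card (V - W) * int (card {x \<in> F. u x \<subseteq> W}))"
proof -
  have *: "(\<Sum>W\<in>Pow V. if u x \<subseteq> W then (-1) ^ card (V - W) else 0) = (if u x = V then 1 else 0 :: int)"
    if x: "x \<in> F" for x
  proof -
    have "(\<Sum>W\<in>Pow V. if u x \<subseteq> W then (-1) ^ card (V - W) else 0 :: int) =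
      (\<Sum>W\<in>{W\<in>Pow V. u x \<subseteq> W}. (-1) ^ card (V - W))"
      using V by (intro sum.inter_filter[symmetric]) simp
    also have "\<dots> = (\<Sum>T\<in>Pow (V - u x). (-1) ^ card T)"
      by (rule sum.reindex_bij_witness[of _ "\<lambda>T. V - T" "\<lambda>W. V - W"]) (use u[OF x] in auto)
    also have "\<dots> = (if u x = V then 1 else 0)"
      using sum_Pow_minus_one_power[of "V - u x"] V u[OF x] by auto
    finally show ?thesis .
  qed
  have "(\<Sum>W\<in>Pow V. (-1) ^ card (V - W) * int (card {x \<in> F. u x \<subseteq> W})) =
    (\<Sum>W\<in>Pow V. \<Sum>x\<in>F. if u x \<subseteq> W then (-1) ^ card (V - W) else 0)"
    using F by (intro sum.cong refl) (simp add: sum.inter_filter[symmetric])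
  also have "\<dots> = (\<Sum>x\<in>F. if u x = V then 1 else 0)"
    by (subst sum.swap) (use * in simp)
  also have "\<dots> = int (card {x \<in> F. u x = V})"
    using F by (simp add: sum.inter_filter[symmetric])
  finally show ?thesis ..
qed

subsection \<open>Lyndon heaps on induced subgraphs\<close>

lemma swap_step_set: "swap_step E xs ys \<Longrightarrow> set ys = set xs"
  by (auto simp: swap_step_def)

text \<open>Swaps preserve the set of letters, and on letters from W both edge relations
  agree.\<close>

lemma heap_eq_induced:
  assumes "set xs \<subseteq> W"
  shows "heap_eq (induced E W) xs ys \<longleftrightarrow> heap_eq E xs ys"
proof -
  have swap: "swap_step (induced E W) xs ys \<longleftrightarrow> swap_step E xs ys" if "set xs \<subseteq> W" for xs ys
    using that by (auto simp: swap_step_def induced_def)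
  have "heap_eq (induced E W) xs ys \<Longrightarrow> heap_eq E xs ys \<and> set ys = set xs"
    unfolding heap_eq_def
  proof (induction rule: rtranclp_induct)
    case (step y z)
    then show ?case using assms swap[of y z] swap_step_set[of _ y z]
      by (auto intro: rtranclp.rtrancl_into_rtrancl)
  qed simp
  moreover have "heap_eq E xs ys \<Longrightarrow> heap_eq (induced E W) xs ys \<and> set ys = set xs"
    unfolding heap_eq_def
  proof (induction rule: rtranclp_induct)
    case (step y z)
    then show ?case using assms swap[of y z] swap_step_set[of _ y z]
      by (auto intro: rtranclp.rtrancl_into_rtrancl)
  qed simp
  ultimately show ?thesis by blast
qed

lemma pyramid_induced:
  assumes "set w \<subseteq> W"
  shows "pyramid (induced E W) w \<longleftrightarrow> pyramid E w"
proof -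
  have "w ! i \<in> W" if "i < length w" for i using assms that by auto
  then have "(\<lambda>i j. i < j \<and> j < length w \<and> (w ! i = w ! j \<or> induced E W (w ! i) (w ! j))) =
    (\<lambda>i j. i < j \<and> j < length w \<and> (w ! i = w ! j \<or> E (w ! i) (w ! j)))"
    by (auto simp: fun_eq_iff induced_def)
  then show ?thesis by (simp add: pyramid_def piece_lt_def)
qed

context ordered_heap_graph
begin

lemma heap_graph_induced: "heap_graph (induced E W)"
  by unfold_locales (auto simp: induced_def E_sym E_irrefl)

text \<open>Conjugators are supported on P, so P X stays inside W, where the two commutation
  relations agree.\<close>

lemma conjug_induced:
  assumes "set P \<subseteq> W"
  shows "heap_graph.conjug (induced E W) P Q \<longleftrightarrow> conjug P Q"
proof -
  have "heap_eq (induced E W) (P @ X) (X @ Q) \<longleftrightarrow> P @ X \<approx> X @ Q" if "set X \<subseteq> set P" for X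
    using that assms by (intro heap_eq_induced) auto
  then show ?thesis unfolding conjug_def heap_graph.conjug_def[OF heap_graph_induced] by blast
qed

text \<open>All rotations of w use the letters of w, so standard words, periodicity and rotation
  class are the same in both graphs. Every induced subgraph can thus be treated inside E by
  restricting letters.\<close>

lemma lyndon_induced:
  assumes w: "set w \<subseteq> W"
  shows "lyndon (induced E W) w \<longleftrightarrow> lyndon E w"
proof (cases "pyramid E w")
  case True
  have "rot_equiv (induced E W) w u \<longleftrightarrow> pyramid (induced E W) u \<and> conjug w u" for u
    using heap_graph.rot_equiv_iff[OF heap_graph_induced] True w
    by (simp add: pyramid_induced conjug_induced)
  moreover have "set u = set w" if "conjug w u" for u
    using that conj_set by (auto simp: conjug_def)
  ultimately have "rot_equiv (induced E W) w u \<longleftrightarrow> rot_equiv E w u"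
    and "rot_equiv E w u \<Longrightarrow> set u \<subseteq> W" for u
    using pyramid_induced[of u W E] rot_equiv_iff[OF True] w by auto
  moreover have "std_word (induced E W) u = std_word E u" if "set u \<subseteq> W" for u
    using that by (simp add: std_word_def heap_eq_induced)
  moreover have "periodic (induced E W) w \<longleftrightarrow> periodic E w"
    using w by (simp add: periodic_def heap_eq_induced)
  ultimately show ?thesis using w by (simp add: lyndon_def pyramid_induced)
next
  case False
  then show ?thesis using w by (simp add: lyndon_def pyramid_induced)
qed

lemma lyndon_heaps_eq:
  "lyndon_heaps E W k = {{ys. xs \<approx> ys} | xs. set xs \<subseteq> W \<and> length xs = k \<and> lyndon E xs}"
proof -
  have "{{ys. heap_eq (induced E W) xs ys} | xs. set xs \<subseteq> W \<and> length xs = k \<and> lyndon (induced E W) xs} =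
    {{ys. xs \<approx> ys} | xs. set xs \<subseteq> W \<and> length xs = k \<and> lyndon E xs}"
    by (rule Collect_cong) (metis (no_types, lifting) heap_eq_induced lyndon_induced Collect_cong)
  then show ?thesis by (simp add: lyndon_heaps_def)
qed

lemma card_lyndon_heaps: "card (lyndon_heaps E W k) = card (lyndon_words W k)"
  unfolding lyndon_heaps_eq by (rule bij_betw_same_card[OF bij_lyndon_words, symmetric])

lemma finite_lyndon_heaps: "finite W \<Longrightarrow> finite (lyndon_heaps E W k)"
  unfolding lyndon_heaps_eq
  by (subst bij_betw_finite[OF bij_lyndon_words, symmetric]) (simp add: lyndon_words_def finite_heaps)

lemma heap_used_class: "heap_used {ys. xs \<approx> ys} = set xs"
  unfolding heap_used_def using heq_set heq_refl by blast

lemma lyndon_heaps_subset: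
  "W \<subseteq> V \<Longrightarrow> lyndon_heaps E W k = {H \<in> lyndon_heaps E V k. heap_used H \<subseteq> W}"
  unfolding lyndon_heaps_eq by (auto simp: heap_used_class)

lemma lyndon_heaps_disjoint:
  "j \<noteq> k \<Longrightarrow> lyndon_heaps E W j \<inter> lyndon_heaps E W k = {}"
proof (rule ccontr)
  assume "j \<noteq> k" "lyndon_heaps E W j \<inter> lyndon_heaps E W k \<noteq> {}"
  then obtain xs ys where "{zs. xs \<approx> zs} = {zs. ys \<approx> zs}" "length xs = j" "length ys = k"
    unfolding lyndon_heaps_eq by blast
  then have "length xs = length ys" using heq_refl heq_length by blast
  then show False using \<open>j \<noteq> k\<close> \<open>length xs = j\<close> \<open>length ys = k\<close> by simp
qed

lemma card_indep_sets:
  assumes W: "finite W" and n: "n \<le> N"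
  shows "euler_product (truncated_exponents (\<lambda>k. card (lyndon_heaps E W k)) N) $ n = int (card (indep_sets W n))"
proof (rule euler_product_coeff[where a = "\<lambda>n. card (heaps W n)" and b = "\<lambda>n. card (pyramids W n)"])
  show "n * card (heaps W n) = (\<Sum>k\<le>n. card (pyramids W k) * card (heaps W (n - k)))" for n
    by (rule heaps_recurrence[OF W])
  show "(\<Sum>j\<le>n. (-1) ^ j * int (card (indep_sets W j)) * int (card (heaps W (n - j)))) =
    (if n = 0 then 1 else 0)" for n by (rule cartier_foata[OF W])
  show "card (pyramids W n) = (\<Sum>d | d dvd n. d * card (lyndon_heaps E W d))" if "0 < n" for n
    using card_pyramids[OF W that] card_aperiodic_pyramids[OF W] by (simp add: card_lyndon_heaps)
  have "pyramids W 0 = {}" using pyramid_not_Nil by (auto simp: pyramids_def heaps_def)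
  then show "card (pyramids W 0) = 0" by simp
  have "indep_sets W 0 = {{}}" using finite_subset[OF _ W] by (auto simp: indep_sets_def)
  then show "card (indep_sets W 0) = 1" by simp
qed (rule n)

subsection \<open>The set colouring series\<close>

lemma Xbar_inclusion_exclusion:
  assumes V: "finite V" and EV: "\<And>u v. E u v \<Longrightarrow> u \<in> V \<and> v \<in> V" and al: "finmono \<alpha>"
  shows "Xbar V E \<alpha> =
    (\<Sum>W\<in>Pow V. (-1) ^ card (V - W) * (\<Prod>i\<in>supp \<alpha>. int (card (indep_sets W (\<alpha> i)))))"
proof -
  let ?S = "supp \<alpha>"
  define F where "F = (\<lambda>W. PiE ?S (\<lambda>i. indep_sets W (\<alpha> i)))"
  define u where "u = (\<lambda>f :: nat \<Rightarrow> 'a set. \<Union>i\<in>?S. f i)"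
  let ?K = "{\<kappa>. proper_set_coloring V E \<kappa> \<and> (\<forall>i. card {v\<in>V. i \<in> \<kappa> v} = \<alpha> i)}"
  note fin = finite_supp[OF al]
  have kap: "\<kappa> v \<subseteq> ?S" if "\<kappa> \<in> ?K" for \<kappa> v
  proof
    fix i assume i: "i \<in> \<kappa> v"
    then have "v \<in> V" using that by (auto simp: proper_set_coloring_def)
    then have "{v\<in>V. i \<in> \<kappa> v} \<noteq> {}" using i by blast
    then have "card {v\<in>V. i \<in> \<kappa> v} \<noteq> 0" using V by simp
    then show "i \<in> ?S" using that by (simp add: supp_def)
  qed
  \<comment> \<open>A colouring is replaced by its colour classes, indexed by the finitely many
    colours in the support of \<alpha>. Properness makes them independent, and
    \<open>u f = V\<close> says that each vertex gets a colour.\<close>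
  have "bij_betw (\<lambda>\<kappa>. \<lambda>i\<in>?S. {v\<in>V. i \<in> \<kappa> v}) ?K {f \<in> F V. u f = V}"
  proof (rule bij_betw_byWitness[where f' = "\<lambda>f v. {i\<in>?S. v \<in> f i}"])
    show "\<forall>\<kappa>\<in>?K. (\<lambda>v. {i\<in>?S. v \<in> (\<lambda>i\<in>?S. {v\<in>V. i \<in> \<kappa> v}) i}) = \<kappa>"
    proof
      fix \<kappa> assume k: "\<kappa> \<in> ?K"
      then have "\<kappa> v = {}" if "v \<notin> V" for v using that by (simp add: proper_set_coloring_def)
      then show "(\<lambda>v. {i\<in>?S. v \<in> (\<lambda>i\<in>?S. {v\<in>V. i \<in> \<kappa> v}) i}) = \<kappa>"
        using kap[OF k] by (auto simp: fun_eq_iff)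
    qed
    show "\<forall>f\<in>{f \<in> F V. u f = V}. (\<lambda>i\<in>?S. {v\<in>V. i \<in> {i\<in>?S. v \<in> f i}}) = f"
      by (fastforce simp: F_def indep_sets_def PiE_def Pi_def extensional_def fun_eq_iff restrict_def)
    show "(\<lambda>\<kappa>. \<lambda>i\<in>?S. {v\<in>V. i \<in> \<kappa> v}) ` ?K \<subseteq> {f \<in> F V. u f = V}"
    proof (intro subsetI, elim imageE)
      fix f \<kappa> assume k: "\<kappa> \<in> ?K" and f: "f = (\<lambda>i\<in>?S. {v\<in>V. i \<in> \<kappa> v})"
      have "f \<in> F V" using k unfolding f F_def indep_sets_def proper_set_coloring_def
        by (auto, blast)
      moreover have "u f = V"
      proof -
        have "\<exists>i\<in>?S. i \<in> \<kappa> v" if "v \<in> V" for v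
        proof -
          have "\<kappa> v \<noteq> {}" using that k by (simp add: proper_set_coloring_def)
          then show ?thesis using kap[OF k, of v] by blast
        qed
        then show ?thesis by (auto simp: u_def f)
      qed
      ultimately show "f \<in> {f \<in> F V. u f = V}" by simp
    qed
    show "(\<lambda>f v. {i\<in>?S. v \<in> f i}) ` {f \<in> F V. u f = V} \<subseteq> ?K"
    proof (intro subsetI, elim imageE)
      fix \<kappa> f assume f: "f \<in> {f \<in> F V. u f = V}" and \<kappa>: "\<kappa> = (\<lambda>v. {i\<in>?S. v \<in> f i})"
      have fi: "f i \<subseteq> V" "card (f i) = \<alpha> i" "\<And>a b. a \<in> f i \<Longrightarrow> b \<in> f i \<Longrightarrow> \<not> E a b" if "i \<in> ?S" for i
        using f that by (auto simp: F_def indep_sets_def)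
      have "{v\<in>V. i \<in> \<kappa> v} = (if i \<in> ?S then f i else {})" for i using fi(1) by (auto simp: \<kappa>)
      then have "card {v\<in>V. i \<in> \<kappa> v} = \<alpha> i" for i using fi(2) by (simp add: supp_def)
      moreover have "proper_set_coloring V E \<kappa>"
        unfolding proper_set_coloring_def using fi(1,3) f fin by (auto simp: \<kappa> u_def)
      ultimately show "\<kappa> \<in> ?K" by simp
    qed
  qed
  then have "Xbar V E \<alpha> = int (card {f \<in> F V. u f = V})"
    unfolding Xbar_def by (simp add: bij_betw_same_card)
  also have "\<dots> = (\<Sum>W\<in>Pow V. (-1) ^ card (V - W) * int (card {f \<in> F V. u f \<subseteq> W}))"
  proof (rule inclusion_exclusion_cover[OF _ V])
    show "finite (F V)" unfolding F_def using fin finite_indep_sets[OF V] by (intro finite_PiE) auto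
    show "u f \<subseteq> V" if "f \<in> F V" for f using that by (auto simp: F_def u_def indep_sets_def)
  qed
  also have "\<dots> = (\<Sum>W\<in>Pow V. (-1) ^ card (V - W) * (\<Prod>i\<in>?S. int (card (indep_sets W (\<alpha> i)))))"
  proof (rule sum.cong[OF refl])
    fix W assume "W \<in> Pow V"
    then have "{f \<in> F V. u f \<subseteq> W} = F W" by (fastforce simp: F_def u_def indep_sets_def PiE_def Pi_def)
    then show "(-1) ^ card (V - W) * int (card {f \<in> F V. u f \<subseteq> W}) =
      (-1) ^ card (V - W) * (\<Prod>i\<in>?S. int (card (indep_sets W (\<alpha> i))))"
      using fin by (simp add: F_def card_PiE)
  qed
  finally show ?thesis .
qed

lemma pbar_coeff_Xbar:
  assumes V: "finite V" and EV: "\<And>u v. E u v \<Longrightarrow> u \<in> V \<and> v \<in> V" and lam: "is_partition lam"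
  shows "pbar_coeff (Xbar V E) lam = (\<Sum>W\<in>Pow V. (-1) ^ card (V - W) *
    (\<Prod>k\<in>set_mset lam. signed_choice k (exponent (\<lambda>k. card (lyndon_heaps E W k)) k) (count lam k)))"
proof -
  define L where "L = (\<lambda>W k. card (lyndon_heaps E W k))"
  define c where "c = (\<lambda>lam. if is_partition lam then \<Sum>W\<in>Pow V. (-1) ^ card (V - W) *
    (\<Prod>k\<in>set_mset lam. signed_choice k (exponent (L W) k) (count lam k)) else 0)"
  have "is_pbar_expansion (Xbar V E) c"
    unfolding is_pbar_expansion_iff
  proof (intro conjI allI impI)
    fix \<alpha> assume al: "finmono \<alpha>"
    let ?N = "mdeg \<alpha>"
    have le: "\<alpha> i \<le> ?N" if "i \<in> supp \<alpha>" for i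
      unfolding mdeg_alt[OF finite_supp[OF al] order_refl]
      using that finite_supp[OF al] by (intro member_le_sum) auto
    have "Xbar V E \<alpha> = (\<Sum>W\<in>Pow V. (-1) ^ card (V - W) *
      mult_series (euler_product (truncated_exponents (L W) ?N)) \<alpha>)"
    proof -
      have X: "Xbar V E \<alpha> = (\<Sum>W\<in>Pow V. (-1) ^ card (V - W) * (\<Prod>i\<in>supp \<alpha>. int (card (indep_sets W (\<alpha> i)))))"
        by (rule Xbar_inclusion_exclusion[OF V _ al]) (rule EV)
      show ?thesis unfolding X mult_series_def
    proof (rule sum.cong[OF refl])
      fix W assume "W \<in> Pow V"
      then have W: "finite W" using finite_subset[OF _ V] by simp
      have "(\<Prod>i\<in>supp \<alpha>. int (card (indep_sets W (\<alpha> i)))) =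
        (\<Prod>i\<in>supp \<alpha>. euler_product (truncated_exponents (L W) ?N) $ \<alpha> i)"
        by (rule prod.cong[OF refl]) (simp add: card_indep_sets[OF W le] L_def)
      then show "(-1) ^ card (V - W) * (\<Prod>i\<in>supp \<alpha>. int (card (indep_sets W (\<alpha> i)))) =
        (-1) ^ card (V - W) * (\<Prod>i\<in>supp \<alpha>. euler_product (truncated_exponents (L W) ?N) $ \<alpha> i)"
        by simp
      qed
    qed
    also have "\<dots> = (\<Sum>W\<in>Pow V. (-1) ^ card (V - W) *
      pbar_sum (expansion_coeff (truncated_exponents (L W) ?N)) \<alpha>)"
      by (simp add: mult_series_euler_product[OF zero_notin_truncated_exponents al])
    also have "\<dots> = (\<Sum>lam\<in>partitions_le ?N. (\<Sum>W\<in>Pow V. (-1) ^ card (V - W) *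
      expansion_coeff (truncated_exponents (L W) ?N) lam) * pbar lam \<alpha>)"
      unfolding pbar_sum_def sum_distrib_left sum_distrib_right
      by (subst sum.swap) (simp add: mult.assoc)
    also have "\<dots> = pbar_sum c \<alpha>"
      unfolding pbar_sum_def
    proof (rule sum.cong[OF refl])
      fix mu assume "mu \<in> partitions_le ?N"
      then have mu: "is_partition mu" "sum_mset mu \<le> ?N" by (auto simp: partitions_le_def)
      \<comment> \<open>The cut-off depends on \<alpha>, but all parts of \<open>mu\<close> lie
        below it, so the resulting coefficient does not.\<close>
      have "expansion_coeff (truncated_exponents (L W) ?N) mu =
        (\<Prod>k\<in>set_mset mu. signed_choice k (exponent (L W) k) (count mu k))" for W
        unfolding expansion_coeff_def
      proof (rule prod.cong[OF refl])
        fix k assume "k \<in># mu"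
        then have "k \<in> {1..?N}" using partition_parts_bound(2)[OF mu(1)] mu(2) by fastforce
        then show "signed_choice k (count (truncated_exponents (L W) ?N) k) (count mu k) =
          signed_choice k (exponent (L W) k) (count mu k)"
          by (simp add: count_truncated_exponents)
      qed
      then show "(\<Sum>W\<in>Pow V. (-1) ^ card (V - W) * expansion_coeff (truncated_exponents (L W) ?N) mu) *
        pbar mu \<alpha> = c mu * pbar mu \<alpha>" by (simp add: c_def mu(1))
    qed
    finally show "Xbar V E \<alpha> = pbar_sum c \<alpha>" .
  qed (simp add: c_def)
  then show ?thesis using lam by (simp add: pbar_coeff_eqI c_def L_def)
qed

end

section \<open>Signs and the enumeration of families\<close>

lemma sum_mset_eq_sum_count:
  "finite A \<Longrightarrow> set_mset M \<subseteq> A \<Longrightarrow> sum_mset M = (\<Sum>k\<in>A. count M k * k)" for M :: "nat multiset"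
proof (induction M)
  case (add x M)
  have "(\<Sum>k\<in>A. count (add_mset x M) k * k) = (\<Sum>k\<in>A. count M k * k + (if k = x then x else 0))"
    by (intro sum.cong) auto
  also have "\<dots> = sum_mset M + x" using add by (simp add: sum.distrib)
  finally show ?case by simp
qed simp

text \<open>Modulo 2 the exponent is the sum of \<open>count lam k\<close> times k + 1, so only even
  parts contribute a sign.\<close>

lemma minus_one_power_partition:
  assumes "is_partition lam"
  shows "(-1 :: int) ^ (sum_mset lam - size lam) = (\<Prod>k\<in>set_mset lam. if odd k then 1 else (-1) ^ count lam k)"
proof -
  have le: "size lam \<le> sum_mset lam" by (rule partition_parts_bound(1)[OF assms])
  have "(-1 :: int) ^ (sum_mset lam - size lam) = (-1) ^ (sum_mset lam + size lam)"
    using le by (simp add: minus_one_power_iff)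
  also have "sum_mset lam + size lam = (\<Sum>k\<in>set_mset lam. count lam k * (k + 1))"
    by (simp add: sum_mset_eq_sum_count[of "set_mset lam"] size_multiset_overloaded_eq sum.distrib)
  also have "(-1 :: int) ^ \<dots> = (\<Prod>k\<in>set_mset lam. (-1) ^ (count lam k * (k + 1)))"
    by (simp add: power_sum)
  also have "\<dots> = (\<Prod>k\<in>set_mset lam. if odd k then 1 else (-1) ^ count lam k)"
    by (intro prod.cong refl) (auto simp: minus_one_power_iff)
  finally show ?thesis .
qed

text \<open>For even k the sign inside \<open>signed_choice\<close> meets its equal and
  cancels.\<close>

lemma signed_choice_sign:
  "(if odd k then 1 else (-1) ^ r) * signed_choice k (exponent L k) r =
    int (if odd k then L k choose r else if 4 dvd k then multichoose (L k) r
         else multichoose (L k + L (k div 2)) r)"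
proof -
  have "odd k \<Longrightarrow> k mod 4 \<noteq> 2" "4 dvd k \<Longrightarrow> k mod 4 \<noteq> 2" "even k \<Longrightarrow> \<not> 4 dvd k \<Longrightarrow> k mod 4 = 2"
    by presburger+
  then show ?thesis
    by (auto simp: signed_choice_def exponent_def simp flip: power_mult_distrib mult.assoc)
qed

definition admissible :: "('a::linorder \<Rightarrow> 'a \<Rightarrow> bool) \<Rightarrow> nat multiset \<Rightarrow> 'a set \<Rightarrow> nat \<Rightarrow> 'a list set multiset set" where
  "admissible E lam W k =
    (if odd k then {A. size A = count lam k \<and> set_mset A \<subseteq> lyndon_heaps E W k \<and> (\<forall>H. count A H \<le> 1)}
     else if 4 dvd k then multisets_of_size (lyndon_heaps E W k) (count lam k)
     else multisets_of_size (lyndon_heaps E W k \<union> lyndon_heaps E W (k div 2)) (count lam k))"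

definition families :: "('a::linorder \<Rightarrow> 'a \<Rightarrow> bool) \<Rightarrow> nat multiset \<Rightarrow> 'a set \<Rightarrow> (nat \<Rightarrow> 'a list set multiset) set" where
  "families E lam W = {M. M 0 = {#} \<and> (\<forall>k\<ge>1. M k \<in> admissible E lam W k)}"

definition used_vertices :: "(nat \<Rightarrow> 'a list set multiset) \<Rightarrow> 'a set" where
  "used_vertices M = (\<Union>k. \<Union>H\<in>set_mset (M k). heap_used H)"

lemma good_family_iff:
  "good_family V E lam M \<longleftrightarrow> M \<in> families E lam V \<and> V \<subseteq> used_vertices M"
proof -
  have adm: "M k \<in> admissible E lam V k \<longleftrightarrow>
    size (M k) = count lam k \<and>
    (odd k \<longrightarrow> set_mset (M k) \<subseteq> lyndon_heaps E V k \<and> (\<forall>H. count (M k) H \<le> 1)) \<and>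
    (4 dvd k \<longrightarrow> set_mset (M k) \<subseteq> lyndon_heaps E V k) \<and>
    (k mod 4 = 2 \<longrightarrow> set_mset (M k) \<subseteq> lyndon_heaps E V k \<union> lyndon_heaps E V (k div 2))" for k
  proof -
    have "odd k \<Longrightarrow> \<not> 4 dvd k \<and> k mod 4 \<noteq> 2" "4 dvd k \<Longrightarrow> k mod 4 \<noteq> 2"
      "even k \<Longrightarrow> \<not> 4 dvd k \<Longrightarrow> k mod 4 = 2" by presburger+
    then show ?thesis by (auto simp: admissible_def multisets_of_size_def)
  qed
  show ?thesis
    unfolding good_family_def families_def used_vertices_def mem_Collect_eq adm imp_conjR all_conj_distrib
    by (intro iffI; elim conjE; intro conjI; assumption)
qed

lemma card_distinct_multisets:
  assumes "finite A"
  shows "card {B. size B = n \<and> set_mset B \<subseteq> A \<and> (\<forall>x. count B x \<le> 1)} = card A choose n"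
proof -
  have "bij_betw mset_set {S. S \<subseteq> A \<and> card S = n} {B. size B = n \<and> set_mset B \<subseteq> A \<and> (\<forall>x. count B x \<le> 1)}"
  proof (rule bij_betw_byWitness[where f' = set_mset])
    show "\<forall>S\<in>{S. S \<subseteq> A \<and> card S = n}. set_mset (mset_set S) = S"
      using finite_subset[OF _ assms] by simp
    have B: "mset_set (set_mset B) = B" if "\<forall>x. count B x \<le> 1" for B :: "'a multiset"
    proof (rule multiset_eqI)
      fix x
      have "count B x \<le> 1" using that by blast
      then have "count B x = 0 \<or> count B x = 1" by linarith
      moreover have "count B x = 0 \<longleftrightarrow> x \<notin># B" by (simp add: not_in_iff)
      ultimately have "count B x = (if x \<in># B then 1 else 0)" by (metis one_neq_zero)
      then show "count (mset_set (set_mset B)) x = count B x" by (simp add: count_mset_set')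
    qed
    then show "\<forall>B\<in>{B. size B = n \<and> set_mset B \<subseteq> A \<and> (\<forall>x. count B x \<le> 1)}. mset_set (set_mset B) = B"
      by blast
    show "mset_set ` {S. S \<subseteq> A \<and> card S = n} \<subseteq> {B. size B = n \<and> set_mset B \<subseteq> A \<and> (\<forall>x. count B x \<le> 1)}"
      using finite_subset[OF _ assms] by (auto simp: count_mset_set')
    have "card (set_mset B) = size B" if "\<forall>x. count B x \<le> 1" for B :: "'a multiset"
      using B[OF that] by (metis size_mset_set)
    then show "set_mset ` {B. size B = n \<and> set_mset B \<subseteq> A \<and> (\<forall>x. count B x \<le> 1)} \<subseteq> {S. S \<subseteq> A \<and> card S = n}"
      by auto
  qed
  from bij_betw_same_card[OF this] show ?thesis using n_subsets[OF assms] by simp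
qed

context ordered_heap_graph
begin

lemma card_admissible:
  assumes "finite W" "0 < k"
  shows "card (admissible E lam W k) =
    (if odd k then card (lyndon_heaps E W k) choose count lam k
     else if 4 dvd k then multichoose (card (lyndon_heaps E W k)) (count lam k)
     else multichoose (card (lyndon_heaps E W k) + card (lyndon_heaps E W (k div 2))) (count lam k))"
proof -
  \<comment> \<open>Since k is positive, k and \<open>k div 2\<close> differ, and no Lyndon heap is
    counted for both sizes.\<close>
  have "card (lyndon_heaps E W k \<union> lyndon_heaps E W (k div 2)) =
    card (lyndon_heaps E W k) + card (lyndon_heaps E W (k div 2))"
    using assms(2) by (intro card_Un_disjoint finite_lyndon_heaps assms(1) lyndon_heaps_disjoint) simp
  then show ?thesis
    by (simp add: admissible_def card_distinct_multisets[OF finite_lyndon_heaps[OF assms(1)], simplified]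
        card_multisets_of_size finite_lyndon_heaps[OF assms(1)] multichoose_def)
qed

lemma finite_admissible:
  assumes "finite W"
  shows "finite (admissible E lam W k)"
proof (rule finite_subset)
  show "admissible E lam W k \<subseteq>
    multisets_of_size (lyndon_heaps E W k \<union> lyndon_heaps E W (k div 2)) (count lam k)"
    by (auto simp: admissible_def multisets_of_size_def)
qed (use finite_lyndon_heaps[OF assms] in auto)

text \<open>At an index that is not a part of \<open>lam\<close> only the empty multiset is
  admissible. So a family is determined by its values at the parts, and \<open>{#}\<close> is the
  default elsewhere.\<close>

lemma bij_families:
  assumes "is_partition lam"
  shows "bij_betw (\<lambda>M. restrict M (set_mset lam)) (families E lam W) (PiE (set_mset lam) (admissible E lam W))"
proof (rule bij_betw_byWitness[where f' = "\<lambda>g k. if k \<in># lam then g k else {#}"])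
  have e: "admissible E lam W k = {{#}}" if "k \<notin># lam" for k
    using that by (auto simp: admissible_def multisets_of_size_def not_in_iff)
  have pos: "1 \<le> k" if "k \<in># lam" for k using partition_parts_bound(2)[OF assms that] by simp
  show "\<forall>M\<in>families E lam W. (\<lambda>k. if k \<in># lam then restrict M (set_mset lam) k else {#}) = M"
  proof (intro ballI ext)
    fix M k assume M: "M \<in> families E lam W"
    show "(if k \<in># lam then restrict M (set_mset lam) k else {#}) = M k"
    proof (cases "k \<in># lam")
      case False
      then have "M k = {#}" using M e[OF False] by (cases k) (auto simp: families_def)
      then show ?thesis using False by simp
    qed simp
  qed
  show "\<forall>g\<in>PiE (set_mset lam) (admissible E lam W).
    restrict (\<lambda>k. if k \<in># lam then g k else {#}) (set_mset lam) = g"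
    by (auto simp: PiE_def extensional_def restrict_def fun_eq_iff)
  show "(\<lambda>M. restrict M (set_mset lam)) ` families E lam W \<subseteq> PiE (set_mset lam) (admissible E lam W)"
    using pos by (auto simp: families_def)
  show "(\<lambda>g k. if k \<in># lam then g k else {#}) ` PiE (set_mset lam) (admissible E lam W) \<subseteq> families E lam W"
    using assms e by (auto simp: families_def is_partition_def)
qed

lemma card_families:
  assumes "is_partition lam" "finite W"
  shows "card (families E lam W) = (\<Prod>k\<in>set_mset lam. card (admissible E lam W k))"
  using bij_betw_same_card[OF bij_families[OF assms(1)]] by (simp add: card_PiE)

lemma finite_families:
  assumes "is_partition lam" "finite W"
  shows "finite (families E lam W)"
  unfolding bij_betw_finite[OF bij_families[OF assms(1)]]
  by (intro finite_PiE finite_admissible assms(2)) simp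

lemma families_used:
  assumes "W \<subseteq> V"
  shows "families E lam W = {M \<in> families E lam V. used_vertices M \<subseteq> W}"
proof -
  note LH = lyndon_heaps_subset[OF assms]
  have "A \<in> admissible E lam W k \<longleftrightarrow> A \<in> admissible E lam V k \<and> (\<forall>H\<in>#A. heap_used H \<subseteq> W)" for A k
    unfolding admissible_def multisets_of_size_def LH[of k] LH[of "k div 2"] by auto
  moreover have "used_vertices M \<subseteq> W \<longleftrightarrow> (\<forall>k\<ge>1. \<forall>H\<in>#M k. heap_used H \<subseteq> W)" if "M 0 = {#}" for M
  proof -
    have "(\<forall>k. \<forall>H\<in>#M k. heap_used H \<subseteq> W) \<longleftrightarrow> (\<forall>k\<ge>1. \<forall>H\<in>#M k. heap_used H \<subseteq> W)"
      using that by (metis One_nat_def Suc_leI empty_iff neq0_conv set_mset_empty)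
    then show ?thesis by (auto simp: used_vertices_def)
  qed
  ultimately show ?thesis unfolding families_def by blast
qed

text \<open>Requiring all vertices to be used produces an alternating sum over W of the same shape
  as for \<open>Xbar\<close>, so the two can be matched term by term.\<close>

lemma card_good_families:
  assumes "is_partition lam" "finite V"
  shows "int (card {M. good_family V E lam M}) =
    (\<Sum>W\<in>Pow V. (-1) ^ card (V - W) * (\<Prod>k\<in>set_mset lam. int (card (admissible E lam W k))))"
proof -
  have used: "used_vertices M \<subseteq> V" if "M \<in> families E lam V" for M
    using families_used[of V V lam] that by blast
  then have "{M. good_family V E lam M} = {M \<in> families E lam V. used_vertices M = V}"
    unfolding good_family_iff by blast
  then have "int (card {M. good_family V E lam M}) =
    (\<Sum>W\<in>Pow V. (-1) ^ card (V - W) * int (card {M \<in> families E lam V. used_vertices M \<subseteq> W}))"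
    using inclusion_exclusion_cover[OF finite_families[OF assms] assms(2), of used_vertices] used by simp
  also have "\<dots> = (\<Sum>W\<in>Pow V. (-1) ^ card (V - W) * (\<Prod>k\<in>set_mset lam. int (card (admissible E lam W k))))"
  proof (rule sum.cong[OF refl])
    fix W assume "W \<in> Pow V"
    then show "(-1) ^ card (V - W) * int (card {M \<in> families E lam V. used_vertices M \<subseteq> W}) =
      (-1) ^ card (V - W) * (\<Prod>k\<in>set_mset lam. int (card (admissible E lam W k)))"
      using families_used[of W V lam] card_families[OF assms(1), of W] finite_subset[OF _ assms(2)] by simp
  qed
  finally show ?thesis .
qed

end

theorem theorem1p4:
  fixes V :: "'a::linorder set" and E :: "'a \<Rightarrow> 'a \<Rightarrow> bool" and lam :: "nat multiset"
  assumes "simple_graph V E" and "is_partition lam"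
  shows "(-1) ^ (sum_mset lam - size lam) * pbar_coeff (Xbar V E) lam
           = int (card {M. good_family V E lam M})
       \<and> (-1) ^ (sum_mset lam - size lam) * pbar_coeff (Xbar V E) lam
           = (\<Sum>W\<in>Pow V. (-1) ^ card (V - W) *
               (\<Prod>k\<in>set_mset lam.
                  int (if odd k then card (lyndon_heaps E W k) choose count lam k
                       else if 4 dvd k then multichoose (card (lyndon_heaps E W k)) (count lam k)
                       else multichoose (card (lyndon_heaps E W k) + card (lyndon_heaps E W (k div 2)))
                                        (count lam k))))"
proof -
  let ?f = "\<lambda>W k. if odd k then card (lyndon_heaps E W k) choose count lam k
    else if 4 dvd k then multichoose (card (lyndon_heaps E W k)) (count lam k)
    else multichoose (card (lyndon_heaps E W k) + card (lyndon_heaps E W (k div 2))) (count lam k)"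
  interpret ordered_heap_graph E
    by unfold_locales (use assms(1) in \<open>auto simp: simple_graph_def\<close>)
  have V: "finite V" and EV: "\<And>u v. E u v \<Longrightarrow> u \<in> V \<and> v \<in> V"
    using assms(1) by (auto simp: simple_graph_def)
  have coeff: "pbar_coeff (Xbar V E) lam = (\<Sum>W\<in>Pow V. (-1) ^ card (V - W) *
    (\<Prod>k\<in>set_mset lam. signed_choice k (exponent (\<lambda>k. card (lyndon_heaps E W k)) k) (count lam k)))"
    by (rule pbar_coeff_Xbar[OF V _ assms(2)]) (rule EV)
  have "(-1) ^ (sum_mset lam - size lam) *
    (\<Prod>k\<in>set_mset lam. signed_choice k (exponent (\<lambda>k. card (lyndon_heaps E W k)) k) (count lam k)) =
    (\<Prod>k\<in>set_mset lam. int (?f W k))" for W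
    unfolding minus_one_power_partition[OF assms(2)] prod.distrib[symmetric] signed_choice_sign ..
  then have 1: "(-1) ^ (sum_mset lam - size lam) * pbar_coeff (Xbar V E) lam = (\<Sum>W\<in>Pow V. (-1) ^ card (V - W) * (\<Prod>k\<in>set_mset lam. int (?f W k)))"
    unfolding coeff sum_distrib_left by (intro sum.cong refl) (simp add: mult.left_commute)
  have "card (admissible E lam W k) = ?f W k" if "W \<in> Pow V" "k \<in># lam" for W k
    using card_admissible[of W k lam] finite_subset[OF _ V] partition_parts_bound(2)[OF assms(2)] that by auto
  then have "int (card {M. good_family V E lam M}) = (\<Sum>W\<in>Pow V. (-1) ^ card (V - W) * (\<Prod>k\<in>set_mset lam. int (?f W k)))"
    unfolding card_good_families[OF assms(2) V] by (intro sum.cong refl) simp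
  with 1 show ?thesis by simp
qed

end
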